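(* Let $F\in S$ be a homogeneous polynomial such that \[F^\perp=(q^a,g_1,\ldots,g_n)\] is a complete intersection with $q,g_1,\ldots,g_n$ homogeneous, $a\geq 2$, $e=\deg q>0$ and $ae \leq d_1=\deg g_1\leq\cdots \leq d_n=\deg g_n$. Then $F$ is $e$-computable, its rank is computed by $q$, and \[\mathrm{rk} (F)=\prod_{i=1}^n d_i=\frac1e \sum_{i=0}^\infty HF\big(T/((F^\perp:(q)) + (q)),i \big).\]
   Context: $k$ is algebraically closed of characteristic zero, $S=k[x_0,\ldots,x_n]$, $T=k[X_0,\ldots,X_n]$ acting on $S$ by differentiation ($X_i\circ F=\partial F/\partial x_i$), $F^\perp=\{g\in T:g\circ F=0\}$, $HF(T/J,i)=\dim_kT_i-\dim_kJ_i$, and $\mathrm{rk}(F)$ is the least $r$ with $F=\sum_{j=1}^rL_j^{\deg F}$, $L_j\in S_1$. A form $F$ is $e$-computable if there is a homogeneous ideal $I\subset T$ generated in degree $e$ such that for a general $t\in I_e$ (i.e. $t$ in a nonempty Zariski-open subset of $I_e$) $\mathrm{rk}(F)=\frac1e\sum_{i=0}^\infty HF(T/((F^\perp:I)+(t)),i)$; "the rank is computed by $q$" means this holds with $I=(q)$ (so the general element of $I_e$ is a nonzero multiple of $q$). *)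

theory Defs
  imports "HOL-Library.Poly_Mapping" "HOL-Library.Cardinality" "HOL-Computational_Algebra.Polynomial"
begin

text \<open>Polynomials over a field 'k in variables indexed by a finite type 'v
  (CARD('v) = n+1 variables).  A monomial is a finitely supported exponent
  vector; a polynomial is a finitely supported map from monomials
  to coefficients.  Both S = k[x_0..x_n] and T = k[X_0..X_n] are modelled by this type.\<close>

type_synonym ('v, 'k) mpoly = "('v \<Rightarrow>\<^sub>0 nat) \<Rightarrow>\<^sub>0 'k"

definition alg_closed_field :: "'k::field itself \<Rightarrow> bool" where
  "alg_closed_field _ \<longleftrightarrow> (\<forall>p :: 'k poly. degree p > 0 \<longrightarrow> (\<exists>x. poly p x = 0))"

definition mdeg :: "('v \<Rightarrow>\<^sub>0 nat) \<Rightarrow> nat" where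
  "mdeg m = (\<Sum>v\<in>Poly_Mapping.keys m. Poly_Mapping.lookup m v)"

text \<open>Homogeneous of degree d (the zero polynomial is homogeneous of every degree).\<close>
definition homog :: "nat \<Rightarrow> ('v, 'k::zero) mpoly \<Rightarrow> bool" where
  "homog d p \<longleftrightarrow> (\<forall>m\<in>Poly_Mapping.keys p. mdeg m = d)"

definition tdeg :: "('v, 'k::zero) mpoly \<Rightarrow> nat" where
  "tdeg p = (if p = 0 then 0 else Max (mdeg ` Poly_Mapping.keys p))"

definition smult_mp :: "'k::field \<Rightarrow> ('v, 'k) mpoly \<Rightarrow> ('v, 'k) mpoly" where
  "smult_mp c p = Poly_Mapping.map (\<lambda>x. c * x) p"

text \<open>Apolar (contraction-by-differentiation) action: the differential operator
  X^m applied to x^\<alpha> gives (\<Prod>_i \<alpha>_i!/(\<alpha>_i-m_i)!) x^(\<alpha>-m) if m \<le> \<alpha>, else 0.\<close>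
definition mon_le :: "('v \<Rightarrow>\<^sub>0 nat) \<Rightarrow> ('v \<Rightarrow>\<^sub>0 nat) \<Rightarrow> bool" where
  "mon_le m a \<longleftrightarrow> (\<forall>v. Poly_Mapping.lookup m v \<le> Poly_Mapping.lookup a v)"

definition diff_mon :: "('v \<Rightarrow>\<^sub>0 nat) \<Rightarrow> ('v, 'k::field_char_0) mpoly \<Rightarrow> ('v, 'k) mpoly" where
  "diff_mon m F = (\<Sum>a\<in>Poly_Mapping.keys F. if mon_le m a then
      Poly_Mapping.single (a - m)
        (Poly_Mapping.lookup F a * of_nat (\<Prod>v\<in>Poly_Mapping.keys a. fact (Poly_Mapping.lookup a v) div fact (Poly_Mapping.lookup a v - Poly_Mapping.lookup m v)))
      else 0)"

definition apolar :: "('v, 'k::field_char_0) mpoly \<Rightarrow> ('v, 'k) mpoly \<Rightarrow> ('v, 'k) mpoly" where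
  "apolar g F = (\<Sum>m\<in>Poly_Mapping.keys g. smult_mp (Poly_Mapping.lookup g m) (diff_mon m F))"

definition perp :: "('v, 'k::field_char_0) mpoly \<Rightarrow> ('v, 'k) mpoly set" where
  "perp F = {g. apolar g F = 0}"

definition ideal_gen :: "'a::comm_ring_1 set \<Rightarrow> 'a set" where
  "ideal_gen G = {x. \<exists>I r. finite I \<and> I \<subseteq> G \<and> x = (\<Sum>i\<in>I. r i * i)}"

definition colon :: "'a::comm_ring_1 set \<Rightarrow> 'a set \<Rightarrow> 'a set" where
  "colon J I = {g. \<forall>h\<in>I. g * h \<in> J}"

definition ideal_sum :: "'a::comm_ring_1 set \<Rightarrow> 'a set \<Rightarrow> 'a set" where
  "ideal_sum J K = ideal_gen (J \<union> K)"

definition graded_part :: "nat \<Rightarrow> ('v, 'k::zero) mpoly set \<Rightarrow> ('v, 'k) mpoly set" where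
  "graded_part i J = {f\<in>J. homog i f}"

definition HF :: "('v, 'k::field) mpoly set \<Rightarrow> nat \<Rightarrow> nat" where
  "HF J i = vector_space.dim smult_mp (graded_part i (UNIV :: ('v, 'k) mpoly set))
            - vector_space.dim smult_mp (graded_part i J)"

definition regular_sequence :: "'a::comm_ring_1 list \<Rightarrow> bool" where
  "regular_sequence fs \<longleftrightarrow> 1 \<notin> ideal_gen (set fs) \<and>
     (\<forall>j<length fs. \<forall>h. h * fs ! j \<in> ideal_gen (set (take j fs)) \<longrightarrow> h \<in> ideal_gen (set (take j fs)))"

definition waring_rank :: "('v, 'k::field) mpoly \<Rightarrow> nat" where
  "waring_rank F = (LEAST r. \<exists>L. (\<forall>j<r. homog 1 (L j)) \<and> F = (\<Sum>j<r. L j ^ tdeg F))"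

definition mp_eval :: "('w, 'k::comm_ring_1) mpoly \<Rightarrow> ('w \<Rightarrow> 'k) \<Rightarrow> 'k" where
  "mp_eval P x = (\<Sum>m\<in>Poly_Mapping.keys P. Poly_Mapping.lookup P m * (\<Prod>w\<in>Poly_Mapping.keys m. x w ^ Poly_Mapping.lookup m w))"

text \<open>A property holds for a general element of a finite-dimensional subspace W of T
  (a set of polynomials), i.e. on a nonempty Zariski-open subset of W.  Polynomial
  functions on W are restrictions of polynomials in the monomial coordinates of T; a
  nonempty Zariski-open subset of W contains a nonempty basic open set W \<inter> D(\<Phi>), and
  conversely each such set is open.\<close>
definition general_in :: "('v, 'k::field) mpoly set \<Rightarrow> (('v, 'k) mpoly \<Rightarrow> bool) \<Rightarrow> bool" where
  "general_in W P \<longleftrightarrow> (\<exists>\<Phi> :: ('v \<Rightarrow>\<^sub>0 nat, 'k) mpoly.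
      (\<exists>t\<in>W. mp_eval \<Phi> (Poly_Mapping.lookup t) \<noteq> 0) \<and>
      (\<forall>t\<in>W. mp_eval \<Phi> (Poly_Mapping.lookup t) \<noteq> 0 \<longrightarrow> P t))"

definition rank_computed_by :: "('v, 'k::field_char_0) mpoly \<Rightarrow> ('v, 'k) mpoly set \<Rightarrow> nat \<Rightarrow> bool" where
  "rank_computed_by F I e \<longleftrightarrow> general_in (graded_part e I) (\<lambda>t.
      real (waring_rank F) =
        suminf (\<lambda>i. real (HF (ideal_sum (colon (perp F) I) (ideal_gen {t})) i)) / real e)"

definition e_computable :: "('v, 'k::field_char_0) mpoly \<Rightarrow> nat \<Rightarrow> bool" where
  "e_computable F e \<longleftrightarrow> (\<exists>G. (\<forall>g\<in>G. homog e g) \<and> rank_computed_by F (ideal_gen G) e)"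

end

(* Lower bound: if F is a sum of r powers of linear forms, let I' be the ideal of those of the r points
   at which q does not vanish. Then I' q annihilates F, so I' lies in (perp F : q), and since q is a
   nonzerodivisor modulo I', the Hilbert function of T/(I' + (q)) telescopes to a sum of at most e r.
   As (perp F : q) + (q) = (q, g_1, ..., g_n) is a complete intersection, its Hilbert function sums to
   e d_1 ... d_n, whence r >= d_1 ... d_n.

   Upper bound: replace g_i by g_i + h_i q^a with general h_i of degree d_i - a e. This changes neither
   perp F nor regularity, and the deformed g_i cut out d_1 ... d_n points away from q = 0. If the deformed
   ideal contains every form vanishing on these points, then by apolarity F is a combination of at most
   d_1 ... d_n powers of linear forms.
   That property is obtained without Bertini's theorem: counting monomials shows that every coordinate x
   satisfies a polynomial relation over the coefficients of the h_i. For a relation of minimal degree the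
   derivative at x is nonzero in characteristic zero, hence divides, up to denominators, a nonzero polynomial
   in these coefficients. For coefficients outside its zero set, x satisfies a separable polynomial modulo
   the deformed ideal, and an ideal containing a split separable polynomial in each variable is
   the ideal of its zeros. *)
theory Submission
  imports Defs "HOL-Computational_Algebra.Polynomial_FPS" "HOL-Library.Countable"
begin

section \<open>Ideals\<close>

text \<open>The obstacle is the upper bound: reducedness of the deformed complete intersection away
  from q = 0 has to come out of a dimension count. Cutting the cone over the points by q = t, t
  nonzero, makes it a finite set of affine points and q a unit; no homogeneous information is lost,
  as q is a nonzerodivisor modulo the deformed forms. The h_i are only diagonal, sum_w c_(i,w)
  X_w^(d_i - a e). On the chart X_v != 0 the equation g_i + h_i q^a = 0 gives c_(i,v) as a fraction
  with denominator q^a X_v^(d_i - a e), so the n+1 coordinates of the point and the n^2 other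
  coefficients are free there. The data to be specialised are t and the n(n+1) coefficients. Both
  counts are n(n+1) + 1; having no more free coordinates than data forces the algebraic relations.
  The charts together suffice because a high power of q lies in the ideal (X_0^L, ..., X_n^L). The
  condition a e <= d_i makes the degree of h_i meaningful; a >= 2 makes q^(a-1) vanish modulo q and
  keeps linear forms out of perp F.\<close>

lemma ring_module: "module ((*) :: 'a::comm_ring_1 \<Rightarrow> 'a \<Rightarrow> 'a)"
  by unfold_locales (auto simp: algebra_simps)

lemma ideal_gen_eq_span: "ideal_gen G = module.span (*) G"
  unfolding ideal_gen_def module.span_explicit[OF ring_module] by auto

definition is_ideal :: "'a::comm_ring_1 set \<Rightarrow> bool" where
  "is_ideal I \<longleftrightarrow> module.subspace (*) I"

lemma is_ideal_ideal_gen [simp, intro]: "is_ideal (ideal_gen G)"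
  unfolding is_ideal_def ideal_gen_eq_span by (rule module.subspace_span[OF ring_module])

lemma is_idealI:
  assumes "0 \<in> I" "\<And>x y. x \<in> I \<Longrightarrow> y \<in> I \<Longrightarrow> x + y \<in> I" "\<And>r x. x \<in> I \<Longrightarrow> r * x \<in> I"
  shows "is_ideal I"
  using assms unfolding is_ideal_def module.subspace_def[OF ring_module] by auto

lemma ideal_0: "is_ideal I \<Longrightarrow> 0 \<in> I"
  unfolding is_ideal_def by (rule module.subspace_0[OF ring_module])

lemma ideal_add: "is_ideal I \<Longrightarrow> x \<in> I \<Longrightarrow> y \<in> I \<Longrightarrow> x + y \<in> I"
  unfolding is_ideal_def by (rule module.subspace_add[OF ring_module])

lemma ideal_mult_left: "is_ideal I \<Longrightarrow> x \<in> I \<Longrightarrow> r * x \<in> I"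
  unfolding is_ideal_def by (rule module.subspace_scale[OF ring_module])

lemma ideal_diff: "is_ideal I \<Longrightarrow> x \<in> I \<Longrightarrow> y \<in> I \<Longrightarrow> x - y \<in> I"
  unfolding is_ideal_def by (rule module.subspace_diff[OF ring_module])

lemma ideal_sum_mem: "is_ideal I \<Longrightarrow> (\<And>a. a \<in> A \<Longrightarrow> f a \<in> I) \<Longrightarrow> sum f A \<in> I"
  unfolding is_ideal_def by (rule module.subspace_sum[OF ring_module])

lemma ideal_mult_right: "is_ideal I \<Longrightarrow> x \<in> I \<Longrightarrow> x * r \<in> I"
  using ideal_mult_left[of I x r] by (simp add: mult.commute)

lemma ideal_gen_minimal: "G \<subseteq> I \<Longrightarrow> is_ideal I \<Longrightarrow> ideal_gen G \<subseteq> I"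
  unfolding is_ideal_def ideal_gen_eq_span by (rule module.span_minimal[OF ring_module])

lemma ideal_gen_superset: "G \<subseteq> ideal_gen G"
  unfolding ideal_gen_eq_span by (rule module.span_superset[OF ring_module])

lemma ideal_gen_base: "x \<in> G \<Longrightarrow> x \<in> ideal_gen G"
  using ideal_gen_superset by auto

lemma ideal_gen_mono: "G \<subseteq> H \<Longrightarrow> ideal_gen G \<subseteq> ideal_gen H"
  unfolding ideal_gen_eq_span by (rule module.span_mono[OF ring_module])

lemma ideal_gen_empty [simp]: "ideal_gen {} = {0}"
  unfolding ideal_gen_eq_span by (rule module.span_empty[OF ring_module])

lemma ideal_gen_insert_iff: "x \<in> ideal_gen (insert a S) \<longleftrightarrow> (\<exists>k. x - k * a \<in> ideal_gen S)"
  unfolding ideal_gen_eq_span by (rule module.span_breakdown_eq[OF ring_module])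

lemma ideal_gen_singleton_iff: "x \<in> ideal_gen {a} \<longleftrightarrow> (\<exists>k. x = k * a)"
  by (simp add: ideal_gen_insert_iff)

lemma ideal_gen_eqI: "G \<subseteq> ideal_gen H \<Longrightarrow> H \<subseteq> ideal_gen G \<Longrightarrow> ideal_gen G = ideal_gen H"
  unfolding ideal_gen_eq_span by (simp add: module.span_eq[OF ring_module])

lemma ideal_sum_ideal_gen: "ideal_sum (ideal_gen A) (ideal_gen B) = ideal_gen (A \<union> B)"
  unfolding ideal_sum_def
proof (rule ideal_gen_eqI)
  show "ideal_gen A \<union> ideal_gen B \<subseteq> ideal_gen (A \<union> B)"
    by (intro Un_least ideal_gen_mono) simp_all
  show "A \<union> B \<subseteq> ideal_gen (ideal_gen A \<union> ideal_gen B)"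
    by (meson Un_iff Un_mono ideal_gen_superset subset_iff)
qed

section \<open>Nonzerodivisors modulo an ideal\<close>

definition nzd_mod :: "'a::comm_ring_1 \<Rightarrow> 'a set \<Rightarrow> bool" where
  "nzd_mod x I \<longleftrightarrow> (\<forall>h. h * x \<in> I \<longrightarrow> h \<in> I)"

lemma nzd_modD: "nzd_mod x I \<Longrightarrow> h * x \<in> I \<Longrightarrow> h \<in> I"
  by (auto simp: nzd_mod_def)

text \<open>If h x lies in I then so does h x^k; this is how q inherits regularity from q^a.\<close>

lemma nzd_mod_powerD:
  assumes "is_ideal I" "nzd_mod (x ^ k) I" "k > 0"
  shows "nzd_mod x I"
  unfolding nzd_mod_def
proof (intro allI impI)
  fix h assume "h * x \<in> I"
  then have "h * x * x ^ (k - 1) \<in> I" using assms(1) by (rule ideal_mult_right[rotated])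
  moreover have "h * x * x ^ (k - 1) = h * x ^ k"
    using assms(3) by (simp add: power_eq_if[of x k] mult.assoc)
  ultimately show "h \<in> I" using assms(2) by (auto dest: nzd_modD)
qed

section \<open>Polynomials and their homogeneous components\<close>

abbreviation lkp where "lkp \<equiv> Poly_Mapping.lookup"
abbreviation keys where "keys \<equiv> Poly_Mapping.keys"

definition cst :: "'k::zero \<Rightarrow> ('v, 'k) mpoly" where
  "cst c = Poly_Mapping.single 0 c"

definition mvar :: "'v \<Rightarrow> ('v, 'k::zero_neq_one) mpoly" where
  "mvar v = Poly_Mapping.single (Poly_Mapping.single v 1) 1"

lemma cst_0 [simp]: "cst 0 = 0" and cst_1 [simp]: "cst 1 = 1"
  and cst_add: "cst (c + c') = cst c + cst c'"
  and cst_mult: "cst (d * d') = cst d * cst d'"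
  by (simp_all add: cst_def single_add mult_single)

lemma cst_diff: "cst (c - c' :: 'k::ab_group_add) = cst c - cst c'"
  and cst_uminus: "cst (- c) = - cst c"
  by (simp_all add: cst_def single_diff single_uminus)

lemma cst_power: "cst (c ^ n :: 'k::comm_ring_1) = cst c ^ n"
  by (induction n) (auto simp: cst_mult)

lemma cst_sum: "cst (sum f A :: 'k::comm_ring_1) = (\<Sum>x\<in>A. cst (f x))"
  by (induction A rule: infinite_finite_induct) (auto simp: cst_add)

lemma cst_prod: "cst (prod f A :: 'k::comm_ring_1) = (\<Prod>x\<in>A. cst (f x))"
  by (induction A rule: infinite_finite_induct) (auto simp: cst_mult)

lemma smult_mp_conv: "smult_mp c p = cst c * p"
  by (simp add: smult_mp_def cst_def mult_map_scale_conv_mult)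

lemma lookup_cst_mult [simp]: "lkp (cst c * p) m = c * lkp p m" for c :: "'k::field"
  unfolding smult_mp_conv[symmetric] smult_mp_def
  by (simp add: Poly_Mapping.map.rep_eq when_def)

lemma lookup_smult_mp [simp]: "lkp (smult_mp c p) m = c * lkp p m"
  by (simp add: smult_mp_conv)

lemma poly_mapping_sum_singles:
  assumes "finite A" "keys p \<subseteq> A"
  shows "p = (\<Sum>m\<in>A. Poly_Mapping.single m (lkp p m))"
proof (rule poly_mapping_eqI)
  fix k
  have "lkp (\<Sum>m\<in>A. Poly_Mapping.single m (lkp p m)) k = (\<Sum>m\<in>A. if k = m then lkp p m else 0)"
    unfolding lookup_sum by (intro sum.cong) (auto simp: lookup_single when_def)
  also have "\<dots> = lkp p k" using assms by (auto simp: sum.delta in_keys_iff)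
  finally show "lkp p k = lkp (\<Sum>m\<in>A. Poly_Mapping.single m (lkp p m)) k" by simp
qed

lemma mdeg_conv: "mdeg (m :: 'v::finite \<Rightarrow>\<^sub>0 nat) = (\<Sum>v\<in>UNIV. lkp m v)"
  unfolding mdeg_def by (intro sum.mono_neutral_left) (auto simp: in_keys_iff)

lemma mdeg_add: "mdeg (m + m' :: 'v::finite \<Rightarrow>\<^sub>0 nat) = mdeg m + mdeg m'"
  by (simp add: mdeg_conv lookup_add sum.distrib)

lemma mdeg_0 [simp]: "mdeg 0 = 0"
  by (simp add: mdeg_def)

lemma mdeg_single [simp]: "mdeg (Poly_Mapping.single v k) = k"
  by (simp add: mdeg_def)

lemma lookup_le_mdeg: "lkp m v \<le> mdeg m" for m :: "'v::finite \<Rightarrow>\<^sub>0 nat"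
  unfolding mdeg_conv by (rule member_le_sum) auto

lemma finite_mdeg: "finite {m :: 'v::finite \<Rightarrow>\<^sub>0 nat. mdeg m = d}"
proof -
  have "lkp ` {m :: 'v \<Rightarrow>\<^sub>0 nat. mdeg m = d} \<subseteq> {f. \<forall>v. (v \<in> UNIV \<longrightarrow> f v \<in> {..d}) \<and> (v \<notin> UNIV \<longrightarrow> f v = 0)}"
    using lookup_le_mdeg by auto
  moreover have "finite {f :: 'v \<Rightarrow> nat. \<forall>v. (v \<in> UNIV \<longrightarrow> f v \<in> {..d}) \<and> (v \<notin> UNIV \<longrightarrow> f v = 0)}"
    by (rule finite_set_of_finite_funs) simp_all
  ultimately have "finite (lkp ` {m :: 'v \<Rightarrow>\<^sub>0 nat. mdeg m = d})" by (rule finite_subset)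
  then show ?thesis by (rule finite_imageD) (simp add: inj_on_def lookup_inject)
qed

lemma homog_0 [simp]: "homog d 0"
  by (simp add: homog_def)

lemma homog_iff: "homog d p \<longleftrightarrow> (\<forall>m. lkp p m \<noteq> 0 \<longrightarrow> mdeg m = d)"
  by (auto simp: homog_def in_keys_iff)

lemma homog_add: "homog d p \<Longrightarrow> homog d q \<Longrightarrow> homog d (p + q)"
  for p q :: "('v, 'k::field) mpoly"
  unfolding homog_iff lookup_add by (metis add_0)

lemma homog_mult: "homog d p \<Longrightarrow> homog d' q \<Longrightarrow> homog (d + d') (p * q)"
  for p q :: "('v::finite, 'k::field) mpoly"
  unfolding homog_def using keys_mult[of p q] by (fastforce simp: mdeg_add)

lemma homog_1 [simp]: "homog 0 (1 :: ('v, 'k::field) mpoly)"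
  by (simp add: homog_def)

lemma homog_cst [simp]: "homog 0 (cst c)"
  by (simp add: homog_def cst_def)

lemma homog_cst_mult: "homog d p \<Longrightarrow> homog d (cst c * p)"
  for p :: "('v::finite, 'k::field) mpoly"
  using homog_mult[of 0 "cst c" d p] by simp

lemma homog_mvar [simp]: "homog 1 (mvar v)"
  by (simp add: homog_def mvar_def)

lemma homog_power: "homog d p \<Longrightarrow> homog (d * k) (p ^ k)"
  for p :: "('v::finite, 'k::field) mpoly"
  by (induction k) (auto intro: homog_mult)

lemma homog_sum: "(\<And>x. x \<in> A \<Longrightarrow> homog d (f x)) \<Longrightarrow> homog d (sum f A)"
  for f :: "'a \<Rightarrow> ('v, 'k::field) mpoly"
  by (induction A rule: infinite_finite_induct) (auto intro: homog_add)

section \<open>Homogeneous components and graded ideals\<close>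

definition hcomp :: "nat \<Rightarrow> ('v, 'k::zero) mpoly \<Rightarrow> ('v, 'k) mpoly" where
  "hcomp d p = Poly_Mapping.mapp (\<lambda>m c. if mdeg m = d then c else 0) p"

lemma lookup_hcomp: "lkp (hcomp d p) m = (if mdeg m = d then lkp p m else 0)"
  by (auto simp: hcomp_def lookup_mapp when_def in_keys_iff)

lemma homog_hcomp [simp]: "homog d (hcomp d p)"
  by (auto simp: homog_iff lookup_hcomp split: if_splits)

lemma hcomp_homog: "homog d p \<Longrightarrow> hcomp d' p = (if d' = d then p else 0)"
  by (rule poly_mapping_eqI) (auto simp: lookup_hcomp homog_iff)

lemma hcomp_hcomp [simp]: "hcomp d (hcomp d p) = hcomp d p"
  by (simp add: hcomp_homog[OF homog_hcomp])

lemma hcomp_0 [simp]: "hcomp d 0 = 0"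
  by (rule poly_mapping_eqI) (simp add: lookup_hcomp)

lemma hcomp_add: "hcomp d (p + q) = hcomp d p + hcomp d q"
  for p q :: "('v, 'k::field) mpoly"
  by (rule poly_mapping_eqI) (auto simp: lookup_hcomp lookup_add)

lemma hcomp_diff: "hcomp d (p - q) = hcomp d p - hcomp d q"
  for p q :: "('v, 'k::field) mpoly"
  by (rule poly_mapping_eqI) (auto simp: lookup_hcomp lookup_minus)

lemma hcomp_sum: "hcomp d (sum f A) = (\<Sum>x\<in>A. hcomp d (f x))"
  for f :: "'a \<Rightarrow> ('v, 'k::field) mpoly"
  by (induction A rule: infinite_finite_induct) (auto simp: hcomp_add)

lemma sum_hcomp:
  fixes p :: "('v, 'k::field) mpoly"
  assumes "finite A" "mdeg ` keys p \<subseteq> A"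
  shows "(\<Sum>d\<in>A. hcomp d p) = p"
proof (rule poly_mapping_eqI)
  fix m
  have "lkp (\<Sum>d\<in>A. hcomp d p) m = (\<Sum>d\<in>A. if mdeg m = d then lkp p m else 0)"
    by (simp add: lookup_sum lookup_hcomp)
  also have "\<dots> = lkp p m" using assms by (auto simp: in_keys_iff image_subset_iff)
  finally show "lkp (\<Sum>d\<in>A. hcomp d p) m = lkp p m" .
qed

lemma sum_hcomp_ex: "\<exists>N. (\<Sum>d\<le>N. hcomp d p) = p \<and> (\<forall>d>N. hcomp d p = 0)" for p :: "('v, 'k::field) mpoly"
proof -
  define N where "N = Max (insert 0 (mdeg ` keys p))"
  have N: "mdeg m \<le> N" if "m \<in> keys p" for m using that by (auto simp: N_def)
  then have "(\<Sum>d\<le>N. hcomp d p) = p" by (intro sum_hcomp) auto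
  moreover have "hcomp d p = 0" if "d > N" for d
    using N that by (intro poly_mapping_eqI) (force simp: lookup_hcomp in_keys_iff)
  ultimately show ?thesis by blast
qed

text \<open>Comparing components of an identity leaves a homogeneous factor intact; the later degree
  arguments rest on this. Below degree k the component is zero, hence the case split.\<close>

lemma hcomp_mult_homog:
  fixes p y :: "('v::finite, 'k::field) mpoly"
  assumes "homog k y"
  shows "hcomp d (p * y) = (if k \<le> d then hcomp (d - k) p * y else 0)"
proof -
  obtain N where N: "(\<Sum>d\<le>N. hcomp d p) = p" "\<forall>d>N. hcomp d p = 0" using sum_hcomp_ex by blast
  have "hcomp d (p * y) = hcomp d (\<Sum>i\<le>N. hcomp i p * y)"
    by (subst N(1)[symmetric]) (simp add: sum_distrib_right)
  also have "\<dots> = (\<Sum>i\<le>N. if d = i + k then hcomp i p * y else 0)"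
    unfolding hcomp_sum using assms by (intro sum.cong refl hcomp_homog homog_mult) auto
  also have "\<dots> = (if k \<le> d then hcomp (d - k) p * y else 0)"
  proof (cases "k \<le> d")
    case True
    have "(\<Sum>i\<le>N. if d = i + k then hcomp i p * y else 0) = (\<Sum>i\<le>N. if d - k = i then hcomp i p * y else 0)"
      using True by (intro sum.cong) auto
    then show ?thesis using True N(2) by (auto simp: not_le)
  qed (auto intro!: sum.neutral)
  finally show ?thesis .
qed

definition graded_set :: "('v, 'k::field) mpoly set \<Rightarrow> bool" where
  "graded_set I \<longleftrightarrow> (\<forall>p\<in>I. \<forall>d. hcomp d p \<in> I)"

lemma graded_ideal_gen:
  fixes G :: "('v::finite, 'k::field) mpoly set"
  assumes "\<And>g. g \<in> G \<Longrightarrow> \<exists>d. homog d g"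
  shows "graded_set (ideal_gen G)"
  unfolding graded_set_def
proof safe
  fix p d assume "p \<in> ideal_gen G"
  then obtain I r where I: "finite I" "I \<subseteq> G" and p: "p = (\<Sum>i\<in>I. r i * i)"
    unfolding ideal_gen_def by auto
  have "hcomp d (r i * i) \<in> ideal_gen G" if i: "i \<in> I" for i
  proof -
    obtain k where "homog k i" using assms I i by blast
    then show ?thesis using i I ideal_gen_base[of i G]
      by (auto simp: hcomp_mult_homog intro: ideal_mult_left ideal_0)
  qed
  then show "hcomp d p \<in> ideal_gen G"
    unfolding p hcomp_sum by (intro ideal_sum_mem is_ideal_ideal_gen)
qed

lemma graded_mem_iff:
  assumes "graded_set I" "is_ideal I"
  shows "p \<in> I \<longleftrightarrow> (\<forall>d. hcomp d p \<in> I)"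
proof
  assume *: "\<forall>d. hcomp d p \<in> I"
  obtain N where "(\<Sum>d\<le>N. hcomp d p) = p" using sum_hcomp_ex by blast
  then show "p \<in> I" using ideal_sum_mem[OF assms(2), of "{..N}" "\<lambda>d. hcomp d p"] * by auto
qed (use assms in \<open>auto simp: graded_set_def\<close>)

section \<open>Hilbert functions\<close>

context vector_space
begin

text \<open>The polynomial ring is infinite-dimensional, so monotonicity of \<open>dim\<close> is
  tied to a finite spanning set \<open>S\<close>; in use \<open>S\<close> consists of the monomials
  of one degree.\<close>

lemma dim_mono_finite:
  assumes "A \<subseteq> span B" "B \<subseteq> span S" "finite S"
  shows "dim A \<le> dim B"
proof -
  obtain D where D: "D \<subseteq> B" "independent D" "B \<subseteq> span D" "card D = dim B" using basis_exists by blast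
  have "finite D" using independent_span_bound[of S D] D assms by blast
  moreover have "A \<subseteq> span D" using assms(1) D(3) by (metis span_mono span_span subset_trans)
  ultimately show ?thesis using dim_le_card D(4) by metis
qed

lemma dim_eq_plus_card_extension:
  assumes A: "subspace A" "A \<subseteq> V" and V: "subspace V" "V \<subseteq> span S" "finite S"
  obtains B C where "independent (B \<union> C)" "B \<inter> C = {}" "finite B" "finite C" "B \<subseteq> A" "span B = A"
    "C \<subseteq> V" "span (B \<union> C) = V" "card B = dim A" "card B + card C = dim V"
proof -
  obtain B where B: "B \<subseteq> A" "independent B" "A \<subseteq> span B" "card B = dim A" using basis_exists by blast
  have "B \<subseteq> V" using B A by auto
  then obtain E where E: "B \<subseteq> E" "E \<subseteq> V" "independent E" "V \<subseteq> span E"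
    using maximal_independent_subset_extend[of B V] B(2) by blast
  have fin: "finite E" using independent_span_bound[of S E] E V by blast
  have "card E = dim V" using E by (intro basis_card_eq_dim)
  moreover have "card E = card B + card (E - B)"
    using fin E(1) by (metis card_Diff_subset card_mono finite_subset le_add_diff_inverse)
  moreover have "B \<union> (E - B) = E" using E by auto
  moreover have "span E = V" using E V by (intro span_subspace) auto
  moreover have "span B = A" using B A by (intro span_subspace) auto
  ultimately show thesis
    using that[of B "E - B"] E B fin finite_subset[OF E(1) fin] by auto
qed

text \<open>\<open>AB\<close> says that f induces an injection from V/A into the quotient by B, so B
  + f(V) exceeds B by dim V - dim A. The additive form avoids truncated subtraction.\<close>

lemma dim_sum_image:
  assumes f: "Vector_Spaces.linear scale scale f"
    and A: "subspace A" "A \<subseteq> V" and V: "subspace V" "V \<subseteq> span S" "finite S"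
    and B: "subspace B" "B \<subseteq> span R" "finite R"
    and AB: "\<And>v. v \<in> V \<Longrightarrow> f v \<in> B \<longleftrightarrow> v \<in> A"
  shows "dim {b + f v | b v. b \<in> B \<and> v \<in> V} + dim A = dim B + dim V"
proof -
  interpret f: Vector_Spaces.linear scale scale f by fact
  obtain E C where EC: "independent (E \<union> C)" "E \<inter> C = {}" "finite E" "finite C" "E \<subseteq> A" "span E = A"
    "C \<subseteq> V" "span (E \<union> C) = V" "card E = dim A" "card E + card C = dim V"
    using dim_eq_plus_card_extension[OF A V] by metis
  obtain D where D: "D \<subseteq> B" "independent D" "B \<subseteq> span D" "card D = dim B" using basis_exists by blast
  have finD: "finite D" using independent_span_bound[of R D] D B by blast
  have spanD: "span D = B" using D B by (intro span_subspace) auto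
  \<comment> \<open>\<open>C\<close> completes a basis \<open>E\<close> of \<open>A\<close> to one
    of \<open>V\<close>. If f c were in the span reached so far, some c - w with w in the span of K
    would lie in \<open>A\<close>, against the independence of \<open>E \<union> C\<close>.\<close>
  have indep: "independent (D \<union> f ` K) \<and> card (D \<union> f ` K) = card D + card K" if "K \<subseteq> C" for K
    using finite_subset[OF that EC(4)] that
  proof (induction K rule: finite_induct)
    case (insert c K)
    have "f c \<notin> span (D \<union> f ` K)"
    proof
      assume "f c \<in> span (D \<union> f ` K)"
      then obtain b w where bw: "f c = b + f w" "b \<in> B" "w \<in> span K"
        unfolding span_Un spanD f.span_image by auto
      have "K \<subseteq> V" using insert.prems EC by auto
      then have "span K \<subseteq> V" using V(1) by (rule span_minimal)
      then have cw: "c - w \<in> V" using bw(3) insert.prems EC V(1) by (auto intro: subspace_diff)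
      have "f (c - w) \<in> B" using bw by (simp add: f.diff)
      then have "c - w \<in> span E" using AB[OF cw] EC by auto
      then have "c - w \<in> span (E \<union> C - {c})" using insert.prems EC(2)
        by (elim set_mp[OF span_mono, rotated]) auto
      moreover have "w \<in> span (E \<union> C - {c})" using insert.prems insert.hyps(2) bw(3)
        by (elim set_mp[OF span_mono, rotated]) auto
      ultimately have "c - w + w \<in> span (E \<union> C - {c})" by (rule span_add)
      then have "c \<in> span (E \<union> C - {c})" by simp
      then show False using EC(1) insert.prems by (auto simp: dependent_def)
    qed
    moreover from this have "f c \<notin> D \<union> f ` K" using span_base[of "f c" "D \<union> f ` K"] by (rule contrapos_nn)
    ultimately show ?case using insert finD independent_insertI[of "f c" "D \<union> f ` K"] by simp
  qed (use D in auto)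
  have "card (D \<union> f ` C) = dim {b + f v | b v. b \<in> B \<and> v \<in> V}"
  proof (rule basis_card_eq_dim)
    show "D \<union> f ` C \<subseteq> {b + f v | b v. b \<in> B \<and> v \<in> V}"
    proof safe
      fix x assume "x \<in> D"
      then show "\<exists>b v. x = b + f v \<and> b \<in> B \<and> v \<in> V"
        using D V(1) by (intro exI[of _ x] exI[of _ 0]) (auto simp: f.zero subspace_0)
    next
      fix x assume "x \<in> C"
      then show "\<exists>b v. f x = b + f v \<and> b \<in> B \<and> v \<in> V"
        using EC B(1) by (intro exI[of _ 0] exI[of _ x]) (auto simp: subspace_0)
    qed
    show "{b + f v | b v. b \<in> B \<and> v \<in> V} \<subseteq> span (D \<union> f ` C)"
    proof safe
      fix b v assume bv: "b \<in> B" "v \<in> V"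
      then obtain x y where xy: "v = x + y" "x \<in> A" "y \<in> span C" using EC(6,8) by (auto simp: span_Un)
      have "f x \<in> B" using xy AB[of x] A by auto
      then have "b + f x \<in> B" using bv B(1) by (auto intro: subspace_add)
      moreover have "b + f v = (b + f x) + f y" by (simp add: xy f.add add.assoc)
      ultimately show "b + f v \<in> span (D \<union> f ` C)"
        unfolding span_Un spanD f.span_image using imageI[OF xy(3), of f] by blast
    qed
    show "independent (D \<union> f ` C)" using indep by blast
  qed
  moreover have "card (D \<union> f ` C) = card D + card C" using indep by blast
  ultimately show ?thesis using D EC by simp
qed

lemma dim_le_kernel_plus_1:
  assumes V: "subspace V" "V \<subseteq> span S" "finite S"
    and add: "\<And>x y. \<phi> (x + y) = \<phi> x + \<phi> y" and sc: "\<And>c x. \<phi> (scale c x) = c * \<phi> x"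
  shows "dim V \<le> dim {x \<in> V. \<phi> x = 0} + 1"
proof (cases "\<forall>x\<in>V. \<phi> x = 0")
  case True
  then have "{x \<in> V. \<phi> x = 0} = V" by auto
  then show ?thesis by simp
next
  case False
  then obtain v where v: "v \<in> V" "\<phi> v \<noteq> 0" by blast
  obtain D where D: "D \<subseteq> {x \<in> V. \<phi> x = 0}" "independent D" "{x \<in> V. \<phi> x = 0} \<subseteq> span D"
    "card D = dim {x \<in> V. \<phi> x = 0}" using basis_exists by blast
  have finD: "finite D" using independent_span_bound[of S D] D V by blast
  have "V \<subseteq> span (insert v D)"
  proof
    fix x assume x: "x \<in> V"
    have "\<phi> (x - scale (\<phi> x / \<phi> v) v) = 0"
      using add[of "x - scale (\<phi> x / \<phi> v) v" "scale (\<phi> x / \<phi> v) v"] v by (simp add: sc)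
    moreover have "x - scale (\<phi> x / \<phi> v) v \<in> V" using x v V by (auto intro: subspace_diff subspace_scale)
    ultimately have "x - scale (\<phi> x / \<phi> v) v \<in> span D" using D by auto
    then show "x \<in> span (insert v D)" by (auto simp: span_breakdown_eq)
  qed
  then have "dim V \<le> card (insert v D)" using finD by (intro dim_le_card) auto
  then show ?thesis using D(4) card_insert_le_m1[of "Suc (card D)" D v] finD by (simp add: card_insert_if split: if_splits)
qed

end

interpretation mp: vector_space "smult_mp :: 'k::field \<Rightarrow> ('v, 'k) mpoly \<Rightarrow> ('v, 'k) mpoly"
  by unfold_locales (simp_all add: smult_mp_conv cst_add cst_mult algebra_simps)

abbreviation Tdeg :: "nat \<Rightarrow> ('v, 'k::zero) mpoly set" where
  "Tdeg i \<equiv> graded_part i UNIV"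

definition monoms :: "nat \<Rightarrow> ('v, 'k::field) mpoly set" where
  "monoms i = (\<lambda>m. Poly_Mapping.single m 1) ` {m. mdeg m = i}"

lemma mem_Tdeg [simp]: "p \<in> Tdeg i \<longleftrightarrow> homog i p"
  by (simp add: graded_part_def)

lemma mem_graded_part: "p \<in> graded_part i J \<longleftrightarrow> p \<in> J \<and> homog i p"
  by (simp add: graded_part_def)

lemma finite_monoms [simp]: "finite (monoms i :: ('v::finite, 'k::field) mpoly set)"
  by (simp add: monoms_def finite_mdeg)

lemma Tdeg_subset_span: "(Tdeg i :: ('v::finite, 'k::field) mpoly set) \<subseteq> mp.span (monoms i)"
proof
  fix p :: "('v, 'k) mpoly" assume p: "p \<in> Tdeg i"
  have "Poly_Mapping.single m (lkp p m) \<in> mp.span (monoms i)" if "m \<in> keys p" for m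
  proof -
    have "Poly_Mapping.single m (1::'k) \<in> monoms i" using p that by (auto simp: homog_def monoms_def)
    then have "smult_mp (lkp p m) (Poly_Mapping.single m 1) \<in> mp.span (monoms i)"
      by (intro mp.span_scale mp.span_base)
    then show ?thesis by (simp add: smult_mp_conv cst_def mult_single)
  qed
  then have "(\<Sum>m\<in>keys p. Poly_Mapping.single m (lkp p m)) \<in> mp.span (monoms i)"
    by (rule mp.span_sum)
  then show "p \<in> mp.span (monoms i)" using poly_mapping_sum_singles[of "keys p" p] by simp
qed

lemma independent_singles:
  "mp.independent ((\<lambda>m. Poly_Mapping.single m (1::'k::field)) ` A :: ('v, 'k) mpoly set)"
  unfolding mp.dependent_def
proof safe
  fix m assume "m \<in> A" and sp: "Poly_Mapping.single m (1::'k) \<in> mp.span ((\<lambda>m. Poly_Mapping.single m 1) ` A - {Poly_Mapping.single m 1})"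
  have "mp.subspace {p :: ('v, 'k) mpoly. lkp p m = 0}"
    by (rule mp.subspaceI) (auto simp: lookup_add)
  moreover have "(\<lambda>m. Poly_Mapping.single m (1::'k)) ` A - {Poly_Mapping.single m 1} \<subseteq> {p. lkp p m = 0}"
    by (auto simp: lookup_single when_def)
  ultimately have "mp.span ((\<lambda>m. Poly_Mapping.single m (1::'k)) ` A - {Poly_Mapping.single m 1}) \<subseteq> {p. lkp p m = 0}"
    by (intro mp.span_minimal)
  from subsetD[OF this sp] show False by simp
qed

lemma dim_Tdeg: "mp.dim (Tdeg i :: ('v::finite, 'k::field) mpoly set) = card {m :: 'v \<Rightarrow>\<^sub>0 nat. mdeg m = i}"
proof -
  have "mp.dim (Tdeg i :: ('v, 'k) mpoly set) = card (monoms i :: ('v, 'k) mpoly set)"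
    using independent_singles[of "{m. mdeg m = i}"] Tdeg_subset_span[of i]
    by (intro mp.basis_card_eq_dim[symmetric]) (auto simp: monoms_def homog_iff lookup_single when_def)
  also have "\<dots> = card {m :: 'v \<Rightarrow>\<^sub>0 nat. mdeg m = i}" unfolding monoms_def
    by (rule card_image) (auto simp: inj_on_def poly_mapping_eq_iff fun_eq_iff lookup_single when_def split: if_splits)
  finally show ?thesis .
qed

lemma homog_smult_mp: "homog d p \<Longrightarrow> homog d (smult_mp c p)"
  by (auto simp: homog_iff)

lemma subspace_Tdeg: "mp.subspace (Tdeg i)"
  by (rule mp.subspaceI) (auto intro: homog_add homog_smult_mp)

lemma subspace_graded_part: "is_ideal J \<Longrightarrow> mp.subspace (graded_part i J)"
  by (rule mp.subspaceI)
    (auto simp: mem_graded_part smult_mp_conv intro: ideal_0 ideal_add ideal_mult_left homog_add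
      homog_smult_mp[unfolded smult_mp_conv])

lemma subspace_graded_subset_span:
  "V \<subseteq> Tdeg i \<Longrightarrow> (V :: ('v::finite, 'k::field) mpoly set) \<subseteq> mp.span (monoms i)"
  using Tdeg_subset_span by blast

lemma graded_part_subset: "graded_part i J \<subseteq> Tdeg i"
  by (auto simp: graded_part_def)

lemma dim_le_Tdeg:
  "A \<subseteq> B \<Longrightarrow> B \<subseteq> Tdeg i \<Longrightarrow> mp.dim (A :: ('v::finite, 'k::field) mpoly set) \<le> mp.dim B"
  by (rule mp.dim_mono_finite[of _ _ "monoms i"]) (use mp.span_superset[of B] Tdeg_subset_span[of i] in auto)

lemma HF_plus_dim:
  "HF J i + mp.dim (graded_part i J) = mp.dim (Tdeg i :: ('v, 'k) mpoly set)"
  for J :: "('v::finite, 'k::field) mpoly set"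
  unfolding HF_def using dim_le_Tdeg[OF graded_part_subset[of i J] subset_refl] by simp

text \<open>The map v -> v y yields the dimension count behind both exact sequences of the proof:
  for ideals in \<open>HF_insert\<close>, for spaces of forms vanishing at points in the lower
  bound.\<close>

lemma dim_plus_mult:
  fixes y :: "('v::finite, 'k::field) mpoly"
  assumes "mp.subspace A" "A \<subseteq> Tdeg j" "mp.subspace B" "B \<subseteq> Tdeg i"
    and "\<And>v. homog j v \<Longrightarrow> v * y \<in> B \<longleftrightarrow> v \<in> A"
  shows "mp.dim {b + v * y | b v. b \<in> B \<and> v \<in> Tdeg j} + mp.dim A = mp.dim B + mp.dim (Tdeg j :: ('v, 'k) mpoly set)"
proof (rule mp.dim_sum_image[of "\<lambda>v. v * y" A "Tdeg j" "monoms j" B "monoms i"])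
  show "Vector_Spaces.linear smult_mp smult_mp (\<lambda>v. v * y)"
    by (rule Vector_Spaces.linear_iff[THEN iffD2])
      (auto simp: algebra_simps smult_mp_conv mp.vector_space_axioms)
qed (use assms subspace_graded_subset_span[OF assms(4)] Tdeg_subset_span[of j] subspace_Tdeg[of j] in auto)

lemma graded_part_insert:
  fixes y :: "('v::finite, 'k::field) mpoly"
  assumes "graded_set (ideal_gen G)" "homog k y" "k \<le> i"
  shows "graded_part i (ideal_gen (insert y G)) = {b + v * y | b v. b \<in> graded_part i (ideal_gen G) \<and> v \<in> Tdeg (i - k)}"
proof safe
  fix p assume "p \<in> graded_part i (ideal_gen (insert y G))"
  then obtain s where p: "homog i p" and s: "p - s * y \<in> ideal_gen G"
    by (auto simp: mem_graded_part ideal_gen_insert_iff)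
  have "hcomp i (p - s * y) \<in> graded_part i (ideal_gen G)" using s assms(1)
    by (auto simp: graded_set_def mem_graded_part)
  moreover have "p = hcomp i (p - s * y) + hcomp (i - k) s * y"
    using p assms by (simp add: hcomp_diff hcomp_homog hcomp_mult_homog)
  ultimately show "\<exists>b v. p = b + v * y \<and> b \<in> graded_part i (ideal_gen G) \<and> v \<in> Tdeg (i - k)"
    using homog_hcomp mem_Tdeg by blast
next
  fix b v :: "('v, 'k) mpoly" assume bv: "b \<in> graded_part i (ideal_gen G)" "v \<in> Tdeg (i - k)"
  have "homog (i - k + k) (v * y)" using bv assms by (intro homog_mult) auto
  then have "homog i (b + v * y)" using bv assms(3) by (auto simp: mem_graded_part intro: homog_add)
  moreover have "b + v * y \<in> ideal_gen (insert y G)"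
    unfolding ideal_gen_insert_iff using bv by (intro exI[of _ v]) (auto simp: mem_graded_part)
  ultimately show "b + v * y \<in> graded_part i (ideal_gen (insert y G))"
    by (simp add: mem_graded_part)
qed

text \<open>Degree i of the exact sequence 0 -> (T/J)(-k) -> T/J -> T/(J + (y)) -> 0, where J is
  generated by G. For i < k the new generator contributes nothing.\<close>

lemma HF_insert:
  fixes y :: "('v::finite, 'k::field) mpoly"
  assumes "graded_set (ideal_gen G)" "homog k y" "nzd_mod y (ideal_gen G)"
  shows "HF (ideal_gen (insert y G)) i + (if k \<le> i then HF (ideal_gen G) (i - k) else 0) = HF (ideal_gen G) i"
proof (cases "k \<le> i")
  case True
  have *: "v * y \<in> graded_part i (ideal_gen G) \<longleftrightarrow> v \<in> graded_part (i - k) (ideal_gen G)" if "homog (i - k) v" for v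
    using that homog_mult[OF that assms(2)] True assms(3)
    by (auto simp: mem_graded_part intro: ideal_mult_right nzd_modD)
  have "mp.dim (graded_part i (ideal_gen (insert y G))) + mp.dim (graded_part (i - k) (ideal_gen G))
      = mp.dim (graded_part i (ideal_gen G)) + mp.dim (Tdeg (i - k) :: ('v, 'k) mpoly set)"
    unfolding graded_part_insert[OF assms(1,2) True]
    by (rule dim_plus_mult[where i = i]) (use * in \<open>auto simp: subspace_graded_part mem_graded_part\<close>)
  then show ?thesis
    using HF_plus_dim[of "ideal_gen G" i] HF_plus_dim[of "ideal_gen G" "i - k"] HF_plus_dim[of "ideal_gen (insert y G)" i] True
    by simp
next
  case False
  have "graded_part i (ideal_gen (insert y G)) = graded_part i (ideal_gen G)"
  proof safe
    fix p assume "p \<in> graded_part i (ideal_gen (insert y G))"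
    then obtain s where p: "homog i p" and s: "p - s * y \<in> ideal_gen G"
      by (auto simp: mem_graded_part ideal_gen_insert_iff)
    have "hcomp i (p - s * y) \<in> ideal_gen G" using s assms(1) by (auto simp: graded_set_def)
    then show "p \<in> graded_part i (ideal_gen G)"
      using p assms False by (simp add: hcomp_diff hcomp_homog hcomp_mult_homog mem_graded_part)
  next
    fix p assume "p \<in> graded_part i (ideal_gen G)"
    then show "p \<in> graded_part i (ideal_gen (insert y G))"
      using ideal_gen_mono[of G "insert y G"] by (auto simp: mem_graded_part)
  qed
  then show ?thesis using False by (simp add: HF_def)
qed

section \<open>Homogeneous regular sequences and Hilbert series\<close>

text \<open>Multiplying by \<open>y\<close> and dividing by the positive degree form \<open>x\<close> lowers degrees,
  so an induction on degrees plays the role of Nakayama's lemma.\<close>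

lemma nzd_swap1:
  fixes x y :: "('v::finite, 'k::field) mpoly"
  assumes gr: "graded_set (ideal_gen G)" and hx: "homog k x" "k > 0" and hy: "homog l y"
    and x: "nzd_mod x (ideal_gen G)" and y: "nzd_mod y (ideal_gen (insert x G))"
  shows "nzd_mod y (ideal_gen G)"
proof -
  have "hcomp m h \<in> ideal_gen G" if "h * y \<in> ideal_gen G" for h m
    using that
  proof (induction m arbitrary: h rule: less_induct)
    case (less m)
    have "hcomp (m + l) (h * y) = hcomp m h * y" using hy by (simp add: hcomp_mult_homog)
    then have h0y: "hcomp m h * y \<in> ideal_gen G" using less.prems gr unfolding graded_set_def by metis
    then have "hcomp m h * y \<in> ideal_gen (insert x G)"
      using ideal_gen_mono[of G "insert x G"] by auto
    then have "hcomp m h \<in> ideal_gen (insert x G)" using y by (rule nzd_modD[rotated])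
    then obtain s where s: "hcomp m h - s * x \<in> ideal_gen G" by (auto simp: ideal_gen_insert_iff)
    then have "hcomp m (hcomp m h - s * x) \<in> ideal_gen G" using gr by (auto simp: graded_set_def)
    then have s0: "hcomp m h - (if k \<le> m then hcomp (m - k) s * x else 0) \<in> ideal_gen G"
      using hx by (simp add: hcomp_diff hcomp_mult_homog hcomp_homog split: if_splits)
    show ?case
    proof (cases "k \<le> m")
      case True
      define t where "t = hcomp (m - k) s"
      have 1: "hcomp m h - t * x \<in> ideal_gen G" using s0 True by (simp add: t_def)
      have "hcomp m h * y - (hcomp m h - t * x) * y \<in> ideal_gen G"
        by (intro ideal_diff ideal_mult_right is_ideal_ideal_gen h0y 1)
      also have "hcomp m h * y - (hcomp m h - t * x) * y = t * y * x" by (simp add: algebra_simps)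
      finally have "t * y \<in> ideal_gen G" using x by (auto dest: nzd_modD)
      then have "hcomp (m - k) t \<in> ideal_gen G" using True hx by (intro less.IH) auto
      then have "t \<in> ideal_gen G" by (simp add: t_def hcomp_homog)
      then have "t * x \<in> ideal_gen G" by (intro ideal_mult_right) auto
      from ideal_add[OF is_ideal_ideal_gen 1 this] show ?thesis by simp
    next
      case False
      then show ?thesis using s0 by simp
    qed
  qed
  then show ?thesis unfolding nzd_mod_def using graded_mem_iff[OF gr] by blast
qed

text \<open>If h x = s y modulo G, then s y lies in (x, G), so s = t x modulo G and (h - t y) x lies
  in (G). Unlike the other half of the exchange, this is independent of any grading.\<close>

lemma nzd_swap2:
  fixes x y :: "'a::comm_ring_1"
  assumes "nzd_mod x (ideal_gen G)" "nzd_mod y (ideal_gen (insert x G))"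
  shows "nzd_mod x (ideal_gen (insert y G))"
  unfolding nzd_mod_def
proof (intro allI impI)
  fix h assume "h * x \<in> ideal_gen (insert y G)"
  then obtain s where s: "h * x - s * y \<in> ideal_gen G" by (auto simp: ideal_gen_insert_iff)
  then have "- (h * x - s * y) \<in> ideal_gen G" using ideal_mult_left[of _ _ "-1"] by fastforce
  then have "s * y - h * x \<in> ideal_gen G" by simp
  then have "s * y \<in> ideal_gen (insert x G)" by (auto simp: ideal_gen_insert_iff)
  then have "s \<in> ideal_gen (insert x G)" using assms(2) by (auto dest: nzd_modD)
  then obtain t where t: "s - t * x \<in> ideal_gen G" by (auto simp: ideal_gen_insert_iff)
  have "(h * x - s * y) + (s - t * x) * y \<in> ideal_gen G"
    using s t by (intro ideal_add ideal_mult_right) auto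
  then have "(h - t * y) * x \<in> ideal_gen G" by (simp add: algebra_simps)
  then have "h - t * y \<in> ideal_gen G" using assms(1) by (auto dest: nzd_modD)
  then show "h \<in> ideal_gen (insert y G)" by (auto simp: ideal_gen_insert_iff)
qed

text \<open>Successive exchanges move x behind g_1, ..., g_n. For x = q^a this makes the g_i a
  regular sequence by themselves, with q^a a nonzerodivisor modulo all of them.\<close>

lemma regular_sequence_shift:
  fixes x :: "('v::finite, 'k::field) mpoly"
  assumes hx: "homog k x" "k > 0" and hg: "\<And>i. i \<in> {1..n} \<Longrightarrow> homog (d i) (g i)"
    and x: "nzd_mod x {0}" and g: "\<And>j. j < n \<Longrightarrow> nzd_mod (g (Suc j)) (ideal_gen (insert x (g ` {1..j})))"
  shows "j \<le> n \<Longrightarrow> nzd_mod x (ideal_gen (g ` {1..j}))"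
    and "j < n \<Longrightarrow> nzd_mod (g (Suc j)) (ideal_gen (g ` {1..j}))"
proof -
  have gr: "graded_set (ideal_gen (g ` {1..j}))" if "j \<le> n" for j
    using hg that by (intro graded_ideal_gen) fastforce
  show *: "nzd_mod x (ideal_gen (g ` {1..j}))" if "j \<le> n" for j
    using that
  proof (induction j)
    case (Suc j)
    then have "nzd_mod x (ideal_gen (insert (g (Suc j)) (g ` {1..j})))"
      using g[of j] by (intro nzd_swap2[of x]) simp_all
    moreover have "insert (g (Suc j)) (g ` {1..j}) = g ` {1..Suc j}" by (simp add: atLeastAtMostSuc_conv)
    ultimately show ?case by simp
  qed (use x in simp)
  show "nzd_mod (g (Suc j)) (ideal_gen (g ` {1..j}))" if "j < n" for j
  proof -
    have "homog (d (Suc j)) (g (Suc j))" using that by (intro hg) simp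
    then show ?thesis using that by (rule nzd_swap1[OF gr[OF less_imp_le] hx _ *[OF less_imp_le] g, rotated]) (use that in simp_all)
  qed
qed

section \<open>Hilbert series of the polynomial ring and of complete intersections\<close>

definition HS :: "('v, 'k::field) mpoly set \<Rightarrow> int fps" where
  "HS J = Abs_fps (\<lambda>i. int (HF J i))"

lemma HS_insert:
  fixes y :: "('v::finite, 'k::field) mpoly"
  assumes "graded_set (ideal_gen G)" "homog k y" "nzd_mod y (ideal_gen G)"
  shows "HS (ideal_gen (insert y G)) = HS (ideal_gen G) * (1 - fps_X ^ k)"
proof (rule fps_ext)
  fix i
  have "int (HF (ideal_gen (insert y G)) i) = int (HF (ideal_gen G) i) - (if k \<le> i then int (HF (ideal_gen G) (i - k)) else 0)"
    using HF_insert[OF assms, of i] by (auto split: if_splits)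
  then show "fps_nth (HS (ideal_gen (insert y G))) i = fps_nth (HS (ideal_gen G) * (1 - fps_X ^ k)) i"
    by (simp add: HS_def right_diff_distrib fps_X_power_mult_right_nth)
qed

text \<open>Hilbert series of the polynomial ring in the variables \<open>S\<close>; arbitrary
  subsets of the index type permit induction on the number of variables.\<close>

definition monom_series :: "'v set \<Rightarrow> int fps" where
  "monom_series S = Abs_fps (\<lambda>i. int (card {m :: 'v \<Rightarrow>\<^sub>0 nat. keys m \<subseteq> S \<and> mdeg m = i}))"

text \<open>A monomial in the larger set of variables either omits v or is v times a monomial of one
  degree less.\<close>

lemma monom_series_insert:
  fixes S :: "'v::finite set"
  assumes "v \<notin> S"
  shows "monom_series (insert v S) * (1 - fps_X) = monom_series S"
proof (rule fps_ext)
  fix i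
  let ?A = "\<lambda>S i. {m :: 'v \<Rightarrow>\<^sub>0 nat. keys m \<subseteq> S \<and> mdeg m = i}"
  have fin: "finite (?A S i)" for S i by (rule finite_subset[OF _ finite_mdeg[of i]]) auto
  have split: "?A (insert v S) i = ?A S i \<union> {m \<in> ?A (insert v S) i. lkp m v \<noteq> 0}"
    by (auto simp: in_keys_iff)
  have "card (?A (insert v S) i) = card (?A S i) + card {m \<in> ?A (insert v S) i. lkp m v \<noteq> 0}"
  proof (subst split, rule card_Un_disjoint)
    show "finite {m \<in> ?A (insert v S) i. lkp m v \<noteq> 0}" by (rule finite_subset[OF _ fin[of "insert v S" i]]) auto
    show "?A S i \<inter> {m \<in> ?A (insert v S) i. lkp m v \<noteq> 0} = {}"
    proof -
      have "lkp m v = 0" if "keys m \<subseteq> S" for m :: "'v \<Rightarrow>\<^sub>0 nat"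
        using that assms by (meson not_in_keys_iff_lookup_eq_zero subsetD)
      then show ?thesis by auto
    qed
  qed (rule fin)
  moreover have "card {m \<in> ?A (insert v S) i. lkp m v \<noteq> 0} = (if i = 0 then 0 else card (?A (insert v S) (i - 1)))"
  proof (cases i)
    case 0
    have "mdeg m > 0" if "lkp m v > 0" for m :: "'v \<Rightarrow>\<^sub>0 nat" using lookup_le_mdeg[of m v] that by simp
    then have "{m \<in> ?A (insert v S) i. lkp m v \<noteq> 0} = {}" using 0 by auto
    then show ?thesis using 0 by (simp only: card.empty if_True refl)
  next
    case (Suc j)
    have "bij_betw (\<lambda>m. m + Poly_Mapping.single v 1) (?A (insert v S) j) {m \<in> ?A (insert v S) i. lkp m v \<noteq> 0}"
    proof (rule bij_betwI[where g = "\<lambda>m. m - Poly_Mapping.single v 1"])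
      have sub: "m - Poly_Mapping.single v 1 + Poly_Mapping.single v 1 = m" if "lkp m v \<noteq> 0" for m :: "'v \<Rightarrow>\<^sub>0 nat"
        using that by (intro poly_mapping_eqI) (auto simp: lookup_add lookup_minus lookup_single when_def)
      show "(\<lambda>m. m + Poly_Mapping.single v 1) \<in> ?A (insert v S) j \<rightarrow> {m \<in> ?A (insert v S) i. lkp m v \<noteq> 0}"
      proof safe
        fix m :: "'v \<Rightarrow>\<^sub>0 nat" assume m: "keys m \<subseteq> insert v S" "j = mdeg m"
        show "mdeg (m + Poly_Mapping.single v 1) = i" using m Suc by (simp add: mdeg_add)
        fix w assume w: "w \<in> keys (m + Poly_Mapping.single v 1)" "w \<notin> S"
        have "w \<in> keys m \<union> keys (Poly_Mapping.single v (1::nat))" using w(1) keys_add by (rule rev_subsetD)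
        then show "w = v" using w(2) m(1) by auto
      qed (simp add: lookup_add)
      have "m - Poly_Mapping.single v 1 \<in> ?A (insert v S) j" if "m \<in> {m \<in> ?A (insert v S) i. lkp m v \<noteq> 0}" for m
      proof -
        have m: "mdeg m = i" "lkp m v \<noteq> 0" "keys m \<subseteq> insert v S" using that by simp_all
        have "mdeg (m - Poly_Mapping.single v 1) = j"
          using arg_cong[OF sub[OF m(2)], of mdeg] m Suc by (simp add: mdeg_add)
        moreover have "keys (m - Poly_Mapping.single v 1) \<subseteq> keys m" by (auto simp: in_keys_iff lookup_minus)
        ultimately show ?thesis using m by auto
      qed
      then show "(\<lambda>m. m - Poly_Mapping.single v 1) \<in> {m \<in> ?A (insert v S) i. lkp m v \<noteq> 0} \<rightarrow> ?A (insert v S) j"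
        by (rule funcsetI)
      show "m + Poly_Mapping.single v 1 - Poly_Mapping.single v 1 = m" for m by simp
      show "m - Poly_Mapping.single v 1 + Poly_Mapping.single v 1 = m" if "m \<in> {m \<in> ?A (insert v S) i. lkp m v \<noteq> 0}" for m
        using that sub by simp
    qed
    then show ?thesis using Suc by (simp add: bij_betw_same_card)
  qed
  ultimately show "fps_nth (monom_series (insert v S) * (1 - fps_X)) i = fps_nth (monom_series S) i"
    by (simp add: monom_series_def right_diff_distrib)
qed

lemma monom_series_power: "monom_series (S :: 'v::finite set) * (1 - fps_X) ^ card S = 1"
proof (induction S rule: finite_induct[OF finite])
  case 1
  have "{m :: 'v \<Rightarrow>\<^sub>0 nat. keys m \<subseteq> {} \<and> mdeg m = i} = (if i = 0 then {0} else {})" for i by auto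
  then show ?case by (intro fps_ext) (auto simp: monom_series_def)
next
  case (2 v S)
  then show ?case using monom_series_insert[of v S] by (simp add: mult.assoc[symmetric])
qed

lemma HS_zero_ideal: "HS (ideal_gen ({} :: ('v::finite, 'k::field) mpoly set)) = monom_series (UNIV :: 'v set)"
proof (rule fps_ext)
  fix i
  have "graded_part i {0 :: ('v, 'k) mpoly} = {0}" by (auto simp: graded_part_def)
  then have "mp.dim (graded_part i {0 :: ('v, 'k) mpoly}) = 0"
    using mp.dim_le_card[of "{0}" "{}"] by simp
  then show "fps_nth (HS (ideal_gen ({} :: ('v, 'k) mpoly set))) i = fps_nth (monom_series (UNIV :: 'v set)) i"
    using HF_plus_dim[of "{0 :: ('v, 'k) mpoly}" i] by (simp add: HS_def monom_series_def dim_Tdeg)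
qed

text \<open>The quotient (1 - X^d) / (1 - X), kept as a polynomial so that it can be evaluated at
  1.\<close>

definition geom_poly :: "nat \<Rightarrow> int poly" where
  "geom_poly d = (\<Sum>l<d. monom 1 l)"

lemma geom_poly_fps: "(1 - fps_X) * fps_of_poly (geom_poly d) = 1 - fps_X ^ d"
proof -
  have "fps_of_poly (geom_poly d) = (\<Sum>l<d. fps_X ^ l)"
    by (simp add: geom_poly_def fps_of_poly_sum fps_of_poly_monom')
  then show ?thesis using one_diff_power_eq[of "fps_X :: int fps" d] by simp
qed

lemma coeff_geom_poly_nonneg: "coeff (geom_poly d) i \<ge> 0"
  by (auto simp: geom_poly_def coeff_sum intro!: sum_nonneg)

lemma poly_geom_poly_1 [simp]: "poly (geom_poly d) 1 = int d"
  by (simp add: geom_poly_def poly_sum poly_monom)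

lemma sum_coeff_eq_poly_1:
  assumes "degree p \<le> N" shows "(\<Sum>i\<le>N. coeff p i) = poly p (1 :: int)"
proof -
  have "(\<Sum>i\<le>degree p. coeff p i) = (\<Sum>i\<le>N. coeff p i)"
    by (rule sum.mono_neutral_left) (use assms in \<open>auto simp: coeff_eq_0\<close>)
  then show ?thesis by (simp add: poly_altdef)
qed

lemma coeff_prod_nonneg:
  fixes f :: "'a \<Rightarrow> int poly"
  assumes "\<And>x i. x \<in> A \<Longrightarrow> coeff (f x) i \<ge> 0"
  shows "coeff (prod f A) i \<ge> 0"
  using assms by (induction A arbitrary: i rule: infinite_finite_induct)
    (auto simp: coeff_mult intro!: sum_nonneg mult_nonneg_nonneg)

context
  fixes g :: "nat \<Rightarrow> ('v::finite, 'k::field) mpoly" and n :: nat and d :: "nat \<Rightarrow> nat"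
  assumes card: "CARD('v) = n + 1"
    and hg: "\<And>i. i \<in> {1..n} \<Longrightarrow> homog (d i) (g i)"
    and reg: "\<And>j. j < n \<Longrightarrow> nzd_mod (g (Suc j)) (ideal_gen (g ` {1..j}))"
begin

lemma HS_regular:
  "j \<le> n \<Longrightarrow> HS (ideal_gen (g ` {1..j})) = monom_series (UNIV :: 'v set) * (\<Prod>i=1..j. 1 - fps_X ^ d i)"
proof (induction j)
  case 0
  then show ?case using HS_zero_ideal[where ?'v = 'v and ?'k = 'k] by simp
next
  case (Suc j)
  have "graded_set (ideal_gen (g ` {1..j}))" using hg Suc.prems by (intro graded_ideal_gen) fastforce
  moreover have "insert (g (Suc j)) (g ` {1..j}) = g ` {1..Suc j}" by (simp add: atLeastAtMostSuc_conv)
  ultimately show ?case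
    using HS_insert[of "g ` {1..j}" "d (Suc j)" "g (Suc j)"] hg[of "Suc j"] reg[of j] Suc by (simp add: mult.assoc)
qed

text \<open>The factors 1 - X^(d_i) cancel n of the n+1 factors 1 - X of the denominator; the one
  that remains is moved to the left.\<close>

lemma HS_regular_all:
  "HS (ideal_gen (g ` {1..n})) * (1 - fps_X) = fps_of_poly (\<Prod>i=1..n. geom_poly (d i))"
proof -
  have "(\<Prod>i=1..n. 1 - fps_X ^ d i) = (1 - fps_X) ^ n * fps_of_poly (\<Prod>i=1..n. geom_poly (d i))"
    by (simp add: geom_poly_fps[symmetric] prod.distrib fps_of_poly_prod)
  then have "HS (ideal_gen (g ` {1..n})) * (1 - fps_X)
      = monom_series (UNIV :: 'v set) * (1 - fps_X) ^ CARD('v) * fps_of_poly (\<Prod>i=1..n. geom_poly (d i))"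
    using HS_regular[of n] by (simp add: card mult_ac)
  then show ?thesis by (simp add: monom_series_power)
qed

text \<open>Multiplication by 1 - X takes differences, so the Hilbert function consists of the
  partial sums of a polynomial with nonnegative coefficients; the value of that polynomial at 1, the
  product of the d_i, bounds them all.\<close>

lemma HF_regular_le: "HF (ideal_gen (g ` {1..n})) i \<le> (\<Prod>i=1..n. d i)"
proof -
  let ?P = "\<Prod>i=1..n. geom_poly (d i)"
  have H: "int (HF (ideal_gen (g ` {1..n})) i) = (\<Sum>j\<le>i. coeff ?P j)" for i
  proof (induction i)
    case 0
    then show ?case using arg_cong[OF HS_regular_all, of "\<lambda>f. fps_nth f 0"] by (simp add: HS_def)
  next
    case (Suc i)
    then show ?case using arg_cong[OF HS_regular_all, of "\<lambda>f. fps_nth f (Suc i)"]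
      by (simp add: HS_def right_diff_distrib)
  qed
  have "(\<Sum>j\<le>i. coeff ?P j) \<le> (\<Sum>j\<le>max i (degree ?P). coeff ?P j)"
    by (rule sum_mono2) (auto intro!: coeff_prod_nonneg coeff_geom_poly_nonneg)
  also have "\<dots> = int (\<Prod>i=1..n. d i)" by (subst sum_coeff_eq_poly_1) (auto simp: poly_prod)
  finally show ?thesis unfolding H[symmetric] by (simp only: of_nat_le_iff)
qed

text \<open>The factor 1 - X^e contributed by q cancels the last pole, so the Hilbert series is a
  polynomial and its value at 1 is the total. Finite sums from \<open>N\<close> on serve both the
  infinite series and the lower bound.\<close>

lemma HF_complete_intersection:
  assumes "homog e q" "nzd_mod q (ideal_gen (g ` {1..n}))"
  obtains N where "\<And>i. i > N \<Longrightarrow> HF (ideal_gen (insert q (g ` {1..n}))) i = 0"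
    "\<And>M. M \<ge> N \<Longrightarrow> (\<Sum>i\<le>M. HF (ideal_gen (insert q (g ` {1..n}))) i) = e * (\<Prod>i=1..n. d i)"
proof -
  let ?P = "(\<Prod>i=1..n. geom_poly (d i)) * geom_poly e"
  have "graded_set (ideal_gen (g ` {1..n}))" using hg by (intro graded_ideal_gen) fastforce
  then have "HS (ideal_gen (insert q (g ` {1..n}))) = HS (ideal_gen (g ` {1..n})) * (1 - fps_X) * fps_of_poly (geom_poly e)"
    using HS_insert[OF _ assms] by (simp add: mult.assoc geom_poly_fps)
  also have "\<dots> = fps_of_poly ?P" unfolding HS_regular_all fps_of_poly_mult ..
  finally have H: "int (HF (ideal_gen (insert q (g ` {1..n}))) i) = coeff ?P i" for i
    by (metis HS_def fps_nth_Abs_fps fps_of_poly_nth)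
  show thesis
  proof (rule that[of "degree ?P"])
    fix i assume "i > degree ?P"
    then show "HF (ideal_gen (insert q (g ` {1..n}))) i = 0" using H[of i] by (simp add: coeff_eq_0)
  next
    fix M assume M: "M \<ge> degree ?P"
    have "int (\<Sum>i\<le>M. HF (ideal_gen (insert q (g ` {1..n}))) i) = (\<Sum>i\<le>M. coeff ?P i)"
      unfolding of_nat_sum H ..
    also have "\<dots> = int (e * (\<Prod>i=1..n. d i))"
      using M by (subst sum_coeff_eq_poly_1) (auto simp: poly_prod)
    finally show "(\<Sum>i\<le>M. HF (ideal_gen (insert q (g ` {1..n}))) i) = e * (\<Prod>i=1..n. d i)"
      using of_nat_eq_iff by blast
  qed
qed

end

section \<open>Evaluation homomorphisms\<close>

definition mono_val :: "('w \<Rightarrow> 'r::comm_monoid_mult) \<Rightarrow> ('w \<Rightarrow>\<^sub>0 nat) \<Rightarrow> 'r" where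
  "mono_val \<phi> m = (\<Prod>w\<in>keys m. \<phi> w ^ lkp m w)"

lemma mono_val_superset:
  "finite A \<Longrightarrow> keys m \<subseteq> A \<Longrightarrow> mono_val \<phi> m = (\<Prod>w\<in>A. \<phi> w ^ lkp m w)"
  unfolding mono_val_def by (intro prod.mono_neutral_left) (auto simp: in_keys_iff)

lemma mono_val_add: "mono_val \<phi> (m + m') = mono_val \<phi> m * mono_val \<phi> m'"
proof -
  let ?A = "keys m \<union> keys m'"
  have "mono_val \<phi> (m + m') = (\<Prod>w\<in>?A. \<phi> w ^ lkp (m + m') w)"
    by (rule mono_val_superset) (use keys_add[of m m'] in auto)
  also have "\<dots> = (\<Prod>w\<in>?A. \<phi> w ^ lkp m w) * (\<Prod>w\<in>?A. \<phi> w ^ lkp m' w)"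
    by (simp add: lookup_add power_add prod.distrib)
  also have "\<dots> = mono_val \<phi> m * mono_val \<phi> m'"
    by (simp add: mono_val_superset[of ?A m] mono_val_superset[of ?A m'])
  finally show ?thesis .
qed

lemma mono_val_0 [simp]: "mono_val \<phi> 0 = 1"
  and mono_val_single [simp]: "mono_val \<phi> (Poly_Mapping.single w k) = \<phi> w ^ k"
  by (simp_all add: mono_val_def)

text \<open>Keeping the coefficient map as a parameter covers two cases: evaluation at a point for
  the identity, substitution of polynomials (\<open>msubst\<close>) for \<open>cst\<close>.\<close>

definition mp_hom :: "('k::comm_ring_1 \<Rightarrow> 'r::comm_ring_1) \<Rightarrow> ('w \<Rightarrow> 'r) \<Rightarrow> ('w, 'k) mpoly \<Rightarrow> 'r" where
  "mp_hom \<kappa> \<phi> p = (\<Sum>m\<in>keys p. \<kappa> (lkp p m) * mono_val \<phi> m)"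

locale coeff_hom =
  fixes \<kappa> :: "'k::comm_ring_1 \<Rightarrow> 'r::comm_ring_1"
  assumes \<kappa>_0: "\<kappa> 0 = 0" and \<kappa>_1: "\<kappa> 1 = 1"
    and \<kappa>_add: "\<kappa> (a + b) = \<kappa> a + \<kappa> b" and \<kappa>_mult: "\<kappa> (a * b) = \<kappa> a * \<kappa> b"
begin

lemma mp_hom_0 [simp]: "mp_hom \<kappa> \<phi> 0 = 0"
  by (simp add: mp_hom_def)

lemma mp_hom_add: "mp_hom \<kappa> \<phi> (p + q) = mp_hom \<kappa> \<phi> p + mp_hom \<kappa> \<phi> q"
  unfolding mp_hom_def by (rule setsum_keys_plus_distrib) (simp_all add: \<kappa>_0 \<kappa>_add algebra_simps)

lemma mp_hom_single [simp]: "mp_hom \<kappa> \<phi> (Poly_Mapping.single m c) = \<kappa> c * mono_val \<phi> m"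
  by (simp add: mp_hom_def \<kappa>_0)

lemma mp_hom_sum: "mp_hom \<kappa> \<phi> (sum f A) = (\<Sum>x\<in>A. mp_hom \<kappa> \<phi> (f x))"
  by (induction A rule: infinite_finite_induct) (auto simp: mp_hom_add)

lemma mp_hom_mult: "mp_hom \<kappa> \<phi> (p * q) = mp_hom \<kappa> \<phi> p * mp_hom \<kappa> \<phi> q"
proof -
  have "p * q = (\<Sum>m\<in>keys p. Poly_Mapping.single m (lkp p m)) * (\<Sum>m\<in>keys q. Poly_Mapping.single m (lkp q m))"
    by (simp add: poly_mapping_sum_singles[OF finite_keys subset_refl, symmetric])
  also have "mp_hom \<kappa> \<phi> \<dots> = (\<Sum>m\<in>keys p. \<Sum>m'\<in>keys q. \<kappa> (lkp p m) * mono_val \<phi> m * (\<kappa> (lkp q m') * mono_val \<phi> m'))"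
    by (simp add: sum_product mp_hom_sum mult_single \<kappa>_mult mono_val_add mult_ac)
  also have "\<dots> = mp_hom \<kappa> \<phi> p * mp_hom \<kappa> \<phi> q"
    by (simp add: mp_hom_def sum_product)
  finally show ?thesis .
qed

lemma mp_hom_1 [simp]: "mp_hom \<kappa> \<phi> 1 = 1"
  using mp_hom_single[of \<phi> 0 1] by (simp del: mp_hom_single add: \<kappa>_1)

lemma mp_hom_cst [simp]: "mp_hom \<kappa> \<phi> (cst c) = \<kappa> c"
  by (simp add: cst_def)

lemma mp_hom_mvar [simp]: "mp_hom \<kappa> \<phi> (mvar v) = \<phi> v"
  by (simp add: mvar_def \<kappa>_1)

lemma mp_hom_power: "mp_hom \<kappa> \<phi> (p ^ k) = mp_hom \<kappa> \<phi> p ^ k"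
  by (induction k) (auto simp: mp_hom_mult)

lemma mp_hom_uminus: "mp_hom \<kappa> \<phi> (- p) = - mp_hom \<kappa> \<phi> p"
  using mp_hom_add[of \<phi> p "-p"] by (simp add: eq_neg_iff_add_eq_0 add.commute)

lemma mp_hom_diff: "mp_hom \<kappa> \<phi> (p - q) = mp_hom \<kappa> \<phi> p - mp_hom \<kappa> \<phi> q"
  using mp_hom_add[of \<phi> p "-q"] by (simp add: mp_hom_uminus)

lemma mp_hom_prod: "mp_hom \<kappa> \<phi> (prod f A) = (\<Prod>x\<in>A. mp_hom \<kappa> \<phi> (f x))"
  by (induction A rule: infinite_finite_induct) (auto simp: mp_hom_mult)

lemma mp_hom_mono_val: "mp_hom \<kappa> \<phi> (mono_val \<psi> m) = mono_val (\<lambda>w. mp_hom \<kappa> \<phi> (\<psi> w)) m"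
  by (simp add: mono_val_def mp_hom_prod mp_hom_power)

end

interpretation cst: coeff_hom "cst :: 'k::field \<Rightarrow> ('w, 'k) mpoly"
  by unfold_locales (auto simp: cst_add cst_mult)

interpretation idh: coeff_hom "\<lambda>c :: 'k::comm_ring_1. c"
  by unfold_locales auto

abbreviation msubst :: "('w \<Rightarrow> ('v, 'k::field) mpoly) \<Rightarrow> ('w, 'k) mpoly \<Rightarrow> ('v, 'k) mpoly" where
  "msubst \<phi> \<equiv> mp_hom cst \<phi>"

lemma mp_eval_eq: "mp_eval p x = mp_hom (\<lambda>c. c) x p"
  by (simp add: mp_eval_def mp_hom_def mono_val_def)

lemma mono_val_mvar: "mono_val mvar m = (Poly_Mapping.single m 1 :: ('v, 'k::field) mpoly)"
proof -
  have "mvar w ^ k = (Poly_Mapping.single (Poly_Mapping.single w k) 1 :: ('v, 'k) mpoly)" for w k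
    by (induction k) (auto simp: mvar_def mult_single single_add[symmetric] add.commute)
  moreover have "(\<Prod>w\<in>A. Poly_Mapping.single (f w) 1) = (Poly_Mapping.single (sum f A) 1 :: ('v, 'k) mpoly)"
    for f :: "'v \<Rightarrow> 'v \<Rightarrow>\<^sub>0 nat" and A
    by (induction A rule: infinite_finite_induct) (auto simp: mult_single)
  ultimately show ?thesis
    by (simp add: mono_val_def poly_mapping_sum_singles[of "keys m" m, OF finite_keys subset_refl, symmetric])
qed

lemma msubst_mvar [simp]: "msubst mvar p = p"
  by (simp add: mp_hom_def mono_val_mvar cst_def mult_single
      poly_mapping_sum_singles[of "keys p" p, OF finite_keys subset_refl, symmetric])

lemma msubst_msubst: "msubst \<psi> (msubst \<phi> p) = msubst (\<lambda>w. msubst \<psi> (\<phi> w)) p"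
  by (simp add: mp_hom_def[of cst \<phi>] cst.mp_hom_sum cst.mp_hom_mult cst.mp_hom_mono_val)
    (simp add: mp_hom_def)

section \<open>Congruences modulo an ideal\<close>

definition icong :: "'a::comm_ring_1 set \<Rightarrow> 'a \<Rightarrow> 'a \<Rightarrow> bool" where
  "icong I a b \<longleftrightarrow> a - b \<in> I"

lemma icong_refl: "is_ideal I \<Longrightarrow> icong I a a"
  by (simp add: icong_def ideal_0)

lemma icong_mult:
  assumes I: "is_ideal I" and "icong I a a'" "icong I b b'" shows "icong I (a * b) (a' * b')"
proof -
  have "(a - a') * b + a' * (b - b') \<in> I"
    using assms(2,3) unfolding icong_def
    by (intro ideal_add[OF I] ideal_mult_right[OF I] ideal_mult_left[OF I])
  then show ?thesis by (simp add: icong_def algebra_simps)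
qed

lemma icong_power:
  assumes I: "is_ideal I" and "icong I a b" shows "icong I (a ^ k) (b ^ k)"
proof (induction k)
  case (Suc k)
  then show ?case unfolding power_Suc by (rule icong_mult[OF assms])
qed (simp add: icong_refl[OF I])

lemma icong_sum:
  assumes I: "is_ideal I" and "\<And>x. x \<in> A \<Longrightarrow> icong I (f x) (g x)" shows "icong I (sum f A) (sum g A)"
  unfolding icong_def sum_subtractf[symmetric]
  by (rule ideal_sum_mem[OF I]) (use assms(2) in \<open>auto simp: icong_def\<close>)

lemma icong_prod:
  assumes I: "is_ideal I" and "\<And>x. x \<in> A \<Longrightarrow> icong I (f x) (g x)" shows "icong I (prod f A) (prod g A)"
  using assms(2)
proof (induction A rule: infinite_finite_induct)
  case (insert w A)
  then show ?case unfolding prod.insert[OF insert.hyps] by (intro icong_mult[OF I]) simp_all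
qed (simp_all add: icong_refl[OF I])

lemma icong_mem_iff:
  assumes I: "is_ideal I" and "icong I a b" shows "a \<in> I \<longleftrightarrow> b \<in> I"
proof
  assume "a \<in> I"
  then have "a - (a - b) \<in> I" using assms(2) unfolding icong_def by (rule ideal_diff[OF I])
  then show "b \<in> I" by simp
next
  assume "b \<in> I"
  then have "(a - b) + b \<in> I" using assms(2) unfolding icong_def by (intro ideal_add[OF I])
  then show "a \<in> I" by simp
qed

text \<open>Modulo I every variable is a constant, and substitution respects congruences.\<close>

lemma mp_eval_cong_mod:
  fixes I :: "('v, 'k::field) mpoly set"
  assumes I: "is_ideal I" and "\<And>v. icong I (mvar v) (cst (x v))"
  shows "icong I f (cst (mp_eval f x))"
proof -
  have "icong I (msubst mvar f) (msubst (\<lambda>v. cst (x v)) f)"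
    unfolding mp_hom_def mono_val_def
    by (intro icong_sum[OF I] icong_mult[OF I] icong_prod[OF I] icong_power[OF I] icong_refl[OF I] assms(2))
  moreover have "msubst (\<lambda>v. cst (x v)) f = (cst (mp_eval f x) :: ('v, 'k) mpoly)"
    by (simp add: mp_eval_eq mp_hom_def cst_sum cst_mult mono_val_def cst_prod cst_power)
  ultimately show ?thesis by simp
qed

section \<open>Apolarity\<close>

definition linform :: "('v::finite \<Rightarrow> 'k::field) \<Rightarrow> ('v, 'k) mpoly" where
  "linform l = (\<Sum>v\<in>UNIV. cst (l v) * mvar v)"

text \<open>The factorial m! of a multi-index, the weight that relates differentiation to
  coefficients.\<close>

definition mfact :: "('v::finite \<Rightarrow>\<^sub>0 nat) \<Rightarrow> 'k::field_char_0" where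
  "mfact m = (\<Prod>v\<in>UNIV. fact (lkp m v))"

lemma mfact_nonzero [simp]: "mfact m \<noteq> 0"
  by (simp add: mfact_def)

lemma mfact_0 [simp]: "mfact 0 = 1"
  by (simp add: mfact_def)

lemma homog_linform [simp]: "homog 1 (linform l)"
  unfolding linform_def by (intro homog_sum homog_cst_mult homog_mvar)

lemma homog_1_linform:
  assumes "homog 1 (p :: ('v::finite, 'k::field) mpoly)"
  shows "p = linform (\<lambda>v. lkp p (Poly_Mapping.single v 1))"
proof -
  have "keys p \<subseteq> (\<lambda>v. Poly_Mapping.single v 1) ` UNIV"
  proof
    fix m assume "m \<in> keys p"
    then have "(\<Sum>v\<in>UNIV. lkp m v) = 1" using assms by (auto simp: homog_def mdeg_conv)
    then obtain v where v: "lkp m v = 1" "\<And>w. w \<noteq> v \<Longrightarrow> lkp m w = 0"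
      using sum_eq_1_iff[of UNIV "lkp m"] by force
    have "m = Poly_Mapping.single v 1"
      by (rule poly_mapping_eqI) (auto simp: lookup_single when_def v)
    then show "m \<in> (\<lambda>v. Poly_Mapping.single v 1) ` UNIV" by blast
  qed
  then have "p = (\<Sum>m\<in>(\<lambda>v. Poly_Mapping.single v 1) ` UNIV. Poly_Mapping.single m (lkp p m))"
    by (intro poly_mapping_sum_singles) auto
  also have "\<dots> = (\<Sum>v\<in>UNIV. Poly_Mapping.single (Poly_Mapping.single v 1) (lkp p (Poly_Mapping.single v 1)))"
    by (rule sum.reindex_cong[OF _ refl refl])
      (auto simp: inj_on_def poly_mapping_eq_iff fun_eq_iff lookup_single when_def split: if_splits)
  finally show ?thesis by (simp add: linform_def cst_def mvar_def mult_single)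
qed

lemma lookup_mvar_mult:
  "lkp (mvar v * p) m = (if lkp m v > 0 then lkp p (m - Poly_Mapping.single v 1) else (0::'k::field))"
proof -
  have eq: "Poly_Mapping.single v 1 + m' = m \<longleftrightarrow> lkp m v > 0 \<and> m' = m - Poly_Mapping.single v 1" for m'
  proof safe
    fix m' assume "m = Poly_Mapping.single v 1 + m'"
  next
    assume "lkp m v > 0"
    then show "Poly_Mapping.single v 1 + (m - Poly_Mapping.single v 1) = m"
      by (intro poly_mapping_eqI) (auto simp: lookup_add lookup_minus lookup_single when_def)
  qed (auto simp: lookup_add)
  have "mvar v * p = (\<Sum>m'\<in>keys p. Poly_Mapping.single (Poly_Mapping.single v 1 + m') (lkp p m'))"
    by (subst poly_mapping_sum_singles[of "keys p" p])
      (auto simp: sum_distrib_left mvar_def mult_single)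
  then have "lkp (mvar v * p) m = (\<Sum>m'\<in>keys p. if lkp m v > 0 \<and> m' = m - Poly_Mapping.single v 1 then lkp p m' else 0)"
    by (simp add: lookup_sum lookup_single when_def eq del: One_nat_def)
  also have "\<dots> = (if lkp m v > 0 then lkp p (m - Poly_Mapping.single v 1) else 0)"
    by (auto simp: in_keys_iff)
  finally show ?thesis .
qed

text \<open>Multinomial theorem, by splitting off one linear factor: the exponents m_v add up to D +
  1 and turn D! into (D + 1)!.\<close>

lemma lookup_linform_power:
  fixes l :: "'v::finite \<Rightarrow> 'k::field_char_0"
  shows "lkp (linform l ^ D) m = (if mdeg m = D then fact D / mfact m * mono_val l m else 0)"
proof (induction D arbitrary: m)
  case 0
  have "mdeg m = 0 \<longleftrightarrow> m = 0" by (auto simp: mdeg_conv poly_mapping_eq_iff fun_eq_iff)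
  then show ?case by (auto simp: lookup_one when_def)
next
  case (Suc D)
  have "homog (1 * Suc D) (linform l ^ Suc D)" by (intro homog_power homog_linform)
  then have hom: "lkp (linform l ^ Suc D) m = 0" if "mdeg m \<noteq> Suc D" using that unfolding homog_iff by auto
  show ?case
  proof (cases "mdeg m = Suc D")
    case True
    \<comment> \<open>This also holds for m_v = 0, where both sides vanish, so it can be summed over
      all v.\<close>
    have term_eq: "l v * lkp (mvar v * linform l ^ D) m = fact D / mfact m * mono_val l m * of_nat (lkp m v)" for v
    proof (cases "lkp m v > 0")
      case pos: True
      define m' where "m' = m - Poly_Mapping.single v 1"
      have m: "m = m' + Poly_Mapping.single v 1" unfolding m'_def using pos
        by (intro poly_mapping_eqI) (auto simp: lookup_add lookup_minus lookup_single when_def)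
      have deg: "mdeg m' = D" using True by (simp add: m mdeg_add)
      have "mfact m = (\<Prod>w\<in>UNIV. fact (lkp m' w) * (if w = v then of_nat (lkp m v) else 1))"
        unfolding mfact_def by (intro prod.cong refl) (auto simp: m lookup_add lookup_single when_def)
      also have "\<dots> = mfact m' * (of_nat (lkp m v) :: 'k)" by (simp add: prod.distrib mfact_def)
      finally have "(mfact m :: 'k) = mfact m' * of_nat (lkp m v)" .
      moreover have "mono_val l m = mono_val l m' * l v" by (simp add: m mono_val_add)
      ultimately show ?thesis using pos deg Suc.IH[of m']
        by (simp add: lookup_mvar_mult m'_def[symmetric] del: One_nat_def)
    qed (simp add: lookup_mvar_mult)
    have "lkp (linform l ^ Suc D) m = (\<Sum>v\<in>UNIV. l v * lkp (mvar v * linform l ^ D) m)"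
      by (simp add: linform_def sum_distrib_right lookup_sum mult.assoc)
    also have "\<dots> = fact D / mfact m * mono_val l m * of_nat (mdeg m)"
      by (simp add: term_eq mdeg_conv sum_distrib_left)
    finally show ?thesis using True by (simp add: field_simps)
  qed (use hom in auto)
qed

lemma of_nat_exact_div: "n dvd m \<Longrightarrow> n \<noteq> 0 \<Longrightarrow> of_nat (m div n) = (of_nat m / of_nat n :: 'k::field_char_0)"
  by (auto elim!: dvdE)

text \<open>Only the term x^(b+m) of F is mapped to x^b, with factor (b+m)!/b!.\<close>

lemma lookup_diff_mon:
  fixes F :: "('v::finite, 'k::field_char_0) mpoly"
  shows "lkp (diff_mon m F) b = lkp F (b + m) * mfact (b + m) / mfact b"
proof -
  have eq: "mon_le m a \<and> a - m = b \<longleftrightarrow> a = b + m" for a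
  proof safe
    assume "mon_le m a"
    then show "a = a - m + m"
      by (intro poly_mapping_eqI) (simp add: mon_le_def lookup_add lookup_minus)
  qed (auto simp: mon_le_def lookup_add)
  have coef: "of_nat (\<Prod>v\<in>keys a. fact (lkp a v) div fact (lkp a v - lkp m v)) = (mfact a / mfact (a - m) :: 'k)" for a
  proof -
    have "(\<Prod>v\<in>keys a. fact (lkp a v) div fact (lkp a v - lkp m v))
        = (\<Prod>v\<in>UNIV. fact (lkp a v) div fact (lkp a v - lkp m v) :: nat)"
      by (intro prod.mono_neutral_left) (auto simp: in_keys_iff)
    also have "(of_nat \<dots> :: 'k) = (\<Prod>v\<in>UNIV. fact (lkp a v) / fact (lkp (a - m) v))"
      unfolding of_nat_prod
      by (intro prod.cong refl, subst of_nat_exact_div) (auto simp: lookup_minus fact_dvd)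
    finally show ?thesis by (simp add: mfact_def prod_dividef)
  qed
  have "lkp (diff_mon m F) b = (\<Sum>a\<in>keys F. if a = b + m then lkp F a * (mfact a / mfact (a - m)) else 0)"
    unfolding diff_mon_def coef lookup_sum
    by (intro sum.cong refl) (use eq in \<open>auto simp: lookup_single when_def\<close>)
  also have "\<dots> = lkp F (b + m) * mfact (b + m) / mfact b"
    by (auto simp: in_keys_iff)
  finally show ?thesis .
qed

lemma lookup_apolar:
  fixes f F :: "('v::finite, 'k::field_char_0) mpoly"
  shows "lkp (apolar f F) b = (\<Sum>m\<in>keys f. lkp f m * (lkp F (b + m) * mfact (b + m) / mfact b))"
  by (simp add: apolar_def lookup_sum lookup_diff_mon)

lemma apolar_sum_right:
  fixes f :: "('v::finite, 'k::field_char_0) mpoly"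
  shows "apolar f (\<Sum>x\<in>A. F x) = (\<Sum>x\<in>A. apolar f (F x))"
proof (rule poly_mapping_eqI)
  fix b
  show "lkp (apolar f (\<Sum>x\<in>A. F x)) b = lkp (\<Sum>x\<in>A. apolar f (F x)) b"
    unfolding lookup_apolar lookup_sum sum_distrib_right sum_divide_distrib sum_distrib_left
    by (rule sum.swap)
qed

text \<open>The factor (b+m)! cancels against the coefficient D!/(b+m)! of the power, and l^(b+m) =
  l^b l^m; so every coefficient of the result carries the factor f(l).\<close>

lemma apolar_linform_power:
  fixes f :: "('v::finite, 'k::field_char_0) mpoly"
  assumes "homog i f" "mp_eval f l = 0"
  shows "apolar f (linform l ^ D) = 0"
proof (rule poly_mapping_eqI)
  fix b
  have "lkp (apolar f (linform l ^ D)) b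
      = (\<Sum>m\<in>keys f. lkp f m * mono_val l m * (if mdeg b + i = D then fact D * mono_val l b / mfact b else 0))"
    unfolding lookup_apolar
    by (rule sum.cong[OF refl])
      (use assms(1) in \<open>auto simp: lookup_linform_power mdeg_add mono_val_add homog_def\<close>)
  also have "\<dots> = mp_eval f l * (if mdeg b + i = D then fact D * mono_val l b / mfact b else 0)"
    by (simp only: mp_eval_eq mp_hom_def sum_distrib_right)
  finally show "lkp (apolar f (linform l ^ D)) b = lkp 0 b" using assms(2) by simp
qed

text \<open>Between forms of equal degree the result of differentiation is a constant, read off as
  the coefficient at 0. The weights m! are nonzero in characteristic zero, which makes the pairing
  perfect in each degree.\<close>

definition pairing :: "('v::finite, 'k::field_char_0) mpoly \<Rightarrow> ('v, 'k) mpoly \<Rightarrow> 'k" where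
  "pairing f G = lkp (apolar f G) 0"

lemma pairing_eq: "pairing f G = (\<Sum>m\<in>keys f. lkp f m * (lkp G m * mfact m))"
  by (simp add: pairing_def lookup_apolar)

lemma pairing_superset:
  "finite A \<Longrightarrow> keys f \<subseteq> A \<Longrightarrow> pairing f G = (\<Sum>m\<in>A. lkp f m * (lkp G m * mfact m))"
  unfolding pairing_eq by (intro sum.mono_neutral_left) (auto simp: in_keys_iff)

lemma pairing_add_left: "pairing (f + f') G = pairing f G + pairing f' G"
proof -
  have "keys (f + f') \<subseteq> keys f \<union> keys f'" by (rule keys_add)
  then show ?thesis
    using pairing_superset[of "keys f \<union> keys f'" f G] pairing_superset[of "keys f \<union> keys f'" f' G]
      pairing_superset[of "keys f \<union> keys f'" "f + f'" G]
    by (simp add: lookup_add algebra_simps sum.distrib)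
qed

lemma pairing_smult_left: "pairing (smult_mp c f) G = c * pairing f G"
proof -
  have "keys (smult_mp c f) \<subseteq> keys f" by (auto simp: in_keys_iff)
  then show ?thesis using pairing_superset[of "keys f" "smult_mp c f" G]
    by (simp add: pairing_eq sum_distrib_left mult.assoc)
qed

lemma pairing_linform_power:
  assumes "homog D f" shows "pairing f (linform l ^ D) = fact D * mp_eval f l"
  unfolding pairing_eq mp_eval_eq mp_hom_def sum_distrib_left
  by (rule sum.cong[OF refl]) (use assms in \<open>auto simp: homog_def lookup_linform_power\<close>)

text \<open>Perfectness of the pairing in degree D: the coefficient of the representing form at m is
  the value on x^m divided by m!.\<close>

lemma functional_eq_pairing:
  fixes \<phi> :: "('v::finite, 'k::field_char_0) mpoly \<Rightarrow> 'k"
  assumes add: "\<And>x y. \<phi> (x + y) = \<phi> x + \<phi> y" and sc: "\<And>c x. \<phi> (smult_mp c x) = c * \<phi> x"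
  obtains f where "homog D f" "\<And>G. homog D G \<Longrightarrow> pairing f G = \<phi> G"
proof -
  let ?M = "{m :: 'v \<Rightarrow>\<^sub>0 nat. mdeg m = D}"
  define f where "f = (\<Sum>m\<in>?M. Poly_Mapping.single m (\<phi> (Poly_Mapping.single m 1) / mfact m))"
  have lf: "lkp f m = (if mdeg m = D then \<phi> (Poly_Mapping.single m 1) / mfact m else 0)" for m
  proof -
    have "lkp f m = (\<Sum>m'\<in>?M. if m = m' then \<phi> (Poly_Mapping.single m' 1) / mfact m' else 0)"
      unfolding f_def lookup_sum by (intro sum.cong refl) (auto simp: lookup_single when_def)
    then show ?thesis by (simp only: sum.delta'[OF finite_mdeg] mem_Collect_eq)
  qed
  have 0: "\<phi> 0 = 0" using sc[of 0 0] by simp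
  have sum: "\<phi> (sum h A) = (\<Sum>x\<in>A. \<phi> (h x))" for h :: "_ \<Rightarrow> ('v, 'k) mpoly" and A :: "('v \<Rightarrow>\<^sub>0 nat) set"
    by (induction A rule: infinite_finite_induct) (auto simp: add 0)
  show thesis
  proof
    show "homog D f" by (auto simp: homog_iff lf)
    fix G :: "('v, 'k) mpoly" assume G: "homog D G"
    have "G = (\<Sum>m\<in>?M. smult_mp (lkp G m) (Poly_Mapping.single m 1))"
      using poly_mapping_sum_singles[of ?M G] G finite_mdeg
      by (auto simp: homog_def smult_mp_conv cst_def mult_single)
    then have "\<phi> G = \<phi> (\<Sum>m\<in>?M. smult_mp (lkp G m) (Poly_Mapping.single m 1))" by simp
    also have "\<dots> = (\<Sum>m\<in>?M. lkp G m * \<phi> (Poly_Mapping.single m 1))" by (simp only: sum sc)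
    also have "\<dots> = (\<Sum>m\<in>?M. lkp f m * (lkp G m * mfact m))" by (intro sum.cong) (auto simp: lf)
    also have "\<dots> = pairing f G" using finite_mdeg[of D]
      by (intro pairing_superset[symmetric]) (auto simp: in_keys_iff lf split: if_splits)
    finally show "pairing f G = \<phi> G" by simp
  qed
qed

lemma exists_functional:
  fixes v :: "('v, 'k::field) mpoly"
  assumes "v \<notin> mp.span S"
  obtains \<phi> where "\<And>x y. \<phi> (x + y) = \<phi> x + \<phi> y" "\<And>c x. \<phi> (smult_mp c x) = c * \<phi> x"
    "\<phi> v = 1" "\<And>s. s \<in> mp.span S \<Longrightarrow> \<phi> s = (0 :: 'k)"
proof -
  obtain B where B: "B \<subseteq> S" "mp.independent B" "S \<subseteq> mp.span B"
    using mp.maximal_independent_subset by blast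
  have span: "mp.span B = mp.span S" using B mp.span_mono mp.span_span by (metis subset_antisym)
  have ind: "mp.independent (insert v B)" using assms B by (intro mp.independent_insertI) (auto simp: span)
  have vs: "vector_space ((*) :: 'k \<Rightarrow> 'k \<Rightarrow> 'k)" by unfold_locales (auto simp: algebra_simps)
  have vp: "vector_space_pair (smult_mp :: 'k \<Rightarrow> ('v, 'k) mpoly \<Rightarrow> _) ((*) :: 'k \<Rightarrow> 'k \<Rightarrow> 'k)"
    using vs mp.vector_space_axioms by (simp add: vector_space_pair_def)
  obtain \<phi> where lin: "Vector_Spaces.linear smult_mp (*) \<phi>"
    and \<phi>: "\<forall>x\<in>insert v B. \<phi> x = (if x = v then 1 else (0::'k))"
    using vector_space_pair.linear_independent_extend[OF vp ind, of "\<lambda>x. if x = v then 1 else 0"] by blast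
  have add: "\<phi> (x + y) = \<phi> x + \<phi> y" and sc: "\<phi> (smult_mp c x) = c * \<phi> x" for x y c
    using lin unfolding Vector_Spaces.linear_iff by auto
  have vB: "v \<notin> B" using assms B mp.span_base by auto
  have "mp.subspace {x. \<phi> x = 0}"
    using sc[of 0 0] by (intro mp.subspaceI) (auto simp: add sc)
  moreover have "B \<subseteq> {x. \<phi> x = 0}" using \<phi> vB by auto
  ultimately have "mp.span B \<subseteq> {x. \<phi> x = 0}" by (intro mp.span_minimal)
  then show thesis using that[of \<phi>] add sc \<phi> span by auto
qed

text \<open>No ideal of points is formed: \<open>I X i\<close>, the forms of degree i vanishing at
  the points off q = 0, is treated degree by degree, and \<open>h\<close> plays the role of its
  Hilbert function. \<open>B\<close> enters as an ideal containing q and the forms of (perp F :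
  q).\<close>

lemma waring_lower_bound:
  fixes q :: "('v::finite, 'k::field_char_0) mpoly"
  assumes F: "F = (\<Sum>j<r. linform (l j) ^ D)" and q: "homog e q" "q \<in> B" and B: "is_ideal B"
    and colon: "\<And>f i. homog i f \<Longrightarrow> f * q \<in> perp F \<Longrightarrow> f \<in> B"
  shows "(\<Sum>i\<le>N. HF B i) \<le> e * r"
proof -
  define I where "I Y i = {f. homog i f \<and> (\<forall>j\<in>Y. mp_eval f (l j) = 0)}" for Y i
  define X where "X = {j. j < r \<and> mp_eval q (l j) \<noteq> 0}"
  define h where "h i = mp.dim (Tdeg i :: ('v, 'k) mpoly set) - mp.dim (I X i)" for i
  have ev_add: "mp_eval (x + y) p = mp_eval x p + mp_eval y p"
    and ev_mult: "mp_eval (x * y) p = mp_eval x p * mp_eval y p"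
    and ev_cst: "mp_eval (cst c) p = c" and ev_0: "mp_eval 0 p = 0" for x y :: "('v, 'k) mpoly" and p c
    by (simp_all add: mp_eval_eq idh.mp_hom_add idh.mp_hom_mult)
  have Isub: "I Y i \<subseteq> Tdeg i" for Y i by (auto simp: I_def)
  have Isp: "mp.subspace (I Y i)" for Y i
    by (rule mp.subspaceI)
      (auto simp: I_def ev_add ev_mult ev_cst ev_0 smult_mp_conv intro: homog_add homog_cst_mult)
  \<comment> \<open>Each point imposes at most one linear condition. Coinciding points do no harm,
    since only this upper bound is wanted.\<close>
  have codim: "mp.dim (Tdeg i :: ('v, 'k) mpoly set) \<le> mp.dim (I Y i) + card Y" if "finite Y" for Y i
    using that
  proof (induction Y rule: finite_induct)
    case empty
    have "I {} i = Tdeg i" by (auto simp: I_def)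
    then show ?case by simp
  next
    case (insert j Y)
    have "mp.dim (I Y i) \<le> mp.dim {f \<in> I Y i. mp_eval f (l j) = 0} + 1"
      by (rule mp.dim_le_kernel_plus_1[OF Isp subspace_graded_subset_span[OF Isub]])
        (auto simp: ev_add ev_mult ev_cst smult_mp_conv)
    moreover have "{f \<in> I Y i. mp_eval f (l j) = 0} = I (insert j Y) i" by (auto simp: I_def)
    ultimately show ?case using insert by simp
  qed
  have "card X \<le> card {..<r}" by (rule card_mono) (auto simp: X_def)
  moreover have "finite X" by (simp add: X_def)
  ultimately have h_le: "h i \<le> r" for i using codim[of X i] by (simp add: h_def)
  have dimI: "mp.dim (I X i) + h i = mp.dim (Tdeg i :: ('v, 'k) mpoly set)" for i
    using dim_le_Tdeg[OF Isub subset_refl, of X i] by (simp add: h_def)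
  \<comment> \<open>On \<open>X\<close> the form f vanishes, at the other points q does; hence f q
    kills every summand of F.\<close>
  have IB: "f \<in> B" if f: "f \<in> I X i" for f i
  proof (rule colon)
    show "homog i f" using f by (simp add: I_def)
    then have hom: "homog (i + e) (f * q)" using q(1) by (intro homog_mult)
    have "mp_eval (f * q) (l j) = 0" if "j < r" for j
      using f that by (cases "j \<in> X") (auto simp: ev_mult I_def X_def)
    then have "apolar (f * q) F = 0" unfolding F apolar_sum_right
      using apolar_linform_power[OF hom] by (intro sum.neutral) auto
    then show "f * q \<in> perp F" by (simp add: perp_def)
  qed
  \<comment> \<open>For e <= i, B in degree i contains I_i + q T_(i-e), which has codimension h(i) -
    h(i-e) because q has no zero on \<open>X\<close>.\<close>
  have step: "HF B i + (if e \<le> i then h (i - e) else 0) \<le> h i" for i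
  proof (cases "e \<le> i")
    case True
    have "homog i (v * q)" if "homog (i - e) v" for v
      using homog_mult[OF that q(1)] True by simp
    then have mult: "v * q \<in> I X i \<longleftrightarrow> v \<in> I X (i - e)" if "homog (i - e) v" for v
      using that by (auto simp: I_def ev_mult X_def)
    have "mp.dim {b + v * q | b v. b \<in> I X i \<and> v \<in> Tdeg (i - e)} + mp.dim (I X (i - e))
        = mp.dim (I X i) + mp.dim (Tdeg (i - e) :: ('v, 'k) mpoly set)"
      by (rule dim_plus_mult[OF Isp Isub Isp Isub mult])
    moreover have "mp.dim {b + v * q | b v. b \<in> I X i \<and> v \<in> Tdeg (i - e)} \<le> mp.dim (graded_part i B)"
    proof (rule dim_le_Tdeg[OF _ graded_part_subset], safe)
      fix b v :: "('v, 'k) mpoly" assume bv: "b \<in> I X i" "v \<in> Tdeg (i - e)"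
      have "homog i (b + v * q)" using bv homog_mult[of "i - e" v e q] q(1) True by (auto simp: I_def intro: homog_add)
      moreover have "b + v * q \<in> B" using bv(1) by (intro ideal_add[OF B] ideal_mult_left[OF B q(2)] IB)
      ultimately show "b + v * q \<in> graded_part i B" by (simp add: mem_graded_part)
    qed
    ultimately show ?thesis using HF_plus_dim[of B i] dimI[of i] dimI[of "i - e"] True by simp
  next
    case False
    have "mp.dim (I X i) \<le> mp.dim (graded_part i B)"
      using IB by (intro dim_le_Tdeg[OF _ graded_part_subset]) (auto simp: mem_graded_part I_def)
    then show ?thesis using HF_plus_dim[of B i] dimI[of i] False by simp
  qed
  have "(\<Sum>i\<le>N. HF B i) + (\<Sum>i\<le>N. if e \<le> i then h (i - e) else 0) \<le> (\<Sum>i\<le>N. h i)"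
    unfolding sum.distrib[symmetric] by (rule sum_mono) (rule step)
  \<comment> \<open>Telescoping leaves the last e values of \<open>h\<close>. If N + 1 < e,
    truncated subtraction makes the range start at 0, and it still has at most e elements.\<close>
  moreover have "(\<Sum>i\<le>N. h i) \<le> (\<Sum>i\<le>N. if e \<le> i then h (i - e) else 0) + e * r"
  proof -
    have "(\<Sum>i\<le>N. if e \<le> i then h (i - e) else 0) = (\<Sum>i\<in>{e..N}. h (i - e))"
      by (rule sum.mono_neutral_cong_right) auto
    also have "\<dots> = (\<Sum>i<Suc N - e. h i)"
      by (rule sum.reindex_bij_witness[of _ "\<lambda>i. i + e" "\<lambda>i. i - e"]) auto
    finally have eq: "(\<Sum>i\<le>N. if e \<le> i then h (i - e) else 0) = (\<Sum>i<Suc N - e. h i)" .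
    have "(\<Sum>i\<le>N. h i) = (\<Sum>i<Suc N - e. h i) + (\<Sum>i\<in>{Suc N - e..N}. h i)"
      by (subst sum.union_disjoint[symmetric]) (auto intro!: sum.cong)
    also have "(\<Sum>i\<in>{Suc N - e..N}. h i) \<le> of_nat (card {Suc N - e..N}) * r"
      using h_le by (intro sum_bounded_above)
    also have "\<dots> \<le> e * r" by (intro mult_right_mono) auto
    finally show ?thesis unfolding eq by simp
  qed
  ultimately show ?thesis by linarith
qed

lemma dim_psubset_plus_1:
  fixes V :: "('v::finite, 'k::field) mpoly set"
  assumes A: "mp.subspace A" "A \<subseteq> V" "V \<subseteq> Tdeg i" and v: "v \<in> V" "v \<notin> A"
  shows "mp.dim A + 1 \<le> mp.dim V"
proof -
  obtain D where D: "D \<subseteq> A" "mp.independent D" "A \<subseteq> mp.span D" "card D = mp.dim A"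
    using mp.basis_exists by blast
  have "mp.span D = A" using D A by (intro mp.span_subspace) auto
  then have vD: "v \<notin> mp.span D" using v by simp
  then have ind: "mp.independent (insert v D)" using D by (intro mp.independent_insertI)
  have "insert v D \<subseteq> mp.span (monoms i)" using v D A Tdeg_subset_span[of i] by blast
  then have fin: "finite (insert v D)" using mp.independent_span_bound[OF finite_monoms ind, of i] by simp
  have "v \<notin> D" using vD mp.span_base[of v D] by (rule contrapos_nn)
  then have "mp.dim A + 1 = mp.dim (insert v D)"
    using mp.dim_eq_card_independent[OF ind] fin D by simp
  also have "\<dots> \<le> mp.dim V" using v D A by (intro dim_le_Tdeg[of _ V i]) auto
  finally show ?thesis .
qed

lemma alg_closed_root:
  assumes "alg_closed_field TYPE('k::field)" "D > 0"
  obtains x where "x ^ D = (c :: 'k)"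
proof -
  have "degree (monom 1 D + [:- c:]) = D"
    using assms(2) by (subst degree_add_eq_left) (auto simp: degree_monom_eq)
  then obtain x where "poly (monom 1 D + [:- c:]) x = 0"
    using assms unfolding alg_closed_field_def by metis
  then show thesis using that by (auto simp: poly_monom)
qed

text \<open>If F were outside the span of the powers of linear forms at zeros of J, a separating
  functional would be the pairing with a form f vanishing at all these zeros; \<open>vanish\<close>
  puts f into J, so f annihilates F, a contradiction. The number of powers is at most HF J D because
  J in degree D is orthogonal to all of them.\<close>

lemma waring_upper_bound:
  fixes F :: "('v::finite, 'k::field_char_0) mpoly"
  assumes ac: "alg_closed_field TYPE('k)" and F: "homog D F" "D > 0"
    and J: "is_ideal J" "J \<subseteq> perp F"
    and vanish: "\<And>f. homog D f \<Longrightarrow> (\<And>x. (\<And>j. j \<in> J \<Longrightarrow> mp_eval j x = 0) \<Longrightarrow> mp_eval f x = 0) \<Longrightarrow> f \<in> J"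
  obtains r L where "r \<le> HF J D" "\<And>j. j < r \<Longrightarrow> homog 1 (L j)" "F = (\<Sum>j<r. L j ^ D)"
proof -
  define V where "V = {x. \<forall>j\<in>J. mp_eval j x = 0}"
  define S where "S = (\<lambda>x. linform x ^ D) ` V"
  have homS: "homog D s" if "s \<in> S" for s
    using that homog_power[OF homog_linform, of D] by (auto simp: S_def)
  have FS: "F \<in> mp.span S"
  proof (rule ccontr)
    assume "F \<notin> mp.span S"
    from exists_functional[OF this] obtain \<phi> where \<phi>: "\<And>x y. \<phi> (x + y) = \<phi> x + \<phi> y"
      "\<And>c x. \<phi> (smult_mp c x) = c * \<phi> x" "\<phi> F = 1" "\<And>s. s \<in> mp.span S \<Longrightarrow> \<phi> s = 0" by metis
    obtain f where f: "homog D f" "\<And>G. homog D G \<Longrightarrow> pairing f G = \<phi> G"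
      using functional_eq_pairing[OF \<phi>(1,2)] by metis
    have "f \<in> J"
    proof (rule vanish[OF f(1)])
      fix x assume "\<And>j. j \<in> J \<Longrightarrow> mp_eval j x = 0"
      then have xS: "linform x ^ D \<in> S" by (auto simp: S_def V_def)
      have "pairing f (linform x ^ D) = \<phi> (linform x ^ D)" using f(2) homS[OF xS] by blast
      also have "\<dots> = 0" using \<phi>(4) mp.span_base[OF xS] by blast
      finally show "mp_eval f x = 0" using pairing_linform_power[OF f(1), of x] by simp
    qed
    then have "pairing f F = 0" using J by (auto simp: perp_def pairing_def)
    then show False using f(2)[OF F(1)] \<phi>(3) by simp
  qed
  obtain B where B: "B \<subseteq> S" "mp.independent B" "S \<subseteq> mp.span B"
    using mp.maximal_independent_subset by blast
  have "B \<subseteq> mp.span (monoms D)" using B(1) homS Tdeg_subset_span[of D] by (meson mem_Tdeg subset_iff)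
  then have finB: "finite B" using mp.independent_span_bound[OF finite_monoms B(2), of D] by simp
  define K where "K C = {f :: ('v, 'k) mpoly. homog D f \<and> (\<forall>b\<in>C. pairing f b = 0)}" for C
  have Ksub: "K C \<subseteq> Tdeg D" for C by (auto simp: K_def)
  have pairing_0: "pairing 0 G = 0" for G :: "('v, 'k) mpoly" by (simp add: pairing_eq)
  have Ksp: "mp.subspace (K C)" for C
    by (rule mp.subspaceI)
      (auto simp: K_def pairing_add_left pairing_smult_left pairing_0 intro: homog_add homog_smult_mp)
  \<comment> \<open>A functional that is 1 on b and 0 on the span of C shows that each independent
    power cuts the annihilator down by at least one dimension.\<close>
  have Kdim: "mp.dim (K C) + card C \<le> mp.dim (Tdeg D :: ('v, 'k) mpoly set)" if "C \<subseteq> B" for C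
    using finite_subset[OF that finB] that
  proof (induction C rule: finite_induct)
    case empty
    have "K {} = Tdeg D" by (auto simp: K_def)
    then show ?case by simp
  next
    case (insert b C)
    have "b \<notin> mp.span C"
    proof
      assume "b \<in> mp.span C"
      moreover have "mp.span C \<subseteq> mp.span (B - {b})" using insert by (intro mp.span_mono) auto
      ultimately show False using B(2) insert.prems by (auto simp: mp.dependent_def)
    qed
    from exists_functional[OF this] obtain \<phi> where \<phi>: "\<And>x y. \<phi> (x + y) = \<phi> x + \<phi> y"
      "\<And>c x. \<phi> (smult_mp c x) = c * \<phi> x" "\<phi> b = 1" "\<And>s. s \<in> mp.span C \<Longrightarrow> \<phi> s = 0" by metis
    obtain f where f: "homog D f" "\<And>G. homog D G \<Longrightarrow> pairing f G = \<phi> G"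
      using functional_eq_pairing[OF \<phi>(1,2)] by metis
    have hB: "homog D c" if "c \<in> B" for c using that B(1) homS by auto
    have "pairing f c = 0" if "c \<in> C" for c
      using f(2)[OF hB] that insert.prems \<phi>(4) mp.span_base[OF that] by auto
    moreover have "pairing f b = 1" using f(2)[OF hB] insert.prems \<phi>(3) by auto
    ultimately have "f \<in> K C" "f \<notin> K (insert b C)" using f(1) by (auto simp: K_def)
    then have "mp.dim (K (insert b C)) + 1 \<le> mp.dim (K C)"
      by (intro dim_psubset_plus_1[OF Ksp _ Ksub]) (auto simp: K_def)
    then show ?case using insert by simp
  qed
  have "graded_part D J \<subseteq> K B"
  proof
    fix f assume f: "f \<in> graded_part D J"
    have "pairing f b = 0" if "b \<in> B" for b
    proof -
      obtain x where x: "x \<in> V" "b = linform x ^ D" using \<open>b \<in> B\<close> B(1) by (auto simp: S_def)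
      then show ?thesis using pairing_linform_power[of D f x] f by (auto simp: V_def mem_graded_part)
    qed
    then show "f \<in> K B" using f by (auto simp: K_def mem_graded_part)
  qed
  then have "mp.dim (graded_part D J) \<le> mp.dim (K B)" by (rule dim_le_Tdeg[OF _ Ksub])
  then have cardB: "card B \<le> HF J D" using Kdim[OF subset_refl] HF_plus_dim[of J D] by simp
  have "F \<in> mp.span B" using FS mp.span_mono[OF B(3)] unfolding mp.span_span by (rule rev_subsetD)
  then obtain u where u: "F = (\<Sum>b\<in>B. smult_mp (u b) b)" using mp.span_finite[OF finB] by auto
  \<comment> \<open>A D-th root of the coefficient is absorbed into the linear form; here k
    algebraically closed and D > 0 enter.\<close>
  have "\<exists>l. homog 1 l \<and> smult_mp (u b) b = l ^ D" if "b \<in> B" for b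
  proof -
    obtain x where x: "b = linform x ^ D" using subsetD[OF B(1) \<open>b \<in> B\<close>] by (auto simp: S_def)
    obtain c where "c ^ D = u b" using alg_closed_root[OF ac F(2)] by blast
    then have "smult_mp (u b) b = (cst c * linform x) ^ D"
      by (simp add: x smult_mp_conv power_mult_distrib cst_power[symmetric])
    then show ?thesis using homog_cst_mult[OF homog_linform] by blast
  qed
  then obtain M where M: "\<And>b. b \<in> B \<Longrightarrow> homog 1 (M b) \<and> smult_mp (u b) b = M b ^ D" by metis
  obtain \<beta> where \<beta>: "bij_betw \<beta> {..<card B} B" using ex_bij_betw_nat_finite[OF finB] by (auto simp: lessThan_atLeast0)
  show thesis
  proof (rule that[OF cardB])
    show "homog 1 (M (\<beta> j))" if "j < card B" for j using M \<beta> that by (auto simp: bij_betw_def)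
    have "F = (\<Sum>b\<in>B. M b ^ D)" unfolding u using M by (intro sum.cong) auto
    also have "\<dots> = (\<Sum>j<card B. M (\<beta> j) ^ D)" by (rule sum.reindex_bij_betw[OF \<beta>, symmetric])
    finally show "F = (\<Sum>j<card B. M (\<beta> j) ^ D)" .
  qed
qed

section \<open>Algebraic dependence by counting monomials\<close>

text \<open>Bounding each exponent instead of the total degree gives exactly (B+1)^(card Z)
  monomials, a count that is easy to compare for different Z and B.\<close>

definition box :: "nat set \<Rightarrow> nat \<Rightarrow> (nat \<Rightarrow>\<^sub>0 nat) set" where
  "box Z B = {m. keys m \<subseteq> Z \<and> (\<forall>z. lkp m z \<le> B)}"

lemma box_bij:
  assumes "finite Z"
  shows "bij_betw (\<lambda>m. restrict (lkp m) Z) (box Z B) (Z \<rightarrow>\<^sub>E {..B})"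
proof (rule bij_betwI[where g = "\<lambda>f. Abs_poly_mapping (\<lambda>z. if z \<in> Z then f z else 0)"])
  have lk: "lkp (Abs_poly_mapping (\<lambda>z. if z \<in> Z then f z else 0)) = (\<lambda>z. if z \<in> Z then f z else 0)" for f :: "nat \<Rightarrow> nat"
    by (rule lookup_Abs_poly_mapping) (rule finite_subset[OF _ assms], auto)
  show "(\<lambda>m. restrict (lkp m) Z) \<in> box Z B \<rightarrow> (Z \<rightarrow>\<^sub>E {..B})" by (auto simp: box_def)
  show "(\<lambda>f. Abs_poly_mapping (\<lambda>z. if z \<in> Z then f z else 0)) \<in> (Z \<rightarrow>\<^sub>E {..B}) \<rightarrow> box Z B"
  proof (rule funcsetI)
    fix f assume f: "f \<in> Z \<rightarrow>\<^sub>E {..B}"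
    have "f z \<le> B" if "z \<in> Z" for z using PiE_mem[OF f that] by simp
    then show "Abs_poly_mapping (\<lambda>z. if z \<in> Z then f z else 0) \<in> box Z B"
      unfolding box_def by (simp add: lk subset_iff in_keys_iff)
  qed
  show "Abs_poly_mapping (\<lambda>z. if z \<in> Z then restrict (lkp m) Z z else 0) = m" if "m \<in> box Z B" for m
    using that by (intro poly_mapping_eqI) (auto simp: lk box_def in_keys_iff)
  show "restrict (lkp (Abs_poly_mapping (\<lambda>z. if z \<in> Z then f z else 0))) Z = f" if "f \<in> Z \<rightarrow>\<^sub>E {..B}" for f
  proof
    fix z show "restrict (lkp (Abs_poly_mapping (\<lambda>z. if z \<in> Z then f z else 0))) Z z = f z"
      using PiE_arb[OF that, of z] by (cases "z \<in> Z") (simp_all add: lk)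
  qed
qed

lemma card_box: "finite Z \<Longrightarrow> card (box Z B) = (B + 1) ^ card Z"
  using bij_betw_same_card[OF box_bij, of Z B] by (simp add: card_PiE)

lemma finite_box: "finite Z \<Longrightarrow> finite (box Z B)"
  using bij_betw_finite[OF box_bij, of Z B] by (simp add: finite_PiE)

definition bounded :: "nat set \<Rightarrow> nat \<Rightarrow> (nat, 'k::field) mpoly \<Rightarrow> bool" where
  "bounded Z B p \<longleftrightarrow> keys p \<subseteq> box Z B"

definition vars_in :: "'w set \<Rightarrow> ('w, 'k::field) mpoly \<Rightarrow> bool" where
  "vars_in Z p \<longleftrightarrow> (\<forall>m\<in>keys p. keys m \<subseteq> Z)"

lemma vars_in_add: "vars_in Z p \<Longrightarrow> vars_in Z q \<Longrightarrow> vars_in Z (p + q)"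
  unfolding vars_in_def using keys_add[of p q] by blast

lemma vars_in_uminus: "vars_in Z p \<Longrightarrow> vars_in Z (- p)"
  unfolding vars_in_def by (simp add: in_keys_iff)

lemma vars_in_diff: "vars_in Z p \<Longrightarrow> vars_in Z q \<Longrightarrow> vars_in Z (p - q)"
  using vars_in_add[of Z p "- q"] vars_in_uminus[of Z q] by simp

lemma vars_in_mult: "vars_in Z p \<Longrightarrow> vars_in Z q \<Longrightarrow> vars_in Z (p * q)"
proof -
  assume p: "vars_in Z p" and q: "vars_in Z q"
  have "keys (a + b) \<subseteq> Z" if "a \<in> keys p" "b \<in> keys q" for a b
    using p q that keys_add[of a b] unfolding vars_in_def by blast
  then show ?thesis using keys_mult[of p q] unfolding vars_in_def by blast
qed

lemma vars_in_0: "vars_in Z 0" and vars_in_1: "vars_in Z 1" and vars_in_cst: "vars_in Z (cst c)"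
  and vars_in_mvar: "v \<in> Z \<Longrightarrow> vars_in Z (mvar v)"
  by (auto simp: vars_in_def cst_def mvar_def)

lemma vars_in_power: "vars_in Z p \<Longrightarrow> vars_in Z (p ^ k)"
  by (induction k) (auto intro: vars_in_1 vars_in_mult)

lemma vars_in_sum: "(\<And>x. x \<in> A \<Longrightarrow> vars_in Z (h x)) \<Longrightarrow> vars_in Z (sum h A)"
  by (induction A rule: infinite_finite_induct) (auto intro: vars_in_0 vars_in_add)

lemma vars_in_prod: "(\<And>x. x \<in> A \<Longrightarrow> vars_in Z (h x)) \<Longrightarrow> vars_in Z (prod h A)"
  by (induction A rule: infinite_finite_induct) (auto intro: vars_in_1 vars_in_mult)

lemma vars_in_msubst: "(\<And>w. vars_in Z (\<phi> w)) \<Longrightarrow> vars_in Z (msubst \<phi> p)"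
  unfolding mp_hom_def mono_val_def
  by (intro vars_in_sum vars_in_mult vars_in_cst vars_in_prod vars_in_power)

lemma box_add: "m \<in> box Z B \<Longrightarrow> m' \<in> box Z B' \<Longrightarrow> m + m' \<in> box Z (B + B')"
  using keys_add[of m m'] by (auto simp: box_def lookup_add add_mono)

lemma bounded_mono: "bounded Z B p \<Longrightarrow> B \<le> B' \<Longrightarrow> bounded Z B' p"
  unfolding bounded_def box_def using order_trans by blast

lemma bounded_mult: "bounded Z B p \<Longrightarrow> bounded Z B' q \<Longrightarrow> bounded Z (B + B') (p * q)"
proof -
  assume p: "bounded Z B p" and q: "bounded Z B' q"
  have "a + b \<in> box Z (B + B')" if "a \<in> keys p" "b \<in> keys q" for a b
    using p q that unfolding bounded_def by (intro box_add) auto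
  then show ?thesis using keys_mult[of p q] unfolding bounded_def by blast
qed

lemma bounded_1: "bounded Z B 1"
  by (simp add: bounded_def box_def)

lemma bounded_power: "bounded Z B p \<Longrightarrow> bounded Z (k * B) (p ^ k)"
  by (induction k) (auto intro: bounded_1 bounded_mult)

lemma bounded_prod: "finite A \<Longrightarrow> (\<And>x. x \<in> A \<Longrightarrow> bounded Z B (h x)) \<Longrightarrow> bounded Z (card A * B) (prod h A)"
  by (induction A rule: finite_induct) (auto intro: bounded_1 bounded_mult)

lemma vars_in_bounded:
  assumes "vars_in Z p" shows "\<exists>B. bounded Z B p"
proof -
  define B where "B = Max (insert 0 ((\<lambda>(m, z). lkp m z) ` (SIGMA m:keys p. keys m)))"
  have fin: "finite (SIGMA m:keys p. keys m)" by (intro finite_SigmaI) auto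
  have "lkp m z \<le> B" if "m \<in> keys p" for m z
  proof (cases "z \<in> keys m")
    case True
    then have "lkp m z \<in> (\<lambda>(m, z). lkp m z) ` (SIGMA m:keys p. keys m)" using that by force
    then show ?thesis unfolding B_def using fin by (intro Max_ge) auto
  qed (simp add: in_keys_iff)
  then have "bounded Z B p" using assms by (auto simp: bounded_def box_def vars_in_def)
  then show ?thesis ..
qed

text \<open>There are more polynomials than monomials available to them. The relation is indexed by
  I because members of the family may coincide.\<close>

lemma bounded_dependent:
  fixes w :: "'i \<Rightarrow> (nat, 'k::field) mpoly"
  assumes "finite I" "finite Z" "\<And>i. i \<in> I \<Longrightarrow> bounded Z B (w i)" "card I > (B + 1) ^ card Z"
  obtains a where "\<exists>i\<in>I. a i \<noteq> 0" "(\<Sum>i\<in>I. cst (a i) * w i) = 0"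
proof (cases "inj_on w I")
  case False
  then obtain i j where ij: "i \<in> I" "j \<in> I" "i \<noteq> j" "w i = w j" by (auto simp: inj_on_def)
  define a where "a l = (if l = i then 1 else if l = j then - 1 else (0::'k))" for l
  have "(\<Sum>l\<in>I. cst (a l) * w l) = (\<Sum>l\<in>{i, j}. cst (a l) * w l)"
    using assms(1) ij by (intro sum.mono_neutral_right) (auto simp: a_def)
  also have "\<dots> = 0" using ij by (simp add: a_def cst_uminus)
  finally have "(\<Sum>l\<in>I. cst (a l) * w l) = 0" .
  moreover have "\<exists>l\<in>I. a l \<noteq> 0" using ij(1) by (intro bexI[of _ i]) (simp_all add: a_def)
  ultimately show thesis using that by blast
next
  case True
  define S where "S = (\<lambda>m. Poly_Mapping.single m (1::'k)) ` box Z B"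
  have "w ` I \<subseteq> mp.span S"
  proof safe
    fix i assume "i \<in> I"
    then have k: "keys (w i) \<subseteq> box Z B" using assms(3) by (simp add: bounded_def)
    have "(\<Sum>m\<in>keys (w i). smult_mp (lkp (w i) m) (Poly_Mapping.single m 1)) \<in> mp.span S"
      using k by (intro mp.span_sum mp.span_scale mp.span_base) (auto simp: S_def)
    also have "(\<Sum>m\<in>keys (w i). smult_mp (lkp (w i) m) (Poly_Mapping.single m 1)) = w i"
      by (simp add: smult_mp_conv cst_def mult_single poly_mapping_sum_singles[OF finite_keys subset_refl, symmetric])
    finally show "w i \<in> mp.span S" .
  qed
  moreover have finS: "finite S" "card S \<le> (B + 1) ^ card Z"
    using card_image_le[OF finite_box[OF assms(2)], of "\<lambda>m. Poly_Mapping.single m (1::'k)" B] card_box[OF assms(2), of B]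
    by (simp_all add: S_def finite_box[OF assms(2)])
  ultimately have "mp.dependent (w ` I)"
    using mp.independent_span_bound[of S "w ` I"] assms(4) card_image[OF True] by linarith
  then obtain u where u: "\<exists>x\<in>w ` I. u x \<noteq> 0" "(\<Sum>x\<in>w ` I. smult_mp (u x) x) = 0"
    using mp.dependent_finite[of "w ` I"] assms(1) by auto
  show thesis
  proof (rule that[of "\<lambda>i. u (w i)"])
    show "\<exists>i\<in>I. u (w i) \<noteq> 0" using u(1) by auto
    show "(\<Sum>i\<in>I. cst (u (w i)) * w i) = 0"
      using u(2) unfolding sum.reindex[OF True] by (simp add: smult_mp_conv)
  qed
qed

text \<open>The value of p at the fractions f_j / b_j, cleared of denominators by the M-th power of
  the product of the b_j. The exponent M - m_j does not truncate when p is
  \<open>bounded Y M\<close>.\<close>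

definition hev :: "nat set \<Rightarrow> (nat \<Rightarrow> (nat, 'k::field) mpoly) \<Rightarrow> (nat \<Rightarrow> (nat, 'k) mpoly) \<Rightarrow> nat
    \<Rightarrow> (nat, 'k) mpoly \<Rightarrow> (nat, 'k) mpoly" where
  "hev Y f b M p = (\<Sum>m\<in>keys p. cst (lkp p m) * (\<Prod>j\<in>Y. f j ^ lkp m j * b j ^ (M - lkp m j)))"

text \<open>A relation of degree n for \<phi> over the fractions f_j / b_j. Its leading coefficient
  is nonzero as a formal polynomial but may vanish at the fractions; in that case it is by itself a
  relation with n = 0.\<close>

definition alg_rel :: "nat set \<Rightarrow> (nat \<Rightarrow> (nat, 'k::field) mpoly) \<Rightarrow> (nat \<Rightarrow> (nat, 'k) mpoly)
    \<Rightarrow> (nat, 'k) mpoly \<Rightarrow> nat \<Rightarrow> nat \<Rightarrow> (nat \<Rightarrow> (nat, 'k) mpoly) \<Rightarrow> bool" where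
  "alg_rel Y f b \<phi> n M Q \<longleftrightarrow> (\<forall>s. bounded Y M (Q s)) \<and> Q n \<noteq> 0 \<and> (\<Sum>s\<le>n. \<phi> ^ s * hev Y f b M (Q s)) = 0"

text \<open>The products \<phi>^s f^m b^(M-m) with s and all m_j at most M are (M+1)^(card Y + 1) in
  number, while their exponents are at most K M in card Z variables; for large M they are linearly
  dependent.\<close>

lemma alg_rel_exists:
  assumes fin: "finite Y" "finite Z" and card: "card Z \<le> card Y"
    and vars: "vars_in Z \<phi>" "\<And>j. j \<in> Y \<Longrightarrow> vars_in Z (f j)" "\<And>j. j \<in> Y \<Longrightarrow> vars_in Z (b j)"
  shows "\<exists>n M Q. alg_rel Y f b \<phi> n M Q"
proof -
  obtain C0 where C0: "bounded Z C0 \<phi>" using vars_in_bounded[OF vars(1)] by blast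
  obtain C1 where C1: "\<And>j. j \<in> Y \<Longrightarrow> bounded Z (C1 j) (f j)" using vars_in_bounded[OF vars(2)] by metis
  obtain C2 where C2: "\<And>j. j \<in> Y \<Longrightarrow> bounded Z (C2 j) (b j)" using vars_in_bounded[OF vars(3)] by metis
  define C where "C = Max (insert C0 (C1 ` Y \<union> C2 ` Y))"
  have C_ge: "c \<le> C" if "c \<in> insert C0 (C1 ` Y \<union> C2 ` Y)" for c
    unfolding C_def using that fin by (intro Max_ge) auto
  have C: "bounded Z C \<phi>" "\<And>j. j \<in> Y \<Longrightarrow> bounded Z C (f j)" "\<And>j. j \<in> Y \<Longrightarrow> bounded Z C (b j)"
    using C_ge by (auto intro: bounded_mono[OF C0] bounded_mono[OF C1] bounded_mono[OF C2])
  \<comment> \<open>\<open>C\<close> bounds the exponents in \<phi>, f_j and b_j. A product has at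
    most M factors \<phi> and, for each j, exactly M factors f_j or b_j; hence the bound K
    M.\<close>
  define K where "K = C * (1 + card Y)"
  \<comment> \<open>With this choice ((K+1) (M+1))^(card Z) equals M (M+1)^(card Z), which is below
    the number (M+1) (M+1)^(card Y) of products.\<close>
  define M where "M = (K + 1) ^ card Z"
  define w where "w = (\<lambda>(s, m). \<phi> ^ s * (\<Prod>j\<in>Y. f j ^ lkp m j * b j ^ (M - lkp m j)))"
  have bw: "bounded Z (K * M) (w i)" if "i \<in> {..M} \<times> box Y M" for i
  proof -
    obtain s m where i: "i = (s, m)" "s \<le> M" "m \<in> box Y M" using \<open>i \<in> {..M} \<times> box Y M\<close> by auto
    have "bounded Z (M * C) (f j ^ lkp m j * b j ^ (M - lkp m j))" if "j \<in> Y" for j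
    proof -
      have "bounded Z (lkp m j * C + (M - lkp m j) * C) (f j ^ lkp m j * b j ^ (M - lkp m j))"
        using that C by (intro bounded_mult bounded_power)
      moreover have "lkp m j * C + (M - lkp m j) * C = M * C"
        using i by (auto simp: box_def add_mult_distrib[symmetric])
      ultimately show ?thesis by simp
    qed
    then have "bounded Z (s * C + card Y * (M * C)) (w i)"
      unfolding i(1) w_def prod.case using fin C(1) by (intro bounded_mult bounded_power bounded_prod)
    moreover have "s * C + card Y * (M * C) \<le> K * M" using i(2) by (simp add: K_def algebra_simps)
    ultimately show ?thesis by (rule bounded_mono)
  qed
  have "(K * M + 1) ^ card Z \<le> ((K + 1) * (M + 1)) ^ card Z" by (intro power_mono) auto
  also have "\<dots> = M * (M + 1) ^ card Z" by (simp only: power_mult_distrib M_def)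
  also have "\<dots> < (M + 1) * (M + 1) ^ card Z" by simp
  also have "\<dots> \<le> (M + 1) * (M + 1) ^ card Y" using card by (intro mult_left_mono power_increasing) auto
  also have "\<dots> = card ({..M} \<times> box Y M)" using fin by (simp add: card_cartesian_product card_box)
  finally have cd: "(K * M + 1) ^ card Z < card ({..M} \<times> box Y M)" .
  have finI: "finite ({..M} \<times> box Y M)" using finite_box[OF fin(1), of M] by simp
  obtain a where a: "\<exists>i\<in>{..M} \<times> box Y M. a i \<noteq> 0" "(\<Sum>i\<in>{..M} \<times> box Y M. cst (a i) * w i) = 0"
    by (rule bounded_dependent[OF finI fin(2) _ cd, of w]) (rule bw)
  define Q where "Q s = (if s \<le> M then \<Sum>m\<in>box Y M. Poly_Mapping.single m (a (s, m)) else 0)" for s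
  have lQ: "lkp (Q s) m = (if s \<le> M \<and> m \<in> box Y M then a (s, m) else 0)" for s m
  proof -
    have "lkp (\<Sum>m\<in>box Y M. Poly_Mapping.single m (a (s, m))) m = (\<Sum>m'\<in>box Y M. if m = m' then a (s, m') else 0)"
      unfolding lookup_sum by (intro sum.cong) (auto simp: lookup_single when_def)
    then show ?thesis by (simp add: Q_def sum.delta'[OF finite_box[OF fin(1)]])
  qed
  have bQ: "bounded Y M (Q s)" for s by (auto simp: bounded_def in_keys_iff lQ split: if_splits)
  have hevQ: "\<phi> ^ s * hev Y f b M (Q s) = (\<Sum>m\<in>box Y M. cst (a (s, m)) * w (s, m))" if "s \<le> M" for s
  proof -
    have "hev Y f b M (Q s) = (\<Sum>m\<in>box Y M. cst (lkp (Q s) m) * (\<Prod>j\<in>Y. f j ^ lkp m j * b j ^ (M - lkp m j)))"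
      unfolding hev_def using bQ[of s] finite_box[OF fin(1)]
      by (intro sum.mono_neutral_left) (auto simp: bounded_def in_keys_iff)
    then show ?thesis using that by (simp add: lQ w_def sum_distrib_left mult_ac)
  qed
  have zero: "(\<Sum>s\<le>M. \<phi> ^ s * hev Y f b M (Q s)) = 0"
    using a(2) by (simp add: hevQ sum.cartesian_product case_prod_unfold)
  \<comment> \<open>Cutting off after the last nonzero coefficient provides the nonzero leading
    coefficient that \<open>alg_rel\<close> demands.\<close>
  define n where "n = Max {s. s \<le> M \<and> Q s \<noteq> 0}"
  have "\<exists>s\<le>M. Q s \<noteq> 0"
  proof -
    obtain s m where "s \<le> M" "m \<in> box Y M" "a (s, m) \<noteq> 0" using a(1) by auto
    then show ?thesis using lQ[of s m] by (intro exI[of _ s]) auto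
  qed
  then have n: "n \<le> M" "Q n \<noteq> 0" using Max_in[of "{s. s \<le> M \<and> Q s \<noteq> 0}"] by (auto simp: n_def)
  have n_max: "s \<le> n" if "s \<le> M" "Q s \<noteq> 0" for s unfolding n_def using that by (intro Max_ge) auto
  have "(\<Sum>s\<le>n. \<phi> ^ s * hev Y f b M (Q s)) = (\<Sum>s\<le>M. \<phi> ^ s * hev Y f b M (Q s))"
  proof (rule sum.mono_neutral_left)
    have "Q i = 0" if "i \<le> M" "\<not> i \<le> n" for i using n_max that by blast
    then show "\<forall>i\<in>{..M} - {..n}. \<phi> ^ i * hev Y f b M (Q i) = 0" by (simp add: hev_def)
  qed (use n in auto)
  then have "alg_rel Y f b \<phi> n M Q" unfolding alg_rel_def using bQ n(2) zero by simp
  then show ?thesis by blast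
qed

section \<open>Generic separability\<close>

definition peval :: "'k::field poly \<Rightarrow> ('v, 'k) mpoly \<Rightarrow> ('v, 'k) mpoly" where
  "peval p z = poly (map_poly cst p) z"

lemma peval_0 [simp]: "peval 0 z = 0"
  by (simp add: peval_def)

lemma peval_pCons: "peval (pCons c p) z = cst c + z * peval p z"
  by (simp add: peval_def map_poly_pCons)

lemma peval_add: "peval (p + q) z = peval p z + peval q z"
proof (induction p arbitrary: q)
  case (pCons c p)
  show ?case
  proof (cases q)
    case (pCons c' q')
    then show ?thesis using pCons.IH[of q'] by (simp add: peval_pCons cst_add algebra_simps)
  qed
qed simp

lemma peval_smult: "peval (smult c p) z = cst c * peval p z"
  by (induction p) (auto simp: peval_pCons cst_mult algebra_simps)

lemma peval_linear_mult: "peval ([:- c, 1:] * p) z = (z - cst c) * peval p z"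
proof -
  have "[:- c, 1:] * p = smult (- c) p + pCons 0 p" by simp
  then show ?thesis by (simp only: peval_add peval_smult peval_pCons cst_uminus cst_0) (simp add: algebra_simps)
qed

lemma peval_monom: "peval (monom c n) z = cst c * z ^ n"
  by (induction n) (auto simp: monom_0 monom_Suc peval_pCons mult_ac)

lemma peval_sum: "peval (sum f A) z = (\<Sum>x\<in>A. peval (f x) z)"
  by (induction A rule: infinite_finite_induct) (auto simp: peval_add)

lemma pderiv_sum: "pderiv (sum f A) = (\<Sum>x\<in>A. pderiv (f x))"
  by (induction A rule: infinite_finite_induct) (auto simp: pderiv_add)

text \<open>If \<open>p'(z)\<close> divides a power of \<open>\<beta>\<close> modulo \<open>I\<close>, then multiple roots of \<open>p\<close> are irrelevant
  after inverting \<open>\<beta>\<close>.\<close>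

lemma separable_relation:
  fixes I :: "('v, 'k::field) mpoly set"
  assumes ac: "alg_closed_field TYPE('k)"
    and I: "is_ideal I" and "\<beta> ^ M * peval p z \<in> I" "\<beta> ^ M - s * peval (pderiv p) z \<in> I"
  shows "\<exists>N \<Lambda>. finite \<Lambda> \<and> (p \<noteq> 0 \<longrightarrow> (\<forall>c\<in>\<Lambda>. poly p c = 0)) \<and> \<beta> ^ N * (\<Prod>c\<in>\<Lambda>. z - cst c) \<in> I"
  using assms(2-)
proof (induction "degree p" arbitrary: p I M s)
  case 0
  then obtain a where "p = [:a:]" using degree_eq_zeroE by metis
  then have "pderiv p = 0" by (simp add: pderiv_pCons)
  then have "\<beta> ^ M \<in> I" using 0 by simp
  then show ?case by (intro exI[of _ M] exI[of _ "{}"]) simp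
next
  case (Suc n)
  then obtain c where c: "poly p c = 0" using ac unfolding alg_closed_field_def by (metis zero_less_Suc)
  then obtain p1 where p: "p = [:- c, 1:] * p1" by (auto simp: poly_eq_0_iff_dvd)
  have p0: "p1 \<noteq> 0" "p \<noteq> 0" using Suc.hyps(2) p by auto
  have deg: "n = degree p1" using Suc.hyps(2) p0 unfolding p by (subst (asm) degree_mult_eq) auto
  have dp: "peval (pderiv p) z = peval p1 z + (z - cst c) * peval (pderiv p1) z"
  proof -
    have "pderiv [:- c, 1:] = [:1:]" by (simp add: pderiv_pCons)
    then have "pderiv p = [:- c, 1:] * pderiv p1 + p1" unfolding p by (simp only: pderiv_mult) simp
    then show ?thesis by (simp only: peval_add peval_linear_mult add.commute)
  qed
  \<comment> \<open>After the root c is split off, the quotient p1 is handled modulo (I : z -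
    c).\<close>
  define I1 where "I1 = {h. h * (z - cst c) \<in> I}"
  have I1: "is_ideal I1"
    by (rule is_idealI)
      (auto simp: I1_def ideal_0[OF Suc.prems(1)] distrib_right mult.assoc
        intro: ideal_add[OF Suc.prems(1)] ideal_mult_left[OF Suc.prems(1)])
  have II1: "h \<in> I1" if "h \<in> I" for h using ideal_mult_right[OF Suc.prems(1) that] by (simp add: I1_def)
  have "\<beta> ^ M * peval p1 z \<in> I1"
    using Suc.prems(2) unfolding p peval_linear_mult I1_def by (simp add: mult_ac)
  note b1 = this
  then have a1: "\<beta> ^ (M + M) * peval p1 z \<in> I1"
    using ideal_mult_left[OF I1, of "\<beta> ^ M * peval p1 z" "\<beta> ^ M"] by (simp add: power_add mult.assoc)
  \<comment> \<open>Since p'(z) = p1(z) + (z - c) p1'(z) and \<beta>^M p1(z) lies in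
    \<open>I1\<close>, one more factor \<beta>^M removes the first summand; it doubles the
    exponent.\<close>
  have "\<beta> ^ M * (\<beta> ^ M - s * peval (pderiv p) z) + s * (\<beta> ^ M * peval p1 z) \<in> I1"
    by (rule ideal_add[OF I1 ideal_mult_left[OF I1 II1[OF Suc.prems(3)]] ideal_mult_left[OF I1 b1]])
  then have a2: "\<beta> ^ (M + M) - (s * \<beta> ^ M * (z - cst c)) * peval (pderiv p1) z \<in> I1"
    unfolding dp by (simp add: algebra_simps power_add)
  obtain N \<Lambda> where \<Lambda>: "finite \<Lambda>" "\<And>x. x \<in> \<Lambda> \<Longrightarrow> poly p1 x = 0" "\<beta> ^ N * (\<Prod>x\<in>\<Lambda>. z - cst x) \<in> I1"
    using Suc.hyps(1)[OF deg I1 a1 a2] p0 by blast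
  have roots: "poly p x = 0" if "x \<in> \<Lambda>" for x using \<Lambda>(2)[OF that] by (simp add: p)
  show ?case
  proof (cases "poly p1 c = 0")
    case False
    then have "c \<notin> \<Lambda>" using \<Lambda>(2) by blast
    then have "\<beta> ^ N * (\<Prod>x\<in>insert c \<Lambda>. z - cst x) \<in> I"
      using \<Lambda>(1,3) by (simp add: I1_def mult_ac)
    then show ?thesis using \<Lambda>(1) c roots by (intro exI[of _ N] exI[of _ "insert c \<Lambda>"]) auto
  next
    case True
    \<comment> \<open>Now c is a multiple root, so z - c divides p'(z). As P (z - c) lies in I up to
      a power of \<beta>, so does P, and no further factor z - c is required.\<close>
    then obtain p2 where p2: "p1 = [:- c, 1:] * p2" by (auto simp: poly_eq_0_iff_dvd)
    define t where "t = peval p2 z + peval (pderiv p1) z"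
    define P where "P = (\<Prod>x\<in>\<Lambda>. z - cst x)"
    have dp2: "peval (pderiv p) z = (z - cst c) * t"
      unfolding dp t_def by (subst (1) p2) (simp only: peval_linear_mult distrib_left)
    have PI: "\<beta> ^ N * P * (z - cst c) \<in> I" using \<Lambda>(3) by (simp add: I1_def P_def)
    have "\<beta> ^ N * P * (\<beta> ^ M - s * peval (pderiv p) z) + s * t * (\<beta> ^ N * P * (z - cst c)) \<in> I"
      by (intro ideal_add[OF Suc.prems(1)] ideal_mult_left[OF Suc.prems(1)] Suc.prems(3) PI)
    also have "\<beta> ^ N * P * (\<beta> ^ M - s * peval (pderiv p) z) + s * t * (\<beta> ^ N * P * (z - cst c)) = \<beta> ^ (N + M) * P"
      unfolding dp2 by (simp add: algebra_simps power_add)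
    finally have "\<beta> ^ (N + M) * (\<Prod>x\<in>\<Lambda>. z - cst x) \<in> I" by (simp add: P_def)
    then show ?thesis using \<Lambda>(1) roots by blast
  qed
qed

text \<open>Modulo I each specialised fraction f_j / b_j becomes the constant y_j, expressed without
  denominators; what remains is the power of the product of the specialised b_j.\<close>

lemma hev_specialize:
  fixes \<theta> :: "nat \<Rightarrow> ('v, 'k::field) mpoly"
  assumes I: "is_ideal I" and Y: "finite Y" and p: "bounded Y M p"
    and "\<forall>j\<in>Y. icong I (msubst \<theta> (f j)) (cst (y j) * msubst \<theta> (b j))"
  shows "icong I (msubst \<theta> (hev Y f b M p)) (cst (mp_eval p y) * (\<Prod>j\<in>Y. msubst \<theta> (b j)) ^ M)"
proof -
  have y: "icong I (msubst \<theta> (f j)) (cst (y j) * msubst \<theta> (b j))" if "j \<in> Y" for j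
    using assms(4) that by blast
  have "icong I (\<Sum>m\<in>keys p. cst (lkp p m) * (\<Prod>j\<in>Y. msubst \<theta> (f j) ^ lkp m j * msubst \<theta> (b j) ^ (M - lkp m j)))
      (\<Sum>m\<in>keys p. cst (lkp p m) * (\<Prod>j\<in>Y. (cst (y j) * msubst \<theta> (b j)) ^ lkp m j * msubst \<theta> (b j) ^ (M - lkp m j)))"
    by (intro icong_sum[OF I] icong_mult[OF I] icong_prod[OF I] icong_power[OF I] icong_refl[OF I] y)
  also have "(\<Sum>m\<in>keys p. cst (lkp p m) * (\<Prod>j\<in>Y. msubst \<theta> (f j) ^ lkp m j * msubst \<theta> (b j) ^ (M - lkp m j)))
      = msubst \<theta> (hev Y f b M p)"
    by (simp add: hev_def cst.mp_hom_sum cst.mp_hom_mult cst.mp_hom_prod cst.mp_hom_power)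
  also have "(\<Sum>m\<in>keys p. cst (lkp p m) * (\<Prod>j\<in>Y. (cst (y j) * msubst \<theta> (b j)) ^ lkp m j * msubst \<theta> (b j) ^ (M - lkp m j)))
      = (\<Sum>m\<in>keys p. cst (lkp p m * mono_val y m) * (\<Prod>j\<in>Y. msubst \<theta> (b j)) ^ M)"
  proof (rule sum.cong[OF refl])
    fix m assume "m \<in> keys p"
    then have m: "keys m \<subseteq> Y" "\<And>j. lkp m j \<le> M" using p by (auto simp: bounded_def box_def)
    have "(cst (y j) * msubst \<theta> (b j)) ^ lkp m j * msubst \<theta> (b j) ^ (M - lkp m j)
        = cst (y j ^ lkp m j) * msubst \<theta> (b j) ^ M" for j
      using m(2)[of j] by (simp add: power_mult_distrib cst_power mult.assoc power_add[symmetric])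
    then have "(\<Prod>j\<in>Y. (cst (y j) * msubst \<theta> (b j)) ^ lkp m j * msubst \<theta> (b j) ^ (M - lkp m j))
        = cst (mono_val y m) * (\<Prod>j\<in>Y. msubst \<theta> (b j)) ^ M"
      by (simp add: prod.distrib prod_power_distrib cst_prod mono_val_superset[OF Y m(1)])
    then show "cst (lkp p m) * (\<Prod>j\<in>Y. (cst (y j) * msubst \<theta> (b j)) ^ lkp m j * msubst \<theta> (b j) ^ (M - lkp m j))
        = cst (lkp p m * mono_val y m) * (\<Prod>j\<in>Y. msubst \<theta> (b j)) ^ M"
      by (simp add: cst_mult mult.assoc)
  qed
  also have "\<dots> = cst (mp_eval p y) * (\<Prod>j\<in>Y. msubst \<theta> (b j)) ^ M"
    by (simp add: mp_eval_eq mp_hom_def cst_sum sum_distrib_right)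
  finally show ?thesis .
qed

lemma vars_in_hev:
  assumes "\<And>j. j \<in> Y \<Longrightarrow> vars_in Z (f j)" "\<And>j. j \<in> Y \<Longrightarrow> vars_in Z (b j)"
  shows "vars_in Z (hev Y f b M p)"
  unfolding hev_def by (intro vars_in_sum vars_in_mult vars_in_cst vars_in_prod vars_in_power assms)

text \<open>A relation of minimal degree has a nonvanishing derivative in characteristic zero, and a relation
  for that derivative gives the polynomial \<open>\<nu>\<close> outside of whose zero set the derivative is invertible.\<close>

lemma generic_separability:
  fixes \<phi> :: "(nat, 'k::field_char_0) mpoly"
  assumes ac: "alg_closed_field TYPE('k)"
    and fin: "finite Y" "finite Z" and card: "card Z \<le> card Y"
    and vars: "vars_in Z \<phi>" "\<And>j. j \<in> Y \<Longrightarrow> vars_in Z (f j)" "\<And>j. j \<in> Y \<Longrightarrow> vars_in Z (b j)"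
  obtains \<nu> :: "(nat, 'k) mpoly" where "\<nu> \<noteq> 0"
    "\<And>\<theta> (I :: ('v, 'k) mpoly set) y. is_ideal I \<Longrightarrow>
      (\<forall>j\<in>Y. icong I (msubst \<theta> (f j)) (cst (y j) * msubst \<theta> (b j))) \<Longrightarrow> mp_eval \<nu> y \<noteq> 0 \<Longrightarrow>
      \<exists>N \<Lambda>. finite \<Lambda> \<and> (\<Prod>j\<in>Y. msubst \<theta> (b j)) ^ N * (\<Prod>c\<in>\<Lambda>. msubst \<theta> \<phi> - cst c) \<in> I"
proof -
  define n where "n = (LEAST n. \<exists>M Q. alg_rel Y f b \<phi> n M Q)"
  have ex: "\<exists>n M Q. alg_rel Y f b \<phi> n M Q" by (rule alg_rel_exists[OF fin card vars])
  obtain M Q where rel: "alg_rel Y f b \<phi> n M Q" using LeastI_ex[OF ex] unfolding n_def by blast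
  have min: "n \<le> n'" if "alg_rel Y f b \<phi> n' M' Q'" for n' M' Q'
    unfolding n_def using that by (intro Least_le) blast
  have bQ: "bounded Y M (Q s)" and Qn: "Q n \<noteq> 0" and sum0: "(\<Sum>s\<le>n. \<phi> ^ s * hev Y f b M (Q s)) = 0" for s
    using rel by (auto simp: alg_rel_def)
  have inv: "r * cst c \<in> I \<Longrightarrow> c \<noteq> 0 \<Longrightarrow> is_ideal I \<Longrightarrow> r \<in> I" for r c and I :: "('v, 'k) mpoly set"
    using ideal_mult_right[of I "r * cst c" "cst (1 / c)"] by (simp add: mult.assoc cst_mult[symmetric])
  show thesis
  proof (cases n)
    \<comment> \<open>The fractions themselves are dependent. Off the zeros of that dependence a
      power of the denominators lies in I, so the empty set of roots suffices.\<close>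
    case 0
    show thesis
    proof (rule that[of "Q 0"])
      show "Q 0 \<noteq> 0" using Qn 0 by simp
      fix \<theta> and I :: "('v, 'k) mpoly set" and y
      assume I: "is_ideal I" and cong: "\<forall>j\<in>Y. icong I (msubst \<theta> (f j)) (cst (y j) * msubst \<theta> (b j))"
        and nz: "mp_eval (Q 0) y \<noteq> 0"
      have "msubst \<theta> (hev Y f b M (Q 0)) \<in> I" using sum0 0 by (simp add: ideal_0[OF I])
      then have "cst (mp_eval (Q 0) y) * (\<Prod>j\<in>Y. msubst \<theta> (b j)) ^ M \<in> I"
        using icong_mem_iff[OF I hev_specialize[OF I fin(1) bQ cong]] by blast
      then have "(\<Prod>j\<in>Y. msubst \<theta> (b j)) ^ M \<in> I" using inv nz I by (metis mult.commute)
      then show "\<exists>N \<Lambda>. finite \<Lambda> \<and> (\<Prod>j\<in>Y. msubst \<theta> (b j)) ^ N * (\<Prod>c\<in>\<Lambda>. msubst \<theta> \<phi> - cst c) \<in> I"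
        by (intro exI[of _ M] exI[of _ "{}"]) simp
    qed
  next
    case (Suc n')
    \<comment> \<open>Formal derivative of the minimal relation; its top coefficient, n times
      \<open>Q n\<close>, is nonzero in characteristic zero.\<close>
    define Q' where "Q' s = cst (of_nat (Suc s)) * Q (Suc s)" for s
    have bQ': "bounded Y M (Q' s)" for s using bQ[of "Suc s"] by (auto simp: bounded_def Q'_def in_keys_iff)
    define \<Delta> where "\<Delta> = (\<Sum>s\<le>n'. \<phi> ^ s * hev Y f b M (Q' s))"
    have "Q' n' \<noteq> 0"
    proof
      assume *: "Q' n' = 0"
      have "lkp (Q n) m = 0" for m
      proof -
        have "of_nat (Suc n') * lkp (Q n) m = 0" using arg_cong[OF *, of "\<lambda>p. lkp p m"] by (simp add: Q'_def Suc)
        then show ?thesis by (simp only: mult_eq_0_iff of_nat_eq_0_iff) simp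
      qed
      then have "Q n = 0" by (intro poly_mapping_eqI) simp
      then show False using Qn by contradiction
    qed
    \<comment> \<open>Otherwise \<open>Q'\<close> would be a relation of degree n - 1.\<close>
    then have "\<Delta> \<noteq> 0" using min[of n' M Q'] bQ' Suc unfolding alg_rel_def \<Delta>_def by auto
    have "vars_in Z \<Delta>" unfolding \<Delta>_def
      by (intro vars_in_sum vars_in_mult vars_in_power vars vars_in_hev)
    then have "\<exists>k M' R. alg_rel Y f b \<Delta> k M' R"
      by (rule alg_rel_exists[OF fin card]) (use vars in auto)
    then obtain k M' R where rel': "alg_rel Y f b \<Delta> k M' R" by blast
    \<comment> \<open>The lowest nonzero coefficient of the relation for \<Delta>: once \<Delta>^t
      is cancelled, it is a multiple of \<Delta>. Where it does not vanish, \<Delta> is therefore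
      invertible up to denominators.\<close>
    define t where "t = (LEAST t. R t \<noteq> 0)"
    have Rk: "R k \<noteq> 0" and bR: "bounded Y M' (R s)" for s using rel' by (auto simp: alg_rel_def)
    have t: "R t \<noteq> 0" "t \<le> k"
      unfolding t_def using Rk by (rule LeastI[of "\<lambda>t. R t \<noteq> 0" k], rule Least_le[of "\<lambda>t. R t \<noteq> 0" k])
    have R0: "R s = 0" if "s < t" for s
      using not_less_Least[of s "\<lambda>t. R t \<noteq> 0"] that unfolding t_def by simp
    define U where "U = (\<Sum>s\<in>{Suc t..k}. \<Delta> ^ (s - Suc t) * hev Y f b M' (R s))"
    have "0 = (\<Sum>s\<le>k. \<Delta> ^ s * hev Y f b M' (R s))" using rel' by (simp add: alg_rel_def)
    also have "\<dots> = (\<Sum>s\<in>insert t {Suc t..k}. \<Delta> ^ s * hev Y f b M' (R s))"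
    proof (rule sum.mono_neutral_right)
      show "\<forall>i\<in>{..k} - insert t {Suc t..k}. \<Delta> ^ i * hev Y f b M' (R i) = 0"
      proof
        fix i assume "i \<in> {..k} - insert t {Suc t..k}"
        then have "R i = 0" by (intro R0) auto
        then show "\<Delta> ^ i * hev Y f b M' (R i) = 0" by (simp add: hev_def)
      qed
    qed (use t in auto)
    also have "\<dots> = \<Delta> ^ t * hev Y f b M' (R t) + (\<Sum>s\<in>{Suc t..k}. \<Delta> ^ s * hev Y f b M' (R s))" by simp
    also have "(\<Sum>s\<in>{Suc t..k}. \<Delta> ^ s * hev Y f b M' (R s)) = \<Delta> ^ t * (\<Delta> * U)"
      unfolding U_def sum_distrib_left
    proof (rule sum.cong[OF refl])
      fix s assume "s \<in> {Suc t..k}"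
      then have "s = t + Suc (s - Suc t)" by simp
      then have "\<Delta> ^ s = \<Delta> ^ t * (\<Delta> * \<Delta> ^ (s - Suc t))" by (metis power_add power_Suc)
      then show "\<Delta> ^ s * hev Y f b M' (R s) = \<Delta> ^ t * (\<Delta> * (\<Delta> ^ (s - Suc t) * hev Y f b M' (R s)))"
        by (simp add: mult.assoc)
    qed
    finally have "\<Delta> ^ t * (hev Y f b M' (R t) + \<Delta> * U) = 0" by (simp add: distrib_left)
    then have hevR: "hev Y f b M' (R t) = \<Delta> * (- U)" using \<open>\<Delta> \<noteq> 0\<close> by (simp add: eq_neg_iff_add_eq_0)
    show thesis
    proof (rule that[of "R t"])
      show "R t \<noteq> 0" by fact
      fix \<theta> and I :: "('v, 'k) mpoly set" and y
      assume I: "is_ideal I" and cong: "\<forall>j\<in>Y. icong I (msubst \<theta> (f j)) (cst (y j) * msubst \<theta> (b j))"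
        and nz: "mp_eval (R t) y \<noteq> 0"
      define \<beta> where "\<beta> = (\<Prod>j\<in>Y. msubst \<theta> (b j))"
      define z where "z = msubst \<theta> \<phi>"
      define p where "p = (\<Sum>s\<le>n. monom (mp_eval (Q s) y) s)"
      note sp = hev_specialize[OF I fin(1) _ cong, folded \<beta>_def]
      have "icong I (\<Sum>s\<le>n. z ^ s * msubst \<theta> (hev Y f b M (Q s))) (\<Sum>s\<le>n. z ^ s * (cst (mp_eval (Q s) y) * \<beta> ^ M))"
        by (intro icong_sum[OF I] icong_mult[OF I] icong_refl[OF I] sp bQ)
      also have "(\<Sum>s\<le>n. z ^ s * msubst \<theta> (hev Y f b M (Q s))) = msubst \<theta> (\<Sum>s\<le>n. \<phi> ^ s * hev Y f b M (Q s))"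
        by (simp add: cst.mp_hom_sum cst.mp_hom_mult cst.mp_hom_power z_def)
      also have "\<dots> = 0" by (simp add: sum0)
      also have "(\<Sum>s\<le>n. z ^ s * (cst (mp_eval (Q s) y) * \<beta> ^ M)) = \<beta> ^ M * peval p z"
        unfolding p_def peval_sum sum_distrib_left by (rule sum.cong) (auto simp: peval_monom mult_ac)
      finally have pI: "\<beta> ^ M * peval p z \<in> I" using icong_mem_iff[OF I] ideal_0[OF I] by blast
      have evQ': "mp_eval (Q' s) y = of_nat (Suc s) * mp_eval (Q (Suc s)) y" for s
        unfolding Q'_def mp_eval_eq idh.mp_hom_mult idh.mp_hom_cst ..
      have "pderiv p = (\<Sum>s\<le>n. monom (of_nat s * mp_eval (Q s) y) (s - 1))"
        by (simp add: p_def pderiv_sum pderiv_monom)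
      also have "\<dots> = (\<Sum>s\<le>n'. monom (mp_eval (Q' s) y) s)"
        unfolding Suc sum.atMost_Suc_shift by (simp add: evQ')
      finally have dp: "pderiv p = (\<Sum>s\<le>n'. monom (mp_eval (Q' s) y) s)" .
      have "icong I (\<Sum>s\<le>n'. z ^ s * msubst \<theta> (hev Y f b M (Q' s))) (\<Sum>s\<le>n'. z ^ s * (cst (mp_eval (Q' s) y) * \<beta> ^ M))"
        by (intro icong_sum[OF I] icong_mult[OF I] icong_refl[OF I] sp bQ')
      also have "(\<Sum>s\<le>n'. z ^ s * msubst \<theta> (hev Y f b M (Q' s))) = msubst \<theta> \<Delta>"
        by (simp add: cst.mp_hom_sum cst.mp_hom_mult cst.mp_hom_power z_def \<Delta>_def)
      also have "(\<Sum>s\<le>n'. z ^ s * (cst (mp_eval (Q' s) y) * \<beta> ^ M)) = \<beta> ^ M * peval (pderiv p) z"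
        unfolding dp peval_sum sum_distrib_left by (rule sum.cong) (auto simp: peval_monom mult_ac)
      finally have d: "icong I (msubst \<theta> \<Delta>) (\<beta> ^ M * peval (pderiv p) z)" .
      define c where "c = mp_eval (R t) y"
      define W where "W = msubst \<theta> (- U)"
      have "icong I (msubst \<theta> \<Delta> * W) (cst c * \<beta> ^ M')"
        using sp[OF bR, of t] unfolding hevR cst.mp_hom_mult c_def W_def .
      moreover have "icong I (msubst \<theta> \<Delta> * W) (\<beta> ^ M * peval (pderiv p) z * W)"
        by (intro icong_mult[OF I] d icong_refl[OF I])
      ultimately have "(msubst \<theta> \<Delta> * W - \<beta> ^ M * peval (pderiv p) z * W) - (msubst \<theta> \<Delta> * W - cst c * \<beta> ^ M') \<in> I"
        unfolding icong_def by (rule ideal_diff[OF I, rotated])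
      then have "cst c * \<beta> ^ M' - \<beta> ^ M * W * peval (pderiv p) z \<in> I" by (simp add: mult_ac)
      \<comment> \<open>The extra \<beta>^M brings both premises of
        \<open>separable_relation\<close> to the common exponent M + M'.\<close>
      then have "cst (1 / c) * \<beta> ^ M * (cst c * \<beta> ^ M' - \<beta> ^ M * W * peval (pderiv p) z) \<in> I" by (rule ideal_mult_left[OF I])
      moreover have "cst (1 / c) * cst c = (1 :: ('v, 'k) mpoly)" using nz by (simp add: c_def cst_mult[symmetric])
      then have "cst (1 / c) * \<beta> ^ M * (cst c * \<beta> ^ M') = \<beta> ^ (M + M')" 
        by (metis (no_types, opaque_lifting) mult.assoc mult.commute mult_1 power_add)
      ultimately have "\<beta> ^ (M + M') - (cst (1 / c) * \<beta> ^ M * \<beta> ^ M * W) * peval (pderiv p) z \<in> I"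
        by (simp add: right_diff_distrib mult.assoc)
      moreover have "\<beta> ^ M' * (\<beta> ^ M * peval p z) \<in> I" using pI by (rule ideal_mult_left[OF I])
      then have "\<beta> ^ (M + M') * peval p z \<in> I" by (simp add: power_add mult_ac)
      ultimately show "\<exists>N \<Lambda>. finite \<Lambda> \<and> \<beta> ^ N * (\<Prod>c\<in>\<Lambda>. msubst \<theta> \<phi> - cst c) \<in> I"
        using separable_relation[OF ac I, of \<beta> "M + M'" p z] unfolding z_def by blast
    qed
  qed
qed

section \<open>Points of ideals containing split separable polynomials\<close>

text \<open>For distinct c, c' in \<open>\<Lambda>\<close>, induction with one of the factors z - c,
  z - c' moved into h puts f (z - c) h and f (z - c') h into I; their difference is a nonzero
  multiple of f h. Here distinctness of the roots is essential.\<close>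

lemma ideal_point_step:
  fixes I :: "('v, 'k::field) mpoly set"
  assumes I: "is_ideal I" and fin: "finite \<Lambda>"
    and f: "\<And>c. c \<in> \<Lambda> \<Longrightarrow> f \<in> ideal_gen (insert (z - cst c) I)"
    and prod: "(\<Prod>c\<in>\<Lambda>. z - cst c) * h \<in> I"
  shows "f * h \<in> I"
  using fin f prod
proof (induction "card \<Lambda>" arbitrary: \<Lambda> h rule: less_induct)
  case less
  have gen: "\<exists>s. f - s * (z - cst c) \<in> I" if "c \<in> \<Lambda>" for c
  proof -
    have "ideal_gen I = I" using ideal_gen_minimal[OF subset_refl I] ideal_gen_superset[of I] by blast
    then show ?thesis using less.prems(2)[OF that] by (simp add: ideal_gen_insert_iff)
  qed
  consider "\<Lambda> = {}" | c where "\<Lambda> = {c}" | c c' where "c \<in> \<Lambda>" "c' \<in> \<Lambda>" "c \<noteq> c'" by blast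
  then show ?case
  proof cases
    case 1
    then show ?thesis using less.prems(3) ideal_mult_left[OF I] by simp
  next
    case 2
    then obtain s where s: "f - s * (z - cst c) \<in> I" using gen by blast
    have "(f - s * (z - cst c)) * h + s * ((z - cst c) * h) \<in> I"
      using less.prems(3) 2 by (intro ideal_add[OF I ideal_mult_right[OF I s] ideal_mult_left[OF I]]) simp
    then show ?thesis by (simp add: algebra_simps)
  next
    case 3
    have *: "f * ((z - cst b) * h) \<in> I" if b: "b \<in> \<Lambda>" for b
    proof (rule less.hyps[of "\<Lambda> - {b}"])
      show "card (\<Lambda> - {b}) < card \<Lambda>" using b less.prems(1) by (intro card_Diff1_less)
      show "finite (\<Lambda> - {b})" using less.prems(1) by simp
      show "f \<in> ideal_gen (insert (z - cst c) I)" if "c \<in> \<Lambda> - {b}" for c using that less.prems(2) by simp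
      have "(\<Prod>c\<in>\<Lambda>. z - cst c) = (z - cst b) * (\<Prod>c\<in>\<Lambda> - {b}. z - cst c)"
        using less.prems(1) b by (rule prod.remove)
      then show "(\<Prod>c\<in>\<Lambda> - {b}. z - cst c) * ((z - cst b) * h) \<in> I"
        using less.prems(3) by (simp add: mult_ac)
    qed
    have "cst (1 / (c' - c)) * (f * ((z - cst c) * h) - f * ((z - cst c') * h)) \<in> I"
      using 3 by (intro ideal_mult_left[OF I] ideal_diff[OF I] *)
    moreover have "f * ((z - cst c) * h) - f * ((z - cst c') * h) = cst (c' - c) * (f * h)"
      by (simp add: cst_diff algebra_simps)
    moreover have "cst (1 / (c' - c)) * cst (c' - c) = (1 :: ('v, 'k) mpoly)"
      using 3 by (simp add: cst_mult[symmetric])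
    ultimately show ?thesis by (simp add: mult.assoc[symmetric])
  qed
qed

text \<open>For each variable in turn some X_v - x_v can be adjoined while f stays outside. At the
  end everything is congruent to its value at x: f(x) = 0 would put f inside, and a nonzero value of
  an element of I would put a unit inside.\<close>

lemma ideal_point:
  fixes I :: "('v::finite, 'k::field) mpoly set"
  assumes I: "is_ideal I" and f: "f \<notin> I"
    and split: "\<And>v. \<exists>\<Lambda>. finite \<Lambda> \<and> (\<Prod>c\<in>\<Lambda>. mvar v - cst c) \<in> I"
  shows "\<exists>x. (\<forall>j\<in>I. mp_eval j x = 0) \<and> mp_eval f x \<noteq> 0"
proof -
  have "\<exists>x J. is_ideal J \<and> I \<subseteq> J \<and> f \<notin> J \<and> (\<forall>v\<in>A. mvar v - cst (x v) \<in> J)" for A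
  proof (induction A rule: finite_induct[OF finite])
    case 1
    then show ?case using I f by auto
  next
    case (2 v A)
    then obtain x J where J: "is_ideal J" "I \<subseteq> J" "f \<notin> J" "\<forall>v\<in>A. mvar v - cst (x v) \<in> J" by blast
    obtain \<Lambda> where \<Lambda>: "finite \<Lambda>" "(\<Prod>c\<in>\<Lambda>. mvar v - cst c) \<in> I" using split by blast
    obtain c where c: "f \<notin> ideal_gen (insert (mvar v - cst c) J)"
      using ideal_point_step[OF J(1) \<Lambda>(1), of f "mvar v" 1] \<Lambda>(2) J(2,3) by auto
    let ?J = "ideal_gen (insert (mvar v - cst c) J)"
    have sub: "insert (mvar v - cst c) J \<subseteq> ?J" by (rule ideal_gen_superset)
    have "\<forall>w\<in>insert v A. mvar w - cst ((x(v := c)) w) \<in> ?J" using J(4) sub 2(2) by auto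
    moreover have "I \<subseteq> ?J" using J(2) sub by auto
    ultimately show ?case using c is_ideal_ideal_gen by blast
  qed
  then obtain x J where J: "is_ideal J" "I \<subseteq> J" "f \<notin> J" "\<forall>v\<in>UNIV. mvar v - cst (x v) \<in> J" by blast
  have cong: "icong J p (cst (mp_eval p x))" for p
    by (rule mp_eval_cong_mod[OF J(1)]) (use J(4) in \<open>simp add: icong_def\<close>)
  have "mp_eval j x = 0" if "j \<in> I" for j
  proof (rule ccontr)
    assume nz: "mp_eval j x \<noteq> 0"
    have "cst (mp_eval j x) \<in> J" using icong_mem_iff[OF J(1) cong, of j] that J(2) by blast
    then have "f * cst (1 / mp_eval j x) * cst (mp_eval j x) \<in> J" by (rule ideal_mult_left[OF J(1)])
    then show False using nz J(3) by (simp add: mult.assoc cst_mult[symmetric])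
  qed
  moreover have "mp_eval f x \<noteq> 0"
  proof
    assume "mp_eval f x = 0"
    then have "f \<in> J" using icong_mem_iff[OF J(1) cong, of f] ideal_0[OF J(1)] by simp
    then show False using J(3) by simp
  qed
  ultimately show ?thesis by blast
qed

text \<open>Induction on the variables: once the other variables are specialised so that one
  coefficient in z survives, a nonzero univariate polynomial over an infinite field remains.\<close>

lemma exists_nonroot:
  assumes "finite Z" "vars_in Z p" "(p :: (nat, 'k::field_char_0) mpoly) \<noteq> 0"
  shows "\<exists>y. mp_eval p y \<noteq> 0"
  using assms
proof (induction Z arbitrary: p rule: finite_induct)
  case empty
  have keys: "keys p \<subseteq> {0}" using empty.prems(1) by (auto simp: vars_in_def)
  moreover have "keys p \<noteq> {}" using empty.prems(2) by simp
  ultimately have k: "keys p = {0}" by blast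
  then have "lkp p 0 \<noteq> 0" by (simp add: in_keys_iff[symmetric])
  then show ?case by (simp add: mp_eval_def k)
next
  case (insert z Z)
  obtain m0 where m0: "m0 \<in> keys p" using insert.prems(2) by (metis all_not_in_conv keys_eq_empty)
  define e where "e = lkp m0 z"
  define rem where "rem m = m - Poly_Mapping.single z (lkp m z)" for m :: "nat \<Rightarrow>\<^sub>0 nat"
  have rem_add: "m = rem m + Poly_Mapping.single z (lkp m z)" for m
    by (rule poly_mapping_eqI) (auto simp: rem_def lookup_add lookup_minus lookup_single when_def)
  have rem_z: "lkp (rem m) z = 0" for m by (simp add: rem_def lookup_minus)
  have rem_keys: "keys (rem m) \<subseteq> Z" if "keys m \<subseteq> insert z Z" for m
  proof
    fix w assume w: "w \<in> keys (rem m)"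
    then have "w \<noteq> z" using rem_z[of m] by (auto simp: in_keys_iff)
    moreover have "w \<in> keys m" using w by (auto simp: in_keys_iff rem_def lookup_minus)
    ultimately show "w \<in> Z" using that by auto
  qed
  let ?E = "{m \<in> keys p. lkp m z = e}"
  \<comment> \<open>The coefficient of z^e in p. Removing z from these monomials is injective
    because their exponent of z is fixed, so nothing cancels.\<close>
  define pe where "pe = (\<Sum>m\<in>?E. Poly_Mapping.single (rem m) (lkp p m))"
  have rem_inj: "rem m = rem m' \<longleftrightarrow> m = m'" if "lkp m z = e" "lkp m' z = e" for m m'
    using rem_add[of m] rem_add[of m'] unfolding that by metis
  have "lkp pe (rem m0) = (\<Sum>m\<in>?E. if m = m0 then lkp p m else 0)"
    unfolding pe_def lookup_sum
  proof (rule sum.cong[OF refl])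
    fix m assume "m \<in> ?E"
    then have "rem m = rem m0 \<longleftrightarrow> m = m0" using rem_inj[of m m0, OF _ e_def[symmetric]] by blast
    then show "lkp (Poly_Mapping.single (rem m) (lkp p m)) (rem m0) = (if m = m0 then lkp p m else 0)"
      by (simp only: lookup_single when_def)
  qed
  also have "\<dots> = lkp p m0" using m0 by (simp add: e_def)
  finally have "lkp pe (rem m0) \<noteq> 0" using m0 by (simp add: in_keys_iff)
  then have "pe \<noteq> 0" by auto
  moreover have "vars_in Z pe" unfolding pe_def
  proof (rule vars_in_sum)
    fix m assume "m \<in> ?E"
    then have "keys (rem m) \<subseteq> Z" using insert.prems(1) rem_keys by (auto simp: vars_in_def)
    then show "vars_in Z (Poly_Mapping.single (rem m) (lkp p m))" by (simp add: vars_in_def)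
  qed
  ultimately obtain y where y: "mp_eval pe y \<noteq> 0" using insert.IH by blast
  define u where "u = (\<Sum>m\<in>keys p. monom (lkp p m * mono_val y (rem m)) (lkp m z))"
  have "coeff u e = (\<Sum>m\<in>keys p. if lkp m z = e then lkp p m * mono_val y (rem m) else 0)"
    unfolding u_def coeff_sum by (rule sum.cong) auto
  also have "\<dots> = (\<Sum>m\<in>?E. lkp p m * mono_val y (rem m))"
    by (rule sum.inter_filter[symmetric]) simp
  also have "\<dots> = mp_eval pe y"
    by (simp add: pe_def mp_eval_eq idh.mp_hom_sum)
  finally have "u \<noteq> 0" using y by auto
  then have "finite {x. poly u x = 0}" by (rule poly_roots_finite)
  then have "\<exists>x. poly u x \<noteq> 0" using infinite_UNIV_char_0[where 'a = 'k] by (metis (mono_tags, lifting) UNIV_I finite_subset mem_Collect_eq subsetI)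
  then obtain x where x: "poly u x \<noteq> 0" by blast
  have "mono_val (y(z := x)) m = mono_val y (rem m) * x ^ lkp m z" for m
  proof -
    have "mono_val (y(z := x)) m = mono_val (y(z := x)) (rem m) * x ^ lkp m z"
      by (subst (1) rem_add[of m]) (simp only: mono_val_add mono_val_single fun_upd_same)
    also have "mono_val (y(z := x)) (rem m) = mono_val y (rem m)"
      unfolding mono_val_def by (rule prod.cong) (use rem_z[of m] not_in_keys_iff_lookup_eq_zero[of z "rem m"] in auto)
    finally show ?thesis .
  qed
  then have "mp_eval p (y(z := x)) = poly u x"
    by (simp add: mp_eval_eq mp_hom_def u_def poly_sum poly_monom mult.assoc)
  then show ?case using x by metis
qed

section \<open>General deformations of the complete intersection\<close>

text \<open>Coordinates X_w (\<open>Inl w\<close>) and deformation parameters c_(i,w)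
  (\<open>Inr (i, w)\<close>) share one polynomial ring with variables coded as natural numbers, an
  integral domain in which powers can be cancelled.\<close>

definition emb :: "('v::finite, 'k::field) mpoly \<Rightarrow> (nat, 'k) mpoly" where
  "emb = msubst (\<lambda>w. mvar (to_nat (Inl w :: 'v + nat \<times> 'v)))"

definition par :: "nat \<Rightarrow> 'v::finite \<Rightarrow> (nat, 'k::field) mpoly" where
  "par i w = mvar (to_nat (Inr (i, w) :: 'v + nat \<times> 'v))"

definition specialize :: "(nat \<Rightarrow> 'v \<Rightarrow> 'k) \<Rightarrow> nat \<Rightarrow> ('v::finite, 'k::field) mpoly" where
  "specialize c z = (case from_nat z :: 'v + nat \<times> 'v of Inl w \<Rightarrow> mvar w | Inr (i, w) \<Rightarrow> cst (c i w))"

lemma specialize_emb [simp]: "msubst (specialize c) (emb p) = p"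
  unfolding emb_def msubst_msubst by (simp add: specialize_def)

lemma specialize_par [simp]: "msubst (specialize c) (par i w) = cst (c i w)"
  by (simp add: par_def specialize_def)

text \<open>Modulo I the form q equals the nonzero constant t, so its powers are units.\<close>

lemma power_eq_ideal_unit:
  assumes I: "is_ideal I" and q: "q - cst t \<in> I" and t: "t \<noteq> 0" and h: "q ^ k * f \<in> I"
  shows "f \<in> (I :: ('v, 'k::field) mpoly set)"
proof -
  have "icong I (q ^ k * f) (cst t ^ k * f)"
    by (intro icong_mult[OF I] icong_power[OF I] icong_refl[OF I]) (simp add: icong_def q)
  then have "cst t ^ k * f \<in> I" using h icong_mem_iff[OF I] by blast
  then have "cst (1 / t) ^ k * (cst t ^ k * f) \<in> I" by (rule ideal_mult_left[OF I])
  moreover have "cst (1 / t) ^ k * cst t ^ k = (1 :: ('v, 'k) mpoly)"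
    using t by (simp add: power_mult_distrib[symmetric] cst_mult[symmetric])
  ultimately show ?thesis by (simp add: mult.assoc[symmetric])
qed

text \<open>By the pigeonhole principle each monomial of p has some exponent at least L.\<close>

lemma homog_mult_mem_of_powers:
  fixes I :: "('v::finite, 'k::field) mpoly set"
  assumes I: "is_ideal I" and L: "\<And>v. mvar v ^ L * f \<in> I" and p: "homog d p" "d > CARD('v) * L"
  shows "p * f \<in> I"
proof -
  have "Poly_Mapping.single m (lkp p m) * f \<in> I" if m: "m \<in> keys p" for m
  proof -
    have "\<exists>v. lkp m v \<ge> L"
    proof (rule ccontr)
      assume "\<not> (\<exists>v. lkp m v \<ge> L)"
      then have "mdeg m \<le> (\<Sum>v\<in>(UNIV :: 'v set). L)" unfolding mdeg_conv
        by (intro sum_mono) (simp add: not_le less_imp_le)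
      then show False using p m by (auto simp: homog_def)
    qed
    then obtain v where v: "lkp m v \<ge> L" by blast
    have pw: "mvar v ^ k = (Poly_Mapping.single (Poly_Mapping.single v k) 1 :: ('v, 'k) mpoly)" for k
    proof -
      have "mono_val mvar (Poly_Mapping.single v k) = (Poly_Mapping.single (Poly_Mapping.single v k) 1 :: ('v, 'k) mpoly)"
        by (rule mono_val_mvar)
      then show ?thesis by simp
    qed
    have "m = (m - Poly_Mapping.single v L) + Poly_Mapping.single v L"
      using v by (intro poly_mapping_eqI) (auto simp: lookup_add lookup_minus lookup_single when_def)
    then have "Poly_Mapping.single m (lkp p m) = Poly_Mapping.single (m - Poly_Mapping.single v L) (lkp p m) * mvar v ^ L"
      by (simp add: pw mult_single)
    then show ?thesis using ideal_mult_left[OF I L[of v]] by (simp add: mult.assoc)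
  qed
  then have "(\<Sum>m\<in>keys p. Poly_Mapping.single m (lkp p m) * f) \<in> I" by (rule ideal_sum_mem[OF I])
  then show ?thesis
    by (simp add: sum_distrib_right[symmetric] poly_mapping_sum_singles[OF finite_keys subset_refl, symmetric])
qed

text \<open>Pure powers X_w^(r i) are enough: on each chart one of them is invertible, and its
  coefficient can be solved for.\<close>

definition deform :: "('v::finite, 'k::field) mpoly \<Rightarrow> (nat \<Rightarrow> nat) \<Rightarrow> (nat \<Rightarrow> ('v, 'k) mpoly)
    \<Rightarrow> (nat \<Rightarrow> 'v \<Rightarrow> 'k) \<Rightarrow> nat \<Rightarrow> ('v, 'k) mpoly" where
  "deform u r g c i = g i + (\<Sum>w\<in>UNIV. cst (c i w) * mvar w ^ r i) * u"

text \<open>The coefficients \<open>c\<close> of the deformation are obtained as the values of a dominant map: on the chart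
  \<open>X\<^sub>v \<noteq> 0\<close> the equation \<open>g' i = 0\<close> can be solved for \<open>c i v\<close>, so that the point and the remaining
  coefficients are free coordinates there.\<close>

lemma general_deformation:
  fixes q u :: "('v::finite, 'k::field_char_0) mpoly" and g :: "nat \<Rightarrow> ('v, 'k) mpoly"
  assumes ac: "alg_closed_field TYPE('k)" and card: "CARD('v) = n + 1"
    and q: "homog e q" "e > 0"
  shows "\<exists>t c. t \<noteq> 0 \<and> (\<forall>f. f \<notin> ideal_gen (insert (q - cst t) (deform (q ^ a) r g c ` {1..n})) \<longrightarrow>
    (\<exists>x. (\<forall>j\<in>ideal_gen (deform (q ^ a) r g c ` {1..n}). mp_eval j x = 0) \<and> mp_eval f x \<noteq> 0))"
proof -
  \<comment> \<open>\<open>Y\<close> lists the data to be specialised: the value t of q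
    (\<open>None\<close>) and all c_(i,w). \<open>Z v\<close> lists the free coordinates on the
    chart X_v != 0: the point and the c_(i,w) with w different from v.\<close>
  define Y where "Y = (to_nat :: (nat \<times> 'v) option \<Rightarrow> nat) ` insert None (Some ` ({1..n} \<times> UNIV))"
  define Z where "Z v = (to_nat :: 'v + nat \<times> 'v \<Rightarrow> nat) ` (range Inl \<union> Inr ` ({1..n} \<times> (UNIV - {v})))" for v
  have finY: "finite Y" and finZ: "finite (Z v)" for v by (simp_all add: Y_def Z_def)
  have "card Y = Suc (card (Some ` ({1..n} \<times> (UNIV :: 'v set))))"
    unfolding Y_def by (subst card_image) (auto simp: inj_on_def)
  also have "\<dots> = Suc (n * (n + 1))"
    by (subst card_image) (auto simp: card_cartesian_product card)
  finally have cY: "card Y = Suc (n * (n + 1))" .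
  have cZ: "card (Z v) = Suc (n * (n + 1))" for v
  proof -
    have "card (Z v) = card (range Inl \<union> Inr ` ({1..n} \<times> (UNIV - {v})) :: ('v + nat \<times> 'v) set)"
      unfolding Z_def by (rule card_image) (auto simp: inj_on_def)
    also have "\<dots> = card (range Inl :: ('v + nat \<times> 'v) set) + card (Inr ` ({1..n} \<times> (UNIV - {v})) :: ('v + nat \<times> 'v) set)"
      by (rule card_Un_disjoint) auto
    also have "\<dots> = (n + 1) + n * n"
      by (simp add: card_image card card_cartesian_product card_Diff_singleton)
    finally show ?thesis by simp
  qed
  \<comment> \<open>The data of \<open>Y\<close> as fractions f / b in the coordinates of chart v.
    Only c_(i,v), solved from the i-th equation, has a denominator, namely q^a X_v^(r i).\<close>
  define f where "f v j = (case from_nat j :: (nat \<times> 'v) option of None \<Rightarrow> emb q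
      | Some (i, w) \<Rightarrow> if w = v then - (emb (g i) + (\<Sum>w\<in>UNIV - {v}. par i w * emb (mvar w) ^ r i) * emb q ^ a) else par i w)" for v j
  define b where "b v j = (case from_nat j :: (nat \<times> 'v) option of None \<Rightarrow> 1
      | Some (i, w) \<Rightarrow> if w = v then emb q ^ a * emb (mvar v) ^ r i else (1 :: (nat, 'k) mpoly))" for v j
  have vars_emb: "vars_in (Z v) (emb p)" for v and p :: "('v, 'k) mpoly"
    unfolding emb_def by (intro vars_in_msubst vars_in_mvar) (auto simp: Z_def)
  have vars_par: "vars_in (Z v) (par i w)" if "i \<in> {1..n}" "w \<noteq> v" for v i and w :: 'v
    unfolding par_def using that by (intro vars_in_mvar) (auto simp: Z_def)
  have Y_cases: "from_nat j = (None :: (nat \<times> 'v) option) \<or> (\<exists>i w. i \<in> {1..n} \<and> from_nat j = Some (i, w :: 'v))" if "j \<in> Y" for j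
    using that by (auto simp: Y_def)
  have vars_f: "vars_in (Z v) (f v j)" if "j \<in> Y" for v j
    using Y_cases[OF that]
  proof (elim disjE exE conjE)
    fix i w assume i: "i \<in> {1..n}" and j: "from_nat j = Some (i, w :: 'v)"
    show ?thesis
    proof (cases "w = v")
      case True
      then show ?thesis using i unfolding f_def j
        by (auto intro!: vars_in_diff vars_in_uminus vars_in_add vars_in_mult vars_in_sum vars_in_power vars_emb vars_par)
    qed (use i in \<open>simp add: f_def j vars_par\<close>)
  qed (simp add: f_def vars_emb)
  have vars_b: "vars_in (Z v) (b v j)" for v j
    unfolding b_def by (auto split: option.split intro!: vars_in_1 vars_in_mult vars_in_power vars_emb)
  have gen: "\<exists>\<nu> :: (nat, 'k) mpoly. \<nu> \<noteq> 0 \<and> (\<forall>\<theta> (I :: ('v, 'k) mpoly set) y. is_ideal I \<longrightarrow>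
      (\<forall>j\<in>Y. icong I (msubst \<theta> (f v j)) (cst (y j) * msubst \<theta> (b v j))) \<longrightarrow> mp_eval \<nu> y \<noteq> 0 \<longrightarrow>
      (\<exists>N \<Lambda>. finite \<Lambda> \<and> (\<Prod>j\<in>Y. msubst \<theta> (b v j)) ^ N * (\<Prod>c\<in>\<Lambda>. msubst \<theta> (emb (mvar w)) - cst c) \<in> I))" for v w :: 'v
  proof -
    show ?thesis
    proof (rule generic_separability[where Y = Y and Z = "Z v" and f = "f v" and b = "b v" and \<phi> = "emb (mvar w)", OF ac finY finZ])
      show "card (Z v) \<le> card Y" using cY cZ by simp
      show "vars_in (Z v) (emb (mvar w :: ('v, 'k) mpoly))" by (rule vars_emb)
      show "vars_in (Z v) (f v j)" if "j \<in> Y" for j using that by (rule vars_f)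
      show "vars_in (Z v) (b v j)" for j by (rule vars_b)
      fix \<nu> :: "(nat, 'k) mpoly"
      assume "\<nu> \<noteq> 0" and "\<And>\<theta> (I :: ('v, 'k) mpoly set) y. is_ideal I \<Longrightarrow>
        (\<forall>j\<in>Y. icong I (msubst \<theta> (f v j)) (cst (y j) * msubst \<theta> (b v j))) \<Longrightarrow> mp_eval \<nu> y \<noteq> 0 \<Longrightarrow>
        \<exists>N \<Lambda>. finite \<Lambda> \<and> (\<Prod>j\<in>Y. msubst \<theta> (b v j)) ^ N * (\<Prod>c\<in>\<Lambda>. msubst \<theta> (emb (mvar w)) - cst c) \<in> I"
      then show ?thesis by (intro exI[of _ \<nu>]) simp
    qed
  qed
  then obtain \<nu> :: "'v \<Rightarrow> 'v \<Rightarrow> (nat, 'k) mpoly" where \<nu>: "\<And>v w. \<nu> v w \<noteq> 0"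
    "\<And>v w \<theta> (I :: ('v, 'k) mpoly set) y. is_ideal I \<Longrightarrow>
      (\<forall>j\<in>Y. icong I (msubst \<theta> (f v j)) (cst (y j) * msubst \<theta> (b v j))) \<Longrightarrow> mp_eval (\<nu> v w) y \<noteq> 0 \<Longrightarrow>
      \<exists>N \<Lambda>. finite \<Lambda> \<and> (\<Prod>j\<in>Y. msubst \<theta> (b v j)) ^ N * (\<Prod>c\<in>\<Lambda>. msubst \<theta> (emb (mvar w)) - cst c) \<in> I"
    by metis
  \<comment> \<open>One parameter vector has to work for all charts v and all coordinates w; the
    last factor forces t to be nonzero.\<close>
  define \<nu>' where "\<nu>' = (\<Prod>v\<in>UNIV. \<Prod>w\<in>UNIV. \<nu> v w) * mvar (to_nat (None :: (nat \<times> 'v) option))"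
  have mvar_nz: "mvar z \<noteq> (0 :: (nat, 'k) mpoly)" for z
    unfolding mvar_def by (metis lookup_single_eq lookup_zero zero_neq_one)
  have "\<nu>' \<noteq> 0" using \<nu>(1) mvar_nz by (simp add: \<nu>'_def)
  moreover have "finite (\<Union>m\<in>keys \<nu>'. keys m)" "vars_in (\<Union>m\<in>keys \<nu>'. keys m) \<nu>'" by (auto simp: vars_in_def)
  ultimately obtain y where y: "mp_eval \<nu>' y \<noteq> 0" using exists_nonroot by blast
  then have y': "mp_eval (\<nu> v w) y \<noteq> 0" for v w
    by (simp add: \<nu>'_def mp_eval_eq idh.mp_hom_mult idh.mp_hom_prod)
  define t where "t = y (to_nat (None :: (nat \<times> 'v) option))"
  define c where "c i w = y (to_nat (Some (i, w)))" for i :: nat and w :: 'v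
  have t: "t \<noteq> 0" using y by (simp add: \<nu>'_def mp_eval_eq idh.mp_hom_mult t_def)
  define g' where "g' = deform (q ^ a) r g c"
  define I where "I = ideal_gen (insert (q - cst t) (g' ` {1..n}))"
  have I: "is_ideal I" by (simp add: I_def)
  have qI: "q - cst t \<in> I" unfolding I_def by (rule ideal_gen_base) simp
  have gI: "g' i \<in> I" if "i \<in> {1..n}" for i unfolding I_def using that by (intro ideal_gen_base) simp
  have cong: "\<forall>j\<in>Y. icong I' (msubst (specialize c) (f v j)) (cst (y j) * msubst (specialize c) (b v j))"
    if "I \<subseteq> I'" "is_ideal I'" for v I'
  proof
    fix j assume jY: "j \<in> Y"
    have "\<exists>x. j = to_nat (x :: (nat \<times> 'v) option)" using jY by (auto simp: Y_def)
    then have yj: "y j = y (to_nat (from_nat j :: (nat \<times> 'v) option))" by auto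
    show "icong I' (msubst (specialize c) (f v j)) (cst (y j) * msubst (specialize c) (b v j))"
      using Y_cases[OF jY]
    proof (elim disjE exE conjE)
      assume j: "from_nat j = (None :: (nat \<times> 'v) option)"
      then have "y j = t" using yj by (simp add: t_def)
      then show ?thesis using qI that(1) by (auto simp: f_def b_def j icong_def)
    next
      fix i w assume i: "i \<in> {1..n}" and j: "from_nat j = Some (i, w :: 'v)"
      then have yc: "y j = c i w" using yj by (simp add: c_def)
      show ?thesis
      proof (cases "w = v")
        case False
        then show ?thesis by (simp add: f_def b_def j yc icong_refl[OF that(2)])
      next
        case True
        \<comment> \<open>For w = v the congruence is the i-th deformed equation up to sign.\<close>
        have "(\<Sum>w\<in>UNIV. cst (c i w) * mvar w ^ r i)
            = cst (c i v) * mvar v ^ r i + (\<Sum>w\<in>UNIV - {v}. cst (c i w) * mvar w ^ r i)"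
          by (rule sum.remove) auto
        then have "msubst (specialize c) (f v j) - cst (y j) * msubst (specialize c) (b v j) = - 1 * g' i"
          using True by (simp add: f_def b_def j yc g'_def deform_def cst.mp_hom_uminus cst.mp_hom_diff cst.mp_hom_add cst.mp_hom_mult
              cst.mp_hom_sum cst.mp_hom_power algebra_simps)
        then show ?thesis unfolding icong_def using ideal_mult_left[OF that(2), of "g' i" "- 1"] gI[OF i] that(1) by auto
      qed
    qed
  qed
  \<comment> \<open>The denominators multiply to a monomial in q and X_v. As q is a unit modulo I,
    only X_v has to be inverted, which is why the saturation \<open>Sat v\<close> appears
    below.\<close>
  have \<beta>: "\<exists>A R. (\<Prod>j\<in>Y. msubst (specialize c) (b v j)) = q ^ A * mvar v ^ R" for v
  proof -
    have "\<exists>A R. msubst (specialize c) (b v j) = q ^ A * mvar v ^ R" for j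
    proof (cases "from_nat j :: (nat \<times> 'v) option")
      case None
      then show ?thesis by (intro exI[of _ 0]) (simp add: b_def)
    next
      case (Some iw)
      obtain i w where iw: "iw = (i, w)" by (cases iw)
      show ?thesis
      proof (cases "w = v")
        case True
        then show ?thesis using Some iw
          by (intro exI[of _ a] exI[of _ "r i"]) (simp add: b_def cst.mp_hom_mult cst.mp_hom_power)
      next
        case False
        then show ?thesis using Some iw by (intro exI[of _ 0]) (simp add: b_def)
      qed
    qed
    then obtain A R where AR: "\<And>j. msubst (specialize c) (b v j) = q ^ A j * mvar v ^ R j" by metis
    show ?thesis unfolding AR prod.distrib power_sum[symmetric] by blast
  qed
  have main: "\<exists>x. (\<forall>j\<in>ideal_gen (g' ` {1..n}). mp_eval j x = 0) \<and> mp_eval h x \<noteq> 0" if h: "h \<notin> I" for h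
  proof -
    define Sat where "Sat v = {p. \<exists>N. mvar v ^ N * p \<in> I}" for v
    have IS: "I \<subseteq> Sat v" for v
    proof
      fix p assume "p \<in> I"
      then show "p \<in> Sat v" unfolding Sat_def by (intro CollectI exI[of _ 0]) simp
    qed
    have Sat: "is_ideal (Sat v)" for v
    proof (rule is_idealI)
      show "0 \<in> Sat v" using IS ideal_0[OF I] by blast
      show "x + y \<in> Sat v" if xy: "x \<in> Sat v" "y \<in> Sat v" for x y
      proof -
        obtain N N' where N: "mvar v ^ N * x \<in> I" "mvar v ^ N' * y \<in> I" using xy by (auto simp: Sat_def)
        have "mvar v ^ N' * (mvar v ^ N * x) + mvar v ^ N * (mvar v ^ N' * y) \<in> I"
          by (rule ideal_add[OF I ideal_mult_left[OF I N(1)] ideal_mult_left[OF I N(2)]])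
        then have "mvar v ^ (N + N') * (x + y) \<in> I" by (simp add: power_add algebra_simps)
        then show ?thesis unfolding Sat_def by blast
      qed
      show "s * x \<in> Sat v" if x: "x \<in> Sat v" for s x
      proof -
        obtain N where "mvar v ^ N * x \<in> I" using x by (auto simp: Sat_def)
        then have "s * (mvar v ^ N * x) \<in> I" by (rule ideal_mult_left[OF I])
        then have "mvar v ^ N * (s * x) \<in> I" by (simp add: mult_ac)
        then show ?thesis unfolding Sat_def by blast
      qed
    qed
    \<comment> \<open>Some chart sees h: otherwise all X_v^L h lie in I, hence also q^m h for large
      m, although q is a unit modulo I.\<close>
    have "\<exists>v. h \<notin> Sat v"
    proof (rule ccontr)
      assume "\<not> (\<exists>v. h \<notin> Sat v)"
      then obtain N where N: "\<And>v. mvar v ^ N v * h \<in> I" unfolding Sat_def by (auto, metis)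
      define L where "L = Max (range N)"
      have L: "mvar v ^ L * h \<in> I" for v
      proof -
        have "N v \<le> L" unfolding L_def by (rule Max_ge) auto
        then have "mvar v ^ (L - N v) * (mvar v ^ N v * h) = mvar v ^ L * h"
          by (simp add: mult.assoc[symmetric] power_add[symmetric])
        then show ?thesis using ideal_mult_left[OF I N[of v], of "mvar v ^ (L - N v)"] by simp
      qed
      have "homog (e * Suc (CARD('v) * L)) (q ^ Suc (CARD('v) * L))" by (rule homog_power[OF q(1)])
      moreover have "CARD('v) * L < e * Suc (CARD('v) * L)"
        using q(2) by (metis less_le_trans lessI mult_le_mono1 mult_1 Suc_leI One_nat_def)
      ultimately have "q ^ Suc (CARD('v) * L) * h \<in> I" by (intro homog_mult_mem_of_powers[OF I L])
      then show False using power_eq_ideal_unit[OF I qI t] h by blast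
    qed
    then obtain v where v: "h \<notin> Sat v" by blast
    have "\<exists>\<Lambda>. finite \<Lambda> \<and> (\<Prod>c\<in>\<Lambda>. mvar w - cst c) \<in> Sat v" for w
    proof -
      obtain N \<Lambda> where \<Lambda>: "finite \<Lambda>" "(\<Prod>j\<in>Y. msubst (specialize c) (b v j)) ^ N * (\<Prod>c\<in>\<Lambda>. mvar w - cst c) \<in> I"
        using \<nu>(2)[OF I cong[OF subset_refl I] y', of v w, unfolded specialize_emb] by blast
      obtain A R where AR: "(\<Prod>j\<in>Y. msubst (specialize c) (b v j)) = q ^ A * mvar v ^ R" using \<beta> by blast
      have "q ^ (A * N) * (mvar v ^ (R * N) * (\<Prod>c\<in>\<Lambda>. mvar w - cst c)) \<in> I"
        using \<Lambda>(2) unfolding AR by (simp add: power_mult_distrib power_mult mult.assoc)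
      then have "mvar v ^ (R * N) * (\<Prod>c\<in>\<Lambda>. mvar w - cst c) \<in> I" by (rule power_eq_ideal_unit[OF I qI t])
      then show ?thesis using \<Lambda>(1) unfolding Sat_def by blast
    qed
    from ideal_point[OF Sat v this] obtain x where x: "\<forall>j\<in>Sat v. mp_eval j x = 0" "mp_eval h x \<noteq> 0" by blast
    have "ideal_gen (g' ` {1..n}) \<subseteq> I" unfolding I_def by (rule ideal_gen_mono) auto
    then show ?thesis using x IS by blast
  qed
  show ?thesis
    using t main unfolding I_def g'_def by (intro exI[of _ t] exI[of _ c] conjI allI impI)
qed

section \<open>The rank of F\<close>

text \<open>Let f = s (q - t) modulo J. Comparing degrees gives q S_(i-e) = t S_i for i different
  from D, where S_i are the components of s. Going up from degree 0 (t is a unit) and down from the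
  top (q is a nonzerodivisor), all S_i lie in J.\<close>

lemma dehomogenize_mem:
  fixes q :: "('v::finite, 'k::field) mpoly"
  assumes gr: "graded_set (ideal_gen G)" and q: "homog e q" "e > 0" "nzd_mod q (ideal_gen G)" and t: "t \<noteq> 0"
    and f: "homog D f" "f \<in> ideal_gen (insert (q - cst t) G)"
  shows "f \<in> ideal_gen G"
proof -
  let ?J = "ideal_gen G"
  note J = is_ideal_ideal_gen[of G]
  obtain s where s: "f - s * (q - cst t) \<in> ?J" using f(2) by (auto simp: ideal_gen_insert_iff)
  define S where "S i = hcomp i s" for i
  have comp: "(if i = D then f else 0) - (if e \<le> i then S (i - e) * q else 0) + cst t * S i \<in> ?J" for i
  proof -
    have "hcomp i (f - s * (q - cst t)) \<in> ?J" using s gr by (simp add: graded_set_def)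
    moreover have "hcomp i (s * cst t) = cst t * S i" using hcomp_mult_homog[of 0 "cst t" i s] by (simp add: S_def mult.commute)
    then have "hcomp i (f - s * (q - cst t)) = (if i = D then f else 0) - (if e \<le> i then S (i - e) * q else 0) + cst t * S i"
      by (simp add: right_diff_distrib hcomp_diff hcomp_homog[OF f(1)] hcomp_mult_homog[OF q(1)] S_def)
    ultimately show ?thesis by simp
  qed
  have unit: "p \<in> ?J" if "cst t * p \<in> ?J" for p
    using ideal_mult_left[OF J that, of "cst (1 / t)"] t by (simp add: mult.assoc[symmetric] cst_mult[symmetric])
  have low: "S i \<in> ?J" if "i < D" for i
    using that
  proof (induction i rule: less_induct)
    case (less i)
    have "(if e \<le> i then S (i - e) * q else 0) \<in> ?J"
      using less.IH[of "i - e"] less.prems q(2) by (auto intro: ideal_mult_right[OF J] ideal_0[OF J])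
    from ideal_add[OF J comp[of i] this] have "cst t * S i \<in> ?J" using less.prems by simp
    then show ?case by (rule unit)
  qed
  obtain N where N: "\<And>i. i > N \<Longrightarrow> S i = 0" using sum_hcomp_ex[of s] by (auto simp: S_def)
  \<comment> \<open>Degree i + e exceeds D, so f does not enter; the induction runs downwards from
    \<open>N\<close>, beyond which s has no components.\<close>
  have high: "S i \<in> ?J" if "i \<ge> D" for i
    using that
  proof (induction "N + 1 - i" arbitrary: i rule: less_induct)
    case less
    show ?case
    proof (cases "i > N")
      case False
      have "S (i + e) \<in> ?J" using False q(2) less.prems by (intro less.hyps) auto
      then have "cst t * S (i + e) \<in> ?J" by (rule ideal_mult_left[OF J])
      from ideal_diff[OF J this comp[of "i + e"]] have "S i * q \<in> ?J" using less.prems q(2) by simp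
      then show ?thesis using q(3) by (auto dest: nzd_modD)
    qed (simp add: N ideal_0[OF J])
  qed
  have "s \<in> ?J" using graded_mem_iff[OF gr J, of s] low high unfolding S_def by (meson not_le)
  then have "s * (q - cst t) \<in> ?J" by (rule ideal_mult_right[OF J])
  from ideal_add[OF J s this] show ?thesis by simp
qed

lemma ideal_gen_low_degree:
  fixes p :: "('v::finite, 'k::field) mpoly"
  assumes "\<And>g. g \<in> G \<Longrightarrow> \<exists>d. d \<ge> k \<and> homog d g" and "p \<in> ideal_gen G" "homog i p" "i < k"
  shows "p = 0"
proof -
  obtain I r where I: "I \<subseteq> G" and p: "p = (\<Sum>x\<in>I. r x * x)"
    using assms(2) unfolding ideal_gen_def by auto
  have "hcomp i (r x * x) = 0" if x: "x \<in> I" for x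
  proof -
    obtain d where "d \<ge> k" "homog d x" using assms(1) I x by blast
    then show ?thesis using assms(4) by (simp add: hcomp_mult_homog)
  qed
  then have "hcomp i p = 0" unfolding p hcomp_sum by (rule sum.neutral[rule_format])
  then show ?thesis using assms(3) by (simp add: hcomp_homog)
qed

lemma tdeg_homog:
  assumes "homog D F" "F \<noteq> 0" shows "tdeg F = D"
proof -
  have "mdeg ` keys F = {D}" using assms by (auto simp: homog_def) (metis all_not_in_conv image_iff keys_eq_empty)
  then show ?thesis using assms(2) by (simp add: tdeg_def)
qed

lemma homog_0_cst:
  assumes "homog 0 (p :: ('v::finite, 'k::field) mpoly)" shows "p = cst (lkp p 0)"
proof (rule poly_mapping_eqI)
  fix m :: "'v \<Rightarrow>\<^sub>0 nat"
  have "m = 0" if "mdeg m = 0"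
    by (rule poly_mapping_eqI) (use lookup_le_mdeg[of m] that in simp)
  then show "lkp p m = lkp (cst (lkp p 0)) m"
    using assms by (cases "m = 0") (auto simp: homog_iff cst_def lookup_single)
qed

lemma ideal_gen_deform:
  fixes x :: "'a::comm_ring_1"
  shows "ideal_gen (insert x ((\<lambda>i. g i + h i * x) ` A)) = ideal_gen (insert x (g ` A))"
proof (rule ideal_gen_eqI)
  have *: "insert x ((\<lambda>i. g i + h i * x) ` A) \<subseteq> ideal_gen (insert x (g ` A))" for g h :: "'b \<Rightarrow> 'a"
  proof -
    have "g i + h i * x \<in> ideal_gen (insert x (g ` A))" if "i \<in> A" for i
      using that by (intro ideal_add ideal_mult_left is_ideal_ideal_gen ideal_gen_base) auto
    then show ?thesis using ideal_gen_base[of x "insert x (g ` A)"] by auto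
  qed
  show "insert x ((\<lambda>i. g i + h i * x) ` A) \<subseteq> ideal_gen (insert x (g ` A))" by (rule *)
  show "insert x (g ` A) \<subseteq> ideal_gen (insert x ((\<lambda>i. g i + h i * x) ` A))"
    using *[of "\<lambda>i. g i + h i * x" "\<lambda>i. - h i"] by (simp add: algebra_simps)
qed

section \<open>The rank formula under the hypotheses of the theorem\<close>

context
  fixes F q :: "('v::finite, 'k::field_char_0) mpoly"
    and g :: "nat \<Rightarrow> ('v, 'k) mpoly"
    and n a e D :: nat and d :: "nat \<Rightarrow> nat"
  assumes ac: "alg_closed_field TYPE('k)"
    and card: "CARD('v) = n + 1"
    and F: "homog D F"
    and perp: "perp F = ideal_gen (insert (q ^ a) (g ` {1..n}))"
    and reg: "regular_sequence (q ^ a # map g [1..<n+1])"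
    and q: "q \<noteq> 0" "homog e q"
    and g: "\<And>i. i \<in> {1..n} \<Longrightarrow> homog (d i) (g i)"
    and a: "a \<ge> 2" and e: "e > 0"
    and d: "\<And>i. i \<in> {1..n} \<Longrightarrow> a * e \<le> d i"
begin

lemma qa: "homog (e * a) (q ^ a)" "e * a > 0"
  using homog_power[OF q(2), of a] a e by auto

lemma reg_first: "nzd_mod (q ^ a) {0}"
  using reg unfolding regular_sequence_def nzd_mod_def by (auto dest: spec[of _ 0])

lemma reg_rest: "nzd_mod (g (Suc j)) (ideal_gen (insert (q ^ a) (g ` {1..j})))" if "j < n" for j
proof -
  have "set (take (Suc j) (q ^ a # map g [1..<n+1])) = insert (q ^ a) (g ` {1..j})"
    using that by (auto simp: take_map atLeastLessThanSuc_atLeastAtMost)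
  moreover have "(q ^ a # map g [1..<n+1]) ! Suc j = g (Suc j)" using that by (simp del: upt_Suc)
  moreover have "Suc j < length (q ^ a # map g [1..<n+1])" using that by (simp del: upt_Suc)
  ultimately show ?thesis using reg unfolding regular_sequence_def nzd_mod_def by metis
qed

text \<open>Modulo q^a nothing changes, so q^a, g'_1, ..., g'_n is still regular; moving q^a to the
  end gives both claims.\<close>

lemma deformed_sequence:
  assumes g': "\<And>i. g' i = g i + h i * q ^ a" and hom: "\<And>i. i \<in> {1..n} \<Longrightarrow> homog (d i) (g' i)"
  shows "nzd_mod q (ideal_gen (g' ` {1..n}))"
    and "j < n \<Longrightarrow> nzd_mod (g' (Suc j)) (ideal_gen (g' ` {1..j}))"
proof -
  have r: "nzd_mod (g' (Suc j)) (ideal_gen (insert (q ^ a) (g' ` {1..j})))" if "j < n" for j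
  proof -
    have eq: "ideal_gen (insert (q ^ a) (g' ` {1..j})) = ideal_gen (insert (q ^ a) (g ` {1..j}))"
      unfolding g' by (rule ideal_gen_deform)
    show ?thesis unfolding eq nzd_mod_def
    proof (intro allI impI)
      fix p assume "p * g' (Suc j) \<in> ideal_gen (insert (q ^ a) (g ` {1..j}))"
      moreover have "p * h (Suc j) * q ^ a \<in> ideal_gen (insert (q ^ a) (g ` {1..j}))"
        by (intro ideal_mult_left is_ideal_ideal_gen ideal_gen_base) simp
      ultimately have "p * g' (Suc j) - p * h (Suc j) * q ^ a \<in> ideal_gen (insert (q ^ a) (g ` {1..j}))"
        by (rule ideal_diff[OF is_ideal_ideal_gen])
      then have "p * g (Suc j) \<in> ideal_gen (insert (q ^ a) (g ` {1..j}))" by (simp add: g' algebra_simps)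
      then show "p \<in> ideal_gen (insert (q ^ a) (g ` {1..j}))" by (rule nzd_modD[OF reg_rest[OF that]])
    qed
  qed
  note shift = regular_sequence_shift[of "e * a" "q ^ a" n d g', OF qa hom reg_first r]
  have "nzd_mod (q ^ a) (ideal_gen (g' ` {1..n}))" by (rule shift(1)) auto
  then show "nzd_mod q (ideal_gen (g' ` {1..n}))" using a by (intro nzd_mod_powerD[of _ q a]) auto
  show "j < n \<Longrightarrow> nzd_mod (g' (Suc j)) (ideal_gen (g' ` {1..j}))" by (rule shift(2))
qed

lemma nzd_q: "nzd_mod q (ideal_gen (g ` {1..n}))"
  and nzd_g: "j < n \<Longrightarrow> nzd_mod (g (Suc j)) (ideal_gen (g ` {1..j}))"
  using deformed_sequence[of g "\<lambda>_. 0"] g by auto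

text \<open>In f q = s q^a modulo (g_1, ..., g_n) a factor q can be cancelled, because q is a
  nonzerodivisor there.\<close>

lemma colon_perp: "colon (perp F) (ideal_gen {q}) = ideal_gen (insert (q ^ (a - 1)) (g ` {1..n}))"
proof (intro equalityI subsetI)
  have qa1: "q ^ a = q ^ (a - 1) * q" using a by (simp add: power_eq_if mult.commute)
  fix f assume "f \<in> colon (perp F) (ideal_gen {q})"
  then have "f * q \<in> perp F" using ideal_gen_base[of q "{q}"] by (auto simp: colon_def)
  then obtain s where "f * q - s * q ^ a \<in> ideal_gen (g ` {1..n})" by (auto simp: perp ideal_gen_insert_iff)
  then have "(f - s * q ^ (a - 1)) * q \<in> ideal_gen (g ` {1..n})" by (simp add: qa1 algebra_simps)
  then have "f - s * q ^ (a - 1) \<in> ideal_gen (g ` {1..n})" by (rule nzd_modD[OF nzd_q])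
  then show "f \<in> ideal_gen (insert (q ^ (a - 1)) (g ` {1..n}))" by (auto simp: ideal_gen_insert_iff)
next
  have qa1: "q ^ a = q ^ (a - 1) * q" using a by (simp add: power_eq_if mult.commute)
  fix f assume "f \<in> ideal_gen (insert (q ^ (a - 1)) (g ` {1..n}))"
  then obtain s where s: "f - s * q ^ (a - 1) \<in> ideal_gen (g ` {1..n})" by (auto simp: ideal_gen_insert_iff)
  show "f \<in> colon (perp F) (ideal_gen {q})" unfolding colon_def
  proof (intro CollectI ballI)
    fix h assume "h \<in> ideal_gen {q}"
    then obtain k where h: "h = k * q" by (auto simp: ideal_gen_singleton_iff)
    have "(f - s * q ^ (a - 1)) * h \<in> ideal_gen (g ` {1..n})" using s by (intro ideal_mult_right) auto
    moreover have "(f - s * q ^ (a - 1)) * h = f * h - (s * k) * q ^ a" by (simp add: h qa1 algebra_simps)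
    ultimately show "f * h \<in> perp F" unfolding perp ideal_gen_insert_iff by metis
  qed
qed

lemma colon_plus_q: "ideal_sum (colon (perp F) (ideal_gen {q})) (ideal_gen {q}) = ideal_gen (insert q (g ` {1..n}))"
proof -
  \<comment> \<open>Here a >= 2 enters: for a = 1 the generator q^(a-1) would be 1.\<close>
  have "q ^ (a - 1) = q ^ (a - 2) * q" using a by (simp add: power_Suc2[symmetric] Suc_diff_Suc numeral_2_eq_2 del: power_Suc)
  then have "q ^ (a - 1) \<in> ideal_gen (insert q (g ` {1..n}))"
    by (simp add: ideal_mult_left ideal_gen_base)
  then have "ideal_gen (insert (q ^ (a - 1)) (g ` {1..n}) \<union> {q}) = ideal_gen (insert q (g ` {1..n}))"
    using ideal_gen_superset[of "insert q (g ` {1..n})"] ideal_gen_superset[of "insert (q ^ (a - 1)) (g ` {1..n}) \<union> {q}"]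
    by (intro ideal_gen_eqI) auto
  then show ?thesis unfolding colon_perp ideal_sum_ideal_gen .
qed

lemma suminf_HF:
  "suminf (\<lambda>i. real (HF (ideal_sum (colon (perp F) (ideal_gen {q})) (ideal_gen {q})) i)) / real e = real (\<Prod>i=1..n. d i)"
proof -
  let ?B = "ideal_gen (insert q (g ` {1..n}))"
  obtain N where N: "\<And>i. i > N \<Longrightarrow> HF ?B i = 0"
    "\<And>M. M \<ge> N \<Longrightarrow> (\<Sum>i\<le>M. HF ?B i) = e * (\<Prod>i=1..n. d i)"
    using HF_complete_intersection[OF card g nzd_g q(2) nzd_q] by metis
  have "suminf (\<lambda>i. real (HF ?B i)) = (\<Sum>i\<le>N. real (HF ?B i))"
    using N(1) by (intro suminf_finite) auto
  also have "\<dots> = real (e * (\<Prod>i=1..n. d i))" by (simp only: N(2)[OF order_refl, symmetric] of_nat_sum)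
  finally show ?thesis unfolding colon_plus_q using e by simp
qed

text \<open>A regular sequence generates a proper ideal, whereas 0 is annihilated by 1. This
  identifies \<open>tdeg F\<close> with D.\<close>

lemma F_nonzero: "F \<noteq> 0"
proof
  assume "F = 0"
  then have "1 \<in> perp F" by (simp add: perp_def poly_mapping_eq_iff fun_eq_iff lookup_apolar)
  moreover have "set (q ^ a # map g [1..<n+1]) = insert (q ^ a) (g ` {1..n})" by (auto simp del: upt_Suc)
  ultimately show False using reg unfolding perp regular_sequence_def by metis
qed

text \<open>A constant F would be annihilated by every variable, but all generators of its
  annihilator have degree at least a e >= 2. Positivity serves the extraction of D-th roots.\<close>

lemma D_pos: "D > 0"
proof (rule ccontr)
  assume "\<not> D > 0"
  then have D: "D = 0" by simp
  fix v :: 'v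
  have "apolar (mvar v) F = 0"
  proof (rule poly_mapping_eqI)
    fix b
    have "lkp F (b + m) = 0" if "m \<in> keys (mvar v :: ('v, 'k) mpoly)" for m
    proof -
      have "mdeg (b + m) > 0" using that by (auto simp: mvar_def mdeg_add split: if_splits)
      then show ?thesis using F D by (auto simp: homog_iff)
    qed
    then show "lkp (apolar (mvar v) F) b = lkp 0 b" unfolding lookup_apolar by (simp add: sum.neutral)
  qed
  then have "mvar v \<in> ideal_gen (insert (q ^ a) (g ` {1..n}))" unfolding perp[symmetric] perp_def by simp
  moreover have "e * a \<ge> 2" using a e by (metis One_nat_def Suc_leI le_trans mult_le_mono1 mult_1)
  moreover have "\<exists>k. k \<ge> 2 \<and> homog k p" if "p \<in> insert (q ^ a) (g ` {1..n})" for p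
    using that
  proof
    assume "p = q ^ a"
    then show ?thesis using qa(1) \<open>e * a \<ge> 2\<close> by blast
  next
    assume "p \<in> g ` {1..n}"
    then obtain i where "i \<in> {1..n}" "p = g i" by blast
    then show ?thesis using g d \<open>e * a \<ge> 2\<close> by (metis le_trans mult.commute)
  qed
  ultimately have "mvar v = (0 :: ('v, 'k) mpoly)"
    by (intro ideal_gen_low_degree[of "insert (q ^ a) (g ` {1..n})" 2 "mvar v" 1] homog_mvar) simp_all
  then show False unfolding mvar_def by (metis lookup_single_eq lookup_zero zero_neq_one)
qed

lemma waring_decomposition:
  obtains r L where "r \<le> (\<Prod>i=1..n. d i)" "\<And>j. j < r \<Longrightarrow> homog 1 (L j)" "F = (\<Sum>j<r. L j ^ D)"
proof -
  \<comment> \<open>The degree of h_i; since d_i >= a e, the subtraction is exact.\<close>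
  define r where "r i = d i - e * a" for i
  obtain t c where tc: "t \<noteq> 0 \<and> (\<forall>f. f \<notin> ideal_gen (insert (q - cst t) (deform (q ^ a) r g c ` {1..n})) \<longrightarrow>
    (\<exists>x. (\<forall>j\<in>ideal_gen (deform (q ^ a) r g c ` {1..n}). mp_eval j x = 0) \<and> mp_eval f x \<noteq> 0))"
    using general_deformation[OF ac card q(2) e, of a r g] by (elim exE)
  note t = tc[THEN conjunct1] and pts = tc[THEN conjunct2, rule_format]
  define h where "h i = (\<Sum>w\<in>UNIV. cst (c i w) * mvar w ^ r i)" for i
  define g' where "g' = deform (q ^ a) r g c"
  have g'_eq: "g' i = g i + h i * q ^ a" for i by (simp add: g'_def deform_def h_def)
  define J where "J = ideal_gen (g' ` {1..n})"
  have hom: "homog (d i) (g' i)" if i: "i \<in> {1..n}" for i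
  proof -
    have "homog (1 * r i) (mvar w ^ r i :: ('v, 'k) mpoly)" for w by (intro homog_power homog_mvar)
    then have "homog (r i) (h i)" unfolding h_def by (intro homog_sum homog_cst_mult) simp
    then have "homog (r i + e * a) (h i * q ^ a)" using qa(1) by (rule homog_mult)
    moreover have "r i + e * a = d i" using d[OF i] by (simp add: r_def mult.commute)
    ultimately show ?thesis unfolding g'_eq using g[OF i] by (auto intro: homog_add)
  qed
  note def_seq = deformed_sequence[of g' h, OF g'_eq hom]
  have gr: "graded_set (ideal_gen (g' ` {1..n}))" using hom by (intro graded_ideal_gen) blast
  have "ideal_gen (insert (q ^ a) (g' ` {1..n})) = perp F" unfolding perp g'_eq by (rule ideal_gen_deform)
  then have Jperp: "J \<subseteq> perp F" unfolding J_def using ideal_gen_mono[of "g' ` {1..n}" "insert (q ^ a) (g' ` {1..n})"] by blast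
  \<comment> \<open>By contraposition: a form of degree D outside J stays outside when q = t is
    imposed, and then it is nonzero at some zero of J.\<close>
  have vanish: "f \<in> J" if f: "homog D f" "\<And>x. (\<And>j. j \<in> J \<Longrightarrow> mp_eval j x = 0) \<Longrightarrow> mp_eval f x = 0" for f
  proof (rule ccontr)
    assume "f \<notin> J"
    then have "f \<notin> ideal_gen (insert (q - cst t) (g' ` {1..n}))"
      using dehomogenize_mem[OF gr q(2) e def_seq(1) t f(1)] unfolding J_def by blast
    from pts[folded g'_def, OF this] show False using f(2) unfolding J_def by blast
  qed
  have J: "is_ideal J" by (simp add: J_def)
  have le: "HF J D \<le> (\<Prod>i=1..n. d i)" unfolding J_def by (rule HF_regular_le[OF card hom def_seq(2)])
  obtain r L where L: "r \<le> HF J D" "\<And>j. j < r \<Longrightarrow> homog 1 (L j)" "F = (\<Sum>j<r. L j ^ D)"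
    using waring_upper_bound[OF ac F D_pos J Jperp vanish] by metis
  show thesis by (rule that[OF order_trans[OF L(1) le] L(2,3)])
qed

lemma waring_rank_eq: "waring_rank F = (\<Prod>i=1..n. d i)"
proof -
  let ?R = "\<lambda>r. \<exists>L. (\<forall>j<r. homog 1 (L j)) \<and> F = (\<Sum>j<r. L j ^ D)"
  have rank: "waring_rank F = (LEAST r. ?R r)" by (simp add: waring_rank_def tdeg_homog[OF F F_nonzero])
  obtain r where r: "r \<le> (\<Prod>i=1..n. d i)" "?R r" using waring_decomposition by metis
  have "waring_rank F \<le> r" unfolding rank using r(2) by (rule Least_le)
  also have "r \<le> (\<Prod>i=1..n. d i)" by (rule r(1))
  finally have "waring_rank F \<le> (\<Prod>i=1..n. d i)" .
  moreover have "(\<Prod>i=1..n. d i) \<le> waring_rank F"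
  proof -
    let ?B = "ideal_gen (insert q (g ` {1..n}))"
    \<comment> \<open>The decomposition found above shows that the \<open>LEAST\<close> is attained,
      so the lower bound applies to a decomposition of minimal length.\<close>
    obtain L where L: "\<forall>j<waring_rank F. homog 1 (L j)" "F = (\<Sum>j<waring_rank F. L j ^ D)"
      using LeastI[of ?R r, OF r(2)] unfolding rank by blast
    have "F = (\<Sum>j<waring_rank F. linform (\<lambda>v. lkp (L j) (Poly_Mapping.single v 1)) ^ D)"
      by (subst L(2), rule sum.cong[OF refl]) (use L(1) homog_1_linform in \<open>metis lessThan_iff\<close>)
    then have "(\<Sum>i\<le>N. HF ?B i) \<le> e * waring_rank F" for N
    proof (rule waring_lower_bound[OF _ q(2)])
      show "q \<in> ?B" by (rule ideal_gen_base) simp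
      show "f \<in> ?B" if "f * q \<in> perp F" for f
      proof -
        have "f \<in> colon (perp F) (ideal_gen {q})" unfolding colon_def
        proof (intro CollectI ballI)
          fix h assume "h \<in> ideal_gen {q}"
          then obtain k where h: "h = k * q" by (auto simp: ideal_gen_singleton_iff)
          have "k * (f * q) \<in> perp F" using that unfolding perp by (rule ideal_mult_left[OF is_ideal_ideal_gen])
          then show "f * h \<in> perp F" by (simp add: h mult_ac)
        qed
        then have "f \<in> ideal_sum (colon (perp F) (ideal_gen {q})) (ideal_gen {q})"
          unfolding ideal_sum_def by (intro ideal_gen_base) simp
        then show ?thesis unfolding colon_plus_q .
      qed
    qed simp
    moreover obtain N where "\<And>M. M \<ge> N \<Longrightarrow> (\<Sum>i\<le>M. HF ?B i) = e * (\<Prod>i=1..n. d i)"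
      using HF_complete_intersection[OF card g nzd_g q(2) nzd_q] by metis
    ultimately have "e * (\<Prod>i=1..n. d i) \<le> e * waring_rank F" by (metis order_refl)
    then show ?thesis using e by simp
  qed
  ultimately show ?thesis by simp
qed

lemma rank_computed_by_q: "rank_computed_by F (ideal_gen {q}) e"
proof -
  \<comment> \<open>Degree e of (q) consists of the scalar multiples of q; the coordinate at a
    monomial of q singles out the nonzero ones.\<close>
  obtain m where m: "m \<in> keys q" using q(1) by (metis all_not_in_conv keys_eq_empty)
  let ?\<Phi> = "mvar m :: ('v \<Rightarrow>\<^sub>0 nat, 'k) mpoly"
  have ev: "mp_eval ?\<Phi> (lkp s) = lkp s m" for s :: "('v, 'k) mpoly" by (simp add: mp_eval_eq)
  have "q \<in> graded_part e (ideal_gen {q})" using q(2) by (simp add: mem_graded_part ideal_gen_base)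
  then have 1: "\<exists>s\<in>graded_part e (ideal_gen {q}). mp_eval ?\<Phi> (lkp s) \<noteq> 0"
    using m unfolding ev by (intro bexI[of _ q]) (auto simp: in_keys_iff)
  have 2: "\<forall>s\<in>graded_part e (ideal_gen {q}). mp_eval ?\<Phi> (lkp s) \<noteq> 0 \<longrightarrow> real (waring_rank F)
      = suminf (\<lambda>i. real (HF (ideal_sum (colon (perp F) (ideal_gen {q})) (ideal_gen {s})) i)) / real e"
  proof (intro ballI impI)
    fix s assume s: "s \<in> graded_part e (ideal_gen {q})" "mp_eval ?\<Phi> (lkp s) \<noteq> 0"
    then obtain k where k: "s = k * q" by (auto simp: mem_graded_part ideal_gen_singleton_iff)
    have "s = hcomp e s" using s(1) hcomp_homog[of e s e] by (simp add: mem_graded_part)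
    also have "\<dots> = hcomp 0 k * q" unfolding k using q(2) by (simp add: hcomp_mult_homog)
    also have "\<dots> = cst (lkp (hcomp 0 k) 0) * q" using homog_0_cst[OF homog_hcomp[of 0 k]] by simp
    finally obtain c where c: "s = cst c * q" by blast
    then have "c \<noteq> 0" using s(2) unfolding ev c by auto
    then have "q = cst (1 / c) * s" by (simp add: c mult.assoc[symmetric] cst_mult[symmetric])
    then have "ideal_gen {s} = ideal_gen {q}"
      by (intro ideal_gen_eqI) (auto simp: ideal_gen_singleton_iff c)
    then show "real (waring_rank F)
      = suminf (\<lambda>i. real (HF (ideal_sum (colon (perp F) (ideal_gen {q})) (ideal_gen {s})) i)) / real e"
      by (simp only: suminf_HF waring_rank_eq)
  qed
  show ?thesis
    unfolding rank_computed_by_def general_in_def using 1 2 by (intro exI[of _ ?\<Phi>] conjI)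
qed

end

theorem theorem4p14:
  fixes F q :: "('v::finite, 'k::field_char_0) mpoly"
    and g :: "nat \<Rightarrow> ('v, 'k) mpoly"
    and n a e :: nat and d :: "nat \<Rightarrow> nat"
  assumes "alg_closed_field TYPE('k)"
    and "CARD('v) = n + 1"
    and "\<exists>D. homog D F"
    and "perp F = ideal_gen (insert (q ^ a) (g ` {1..n}))"
    and "regular_sequence (q ^ a # map g [1..<n+1])"
    and "q \<noteq> 0" and "homog e q"
    and "\<forall>i\<in>{1..n}. g i \<noteq> 0 \<and> homog (d i) (g i)"
    and "a \<ge> 2" and "e > 0"
    and "n \<ge> 1 \<longrightarrow> a * e \<le> d 1"
    and "\<forall>i j. 1 \<le> i \<longrightarrow> i \<le> j \<longrightarrow> j \<le> n \<longrightarrow> d i \<le> d j"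
  shows "e_computable F e \<and> rank_computed_by F (ideal_gen {q}) e \<and>
         waring_rank F = (\<Prod>i=1..n. d i) \<and>
         real (waring_rank F) =
           suminf (\<lambda>i. real (HF (ideal_sum (colon (perp F) (ideal_gen {q})) (ideal_gen {q})) i)) / real e"
proof -
  obtain D where D: "homog D F" using assms(3) by blast
  have g: "homog (d i) (g i)" if "i \<in> {1..n}" for i using assms(8) that by blast
  have d: "a * e \<le> d i" if "i \<in> {1..n}" for i
  proof -
    have "a * e \<le> d 1" using assms(11) that by simp
    also have "d 1 \<le> d i" using assms(12) that by simp
    finally show ?thesis .
  qed
  note ctxt = assms(1,2) D assms(4-7) g assms(9,10) d
  have "rank_computed_by F (ideal_gen {q}) e" by (rule rank_computed_by_q[OF ctxt])
  moreover from this have "e_computable F e"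
    unfolding e_computable_def using assms(7) by (intro exI[of _ "{q}"]) simp
  moreover have "waring_rank F = (\<Prod>i=1..n. d i)" by (rule waring_rank_eq[OF ctxt])
  ultimately show ?thesis using suminf_HF[OF ctxt] by simp
qed

end
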